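(* Let $p\in[0,1]$ and let $n\ge 1$ be an integer. The distribution (under $\mathbb P$) of the skyline $\mathrm{skyline}_\ell(v,s,\sigma)$ on $\{1,\dots,n\}$ does not depend on $\ell\in\mathbb L_n$; that is, for all $\ell,\ell'\in\mathbb L_n$, the random variables $\mathrm{skyline}_\ell(v,s,\sigma)$ and $\mathrm{skyline}_{\ell'}(v,s,\sigma)$ have the same law.
   Context: **Model (fixed, shuffled lengths).** Let $n\ge1$, $p\in[0,1]$, and $\mathbb L_n=\{(\ell_1,\dots,\ell_n)\in(0,\infty)^n:\ell_1\le\cdots\le\ell_n\}$. On a probability space $(\Omega,\mathcal F,\mathbb P)$ let $v,s,\sigma$ be independent, where $v=(v_1,\dots,v_n)$ has i.i.d. coordinates with law $\frac{1-p}2\delta_{-1}+p\,\delta_0+\frac{1-p}2\delta_{+1}$; $s=(s_1,\dots,s_n)$ has i.i.d. coordinates uniform on $\{-1,+1\}$ ("spins"); and $\sigma$ is a uniform random permutation of $\{1,\dots,n\}$. For $\ell\in\mathbb L_n$ put $x_k=\ell_{\sigma(1)}+\cdots+\ell_{\sigma(k)}$ for $1\le k\le n$. **Dynamics.** At time $0$, particles $\bullet_1,\dots,\bullet_n$ start at $x_1<\dots<x_n$ on the real line and move at constant velocities $v_1,\dots,v_n$ until they are annihilated. When exactly two (not yet annihilated) particles meet, both are annihilated. When three particles meet (necessarily one right-moving, one static $\bullet_i$, one left-moving), the static particle and one of the two moving particles annihilate each other, and the other moving particle continues unperturbed: the left-moving one survives if $s_i=-1$, the right-moving one survives if $s_i=+1$.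 Annihilated particles are removed from the system. A particle "survives" if it is never annihilated. **Skyline.** The skyline $\mathrm{skyline}_\ell(v,s,\sigma)=((L_1,R_1,\Sigma_1),\dots,(L_S,R_S,\Sigma_S))$ is the family characterized by: the integer intervals $\{L_1,\dots,R_1\},\dots,\{L_S,\dots,R_S\}$, listed from left to right, partition $\{1,\dots,n\}$, and for each $k$ the "shape" $\Sigma_k\in\{\uparrow,\nwarrow,\nearrow,\nearrow\uparrow,\uparrow\nwarrow,\nearrow\nwarrow\}$ satisfies: - $\Sigma_k=\nwarrow$ if $v_{R_k}=-1$, all particles with index in $\{L_k,\dots,R_k-1\}$ are annihilated, and $\bullet_{R_k}$ survives; - $\Sigma_k=\nearrow$ if $v_{L_k}=+1$, all particles with index in $\{L_k+1,\dots,R_k\}$ are annihilated, and $\bullet_{L_k}$ survives; - $\Sigma_k=\uparrow$ if $R_k=L_k$, $v_{L_k}=0$ and $\bullet_{L_k}$ survives; - $\Sigma_k=\nearrow\uparrow$ if $v_{L_k}=+1$, $v_{R_k}=0$, $\bullet_{L_k}$ and $\bullet_{R_k}$ annihilate each other, and no particle ever hits location $x_{L_k}$ from the left or location $x_{R_k}$ from the right; - $\Sigma_k=\uparrow\nwarrow$ if $v_{L_k}=0$, $v_{R_k}=-1$, $\bullet_{L_k}$ and $\bullet_{R_k}$ annihilate each other, and no particle ever hits location $x_{L_k}$ from the left or location $x_{R_k}$ from the right; - $\Sigma_k=\nearrow\nwarrow$ if $v_{L_k}=+1$, $v_{R_k}=-1$, $\bullet_{L_k}$ and $\bullet_{R_k}$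 annihilate each other, and no particle ever hits location $x_{L_k}$ from the left or location $x_{R_k}$ from the right. (A particle "hits $x$ from the left (right)" if it starts strictly to the left (right) of $x$ and reaches $x$ before or when being annihilated.) This splits $\{1,\dots,n\}$ at indices of left- and right-going survivors and at endpoints of intervals never crossed by a particle, so the skyline is well defined. *)

theory Defs
  imports "HOL-Probability.Probability" "HOL-Combinatorics.Permutations"
begin

text \<open>Particles are indexed by \<open>{1..n}\<close>; values of the functions below outside this set are irrelevant.\<close>

definition lengths :: "nat \<Rightarrow> (nat \<Rightarrow> real) set" where
  "lengths n = {l. (\<forall>i\<in>{1..n}. 0 < l i) \<and> mono_on {1..n} l}"

definition start :: "(nat \<Rightarrow> real) \<Rightarrow> (nat \<Rightarrow> nat) \<Rightarrow> nat \<Rightarrow> real" where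
  "start l \<sigma> k = (\<Sum>i=1..k. l (\<sigma> i))"

datatype shape = Up | NW | NE | NE_Up | Up_NW | NE_NW

context
  fixes n :: nat
    and x :: "nat \<Rightarrow> real"  \<comment> \<open>starting positions\<close>
    and v :: "nat \<Rightarrow> int"  \<comment> \<open>velocities\<close>
    and s :: "nat \<Rightarrow> int"  \<comment> \<open>spins\<close>
begin

definition pos :: "nat \<Rightarrow> real \<Rightarrow> real" where
  "pos i t = x i + of_int (v i) * t"

text \<open>The triples \<open>(i, j, t)\<close> such that particles \<open>i < j\<close> of \<open>A\<close> would meet at time \<open>t\<close> if no
  particle were ever removed.\<close>

definition meetings :: "nat set \<Rightarrow> (nat \<times> nat \<times> real) set" where
  "meetings A = {(i, j, t). i \<in> A \<and> j \<in> A \<and> i < j \<and> 0 < t \<and> pos i t = pos j t}"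

text \<open>The mutual annihilations taking place at the first meeting time of the particles in \<open>A\<close>.
  If a third particle \<open>k\<close> is present, then \<open>i\<close> and \<open>j\<close> annihilate each other only if one of them is
  the static particle and its spin lets \<open>k\<close> survive: \<open>k\<close> is right-moving when \<open>i\<close> is static,
  left-moving when \<open>j\<close> is static.\<close>

definition first_annihilations :: "nat set \<Rightarrow> (nat \<times> nat \<times> real) set" where
  "first_annihilations A = {(i, j, t). (i, j, t) \<in> meetings A \<and>
     (\<forall>(i', j', t') \<in> meetings A. t \<le> t') \<and>
     (\<forall>k \<in> A - {i, j}. pos k t = pos i t \<longrightarrow> v i = 0 \<and> s i = 1 \<or> v j = 0 \<and> s j = -1)}"

text \<open>The particles that remain after the first \<open>m\<close> distinct times at which annihilations occur.\<close>

primrec remaining :: "nat \<Rightarrow> nat set" where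
  "remaining 0 = {1..n}"
| "remaining (Suc m) = remaining m -
     (\<Union>(i, j, t) \<in> first_annihilations (remaining m). {i, j})"

definition annihilations :: "(nat \<times> nat \<times> real) set" where
  "annihilations = (\<Union>m. first_annihilations (remaining m))"

definition annihilate_each_other :: "nat \<Rightarrow> nat \<Rightarrow> bool" where
  "annihilate_each_other i j \<longleftrightarrow> (\<exists>t. (i, j, t) \<in> annihilations \<or> (j, i, t) \<in> annihilations)"

definition annihilated_at :: "nat \<Rightarrow> real \<Rightarrow> bool" where
  "annihilated_at i t \<longleftrightarrow> (\<exists>j. (i, j, t) \<in> annihilations \<or> (j, i, t) \<in> annihilations)"

definition annihilated :: "nat \<Rightarrow> bool" where
  "annihilated i \<longleftrightarrow> (\<exists>t. annihilated_at i t)"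

definition reaches :: "nat \<Rightarrow> real \<Rightarrow> bool" where
  "reaches i y \<longleftrightarrow> (\<exists>t\<ge>0. pos i t = y \<and> (\<forall>u. annihilated_at i u \<longrightarrow> t \<le> u))"

definition hit_from_left :: "real \<Rightarrow> bool" where
  "hit_from_left y \<longleftrightarrow> (\<exists>i\<in>{1..n}. x i < y \<and> reaches i y)"

definition hit_from_right :: "real \<Rightarrow> bool" where
  "hit_from_right y \<longleftrightarrow> (\<exists>i\<in>{1..n}. y < x i \<and> reaches i y)"

fun has_shape :: "nat \<Rightarrow> nat \<Rightarrow> shape \<Rightarrow> bool" where
  "has_shape L R NW \<longleftrightarrow> v R = -1 \<and> (\<forall>i\<in>{L..<R}. annihilated i) \<and> \<not> annihilated R"
| "has_shape L R NE \<longleftrightarrow> v L = 1 \<and> (\<forall>i\<in>{L<..R}. annihilated i) \<and> \<not> annihilated L"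
| "has_shape L R Up \<longleftrightarrow> R = L \<and> v L = 0 \<and> \<not> annihilated L"
| "has_shape L R NE_Up \<longleftrightarrow> v L = 1 \<and> v R = 0 \<and> annihilate_each_other L R \<and>
     \<not> hit_from_left (x L) \<and> \<not> hit_from_right (x R)"
| "has_shape L R Up_NW \<longleftrightarrow> v L = 0 \<and> v R = -1 \<and> annihilate_each_other L R \<and>
     \<not> hit_from_left (x L) \<and> \<not> hit_from_right (x R)"
| "has_shape L R NE_NW \<longleftrightarrow> v L = 1 \<and> v R = -1 \<and> annihilate_each_other L R \<and>
     \<not> hit_from_left (x L) \<and> \<not> hit_from_right (x R)"

definition is_skyline :: "(nat \<times> nat \<times> shape) list \<Rightarrow> bool" where
  "is_skyline bs \<longleftrightarrow>
     (\<forall>(L, R, \<Sigma>) \<in> set bs. L \<le> R \<and> has_shape L R \<Sigma>) \<and>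
     sorted_wrt (\<lambda>(L, R, \<Sigma>) (L', R', \<Sigma>'). R < L') bs \<and>
     (\<Union>(L, R, \<Sigma>) \<in> set bs. {L..R}) = {1..n}"

end

definition skyline ::
  "nat \<Rightarrow> (nat \<Rightarrow> real) \<Rightarrow> (nat \<Rightarrow> int) \<Rightarrow> (nat \<Rightarrow> int) \<Rightarrow> (nat \<Rightarrow> nat) \<Rightarrow> (nat \<times> nat \<times> shape) list"
  where "skyline n l v s \<sigma> = (THE bs. is_skyline n (start l \<sigma>) v s bs)"

text \<open>\<open>indep_vars\<close> requires variables of the same type, so mutual independence of the families
  \<open>v\<close>, \<open>s\<close> and of \<open>\<sigma>\<close> is stated through the \<open>\<sigma>\<close>-algebras they generate.\<close>

locale particle_model = prob_space M for M :: "'w measure" +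
  fixes n :: nat and p :: real
    and v s :: "nat \<Rightarrow> 'w \<Rightarrow> int"
    and \<sigma> :: "'w \<Rightarrow> nat \<Rightarrow> nat"
  assumes v_indep: "indep_vars (\<lambda>_. count_space UNIV) v {1..n}"
    and v_law: "\<And>i. i \<in> {1..n} \<Longrightarrow> prob {\<omega> \<in> space M. v i \<omega> = -1} = (1 - p) / 2"
      "\<And>i. i \<in> {1..n} \<Longrightarrow> prob {\<omega> \<in> space M. v i \<omega> = 0} = p"
      "\<And>i. i \<in> {1..n} \<Longrightarrow> prob {\<omega> \<in> space M. v i \<omega> = 1} = (1 - p) / 2"
    and s_indep: "indep_vars (\<lambda>_. count_space UNIV) s {1..n}"
    and s_law: "\<And>i. i \<in> {1..n} \<Longrightarrow>
      distr M (count_space UNIV) (s i) = measure_pmf (pmf_of_set {-1, 1})"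
    and \<sigma>_rv: "random_variable (count_space UNIV) \<sigma>"
    and \<sigma>_law: "distr M (count_space UNIV) \<sigma> = measure_pmf (pmf_of_set {\<pi>. \<pi> permutes {1..n}})"
    and v_s_\<sigma>_indep: "indep_sets (\<lambda>k. sets
      ([vimage_algebra (space M) (\<lambda>\<omega>. \<lambda>i\<in>{1..n}. v i \<omega>) (Pi\<^sub>M {1..n} (\<lambda>_. count_space UNIV)),
        vimage_algebra (space M) (\<lambda>\<omega>. \<lambda>i\<in>{1..n}. s i \<omega>) (Pi\<^sub>M {1..n} (\<lambda>_. count_space UNIV)),
        vimage_algebra (space M) \<sigma> (count_space UNIV)] ! k)) {0, 1, 2}"

end

theory Submission imports Defs begin

text \<open>
  A skyline cuts the particles into consecutive blocks, and no particle of one block ever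
  influences another block. So a list of intervals with shapes is the skyline if and only if
  (1) each interval, run in isolation, forms a single block of the given shape, and
  (2) the shapes \<open>\<nwarrow>\<close> come before the shapes without a survivor crossing their borders, and these
  come before the shapes \<open>\<nearrow>\<close> (\<open>decomposition\<close>, \<open>is_skyline_iff_decomposition\<close>).
  The lengths are uniformly shuffled and the velocities and spins are i.i.d.; hence, given which
  lengths fall into which interval, the blocks are independent and the lengths inside each of
  them are again uniformly shuffled (\<open>pr_factor\<close>). It therefore suffices that, for every shape,
  the probability that a whole interval forms one block of that shape does not depend on the
  lengths (\<open>universal_block\<close>). This is proved by induction on the number of particles of \<open>{a..b}\<close>.

  \<^item> \<open>\<uparrow>\<close> only concerns the velocity of a single particle. \<open>\<uparrow>\<nwarrow>\<close> occurs if and only if \<open>a\<close> is static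
  and the others form a block \<open>\<nwarrow>\<close> (\<open>block_Up_NW_iff\<close>), which is a shorter interval.

  \<^item> For \<open>\<nwarrow>\<close> with at least two particles, let \<open>k\<close> be the particle that annihilates \<open>a\<close>. Then
  \<open>{a..k}\<close> is a block in which \<open>a\<close> and \<open>k\<close> annihilate each other, and \<open>{k+1..b}\<close> is a block \<open>\<nwarrow>\<close>
  (\<open>block_NW_cases\<close>, \<open>block_then_NW\<close>). These conditions are also sufficient, except when
  \<open>k\<close> is static: then \<open>a\<close> must reach \<open>k\<close> before \<open>b\<close> would, that is, either
  \<open>x k - x a < x b - x k\<close>, or equality holds and the spin of \<open>k\<close> favours \<open>b\<close>.
  This is the only place where the lengths matter. Reversing the whole interval exchanges this
  condition with its negation, while the event that some static \<open>k\<close> is attacked from both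
  sides is preserved. So the condition contributes exactly a factor one half
  (\<open>pr_contested_wins\<close>), and what remains are products over shorter intervals.

  \<^item> \<open>\<nearrow>\<close> and \<open>\<nearrow>\<uparrow>\<close> are the mirror images of \<open>\<nwarrow>\<close> and \<open>\<uparrow>\<nwarrow>\<close>.

  \<^item> Every configuration has exactly one skyline, so the probabilities of all lists of blocks add
  up to one. All lists except the single block \<open>\<nearrow>\<nwarrow>\<close> have been dealt with, hence so has this one.

  To reason about the dynamics, the step-by-step simulation is replaced by its result: the set of
  all annihilations \<open>(i, j, t)\<close> is the unique solution of a fixed-point condition (\<open>history\<close>).
  Claims about runs on different sets of particles then reduce to checking that a proposed set
  of annihilations satisfies this condition; the central instance is \<open>join\<close>, which says when the
  histories of two adjacent intervals can be put together or taken apart.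
\<close>

section \<open>The dynamics as a fixed point\<close>

text \<open>With the non-strict inequality a particle still counts as alive at the moment of its own
  annihilation, so that it takes part in the meeting in which it disappears.\<close>
definition alive :: "(nat \<times> nat \<times> real) set \<Rightarrow> nat \<Rightarrow> real \<Rightarrow> bool" where
  "alive E i t \<longleftrightarrow> (\<forall>j k u. (j, k, u) \<in> E \<longrightarrow> i = j \<or> i = k \<longrightarrow> t \<le> u)"

definition matched :: "(nat \<times> nat \<times> real) set \<Rightarrow> nat \<Rightarrow> bool" where
  "matched E i \<longleftrightarrow> (\<exists>j k u. (j, k, u) \<in> E \<and> (i = j \<or> i = k))"

text \<open>Positions increase on all of \<open>nat\<close>, and velocities and spins are constrained for all
  indices, so that shifted and mirrored systems and systems on subintervals are again instances.\<close>
locale particles =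
  fixes x :: "nat \<Rightarrow> real" and v s :: "nat \<Rightarrow> int"
  assumes x_mono: "strict_mono x"
    and v_range: "v i \<in> {-1, 0, 1}"
    and s_range: "s i \<in> {-1, 1}"
begin

abbreviation P :: "nat \<Rightarrow> real \<Rightarrow> real" where "P \<equiv> pos x v"

text \<open>If \<open>S\<close> is the set of particles alive at time \<open>t\<close>, then \<open>i\<close> and \<open>j\<close> are removed together at
  time \<open>t\<close>. The last clause is the spin rule of triple meetings, as in \<open>first_annihilations\<close>.\<close>
definition resolved :: "nat set \<Rightarrow> nat \<Rightarrow> nat \<Rightarrow> real \<Rightarrow> bool" where
  "resolved S i j t \<longleftrightarrow> i \<in> S \<and> j \<in> S \<and> i < j \<and> 0 < t \<and> P i t = P j t \<and>
     (\<forall>k\<in>S - {i, j}. P k t = P i t \<longrightarrow> v i = 0 \<and> s i = 1 \<or> v j = 0 \<and> s j = -1)"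

text \<open>The condition is not circular: whether \<open>k\<close> is alive at time \<open>t\<close> only depends on the triples
  of \<open>E\<close> with time less than \<open>t\<close>. This is why at most one \<open>E\<close> satisfies it.\<close>
definition history :: "nat set \<Rightarrow> (nat \<times> nat \<times> real) set \<Rightarrow> bool" where
  "history A E \<longleftrightarrow> (\<forall>i j t. (i, j, t) \<in> E \<longleftrightarrow> resolved {k \<in> A. alive E k t} i j t)"

lemma x_less: "i < j \<Longrightarrow> x i < x j"
  using x_mono by (simp add: strict_mono_def)

lemma x_le: "i \<le> j \<Longrightarrow> x i \<le> x j"
  using x_mono by (simp add: strict_mono_less_eq)

lemma P_simps: "v i = 0 \<Longrightarrow> P i t = x i" "v i = 1 \<Longrightarrow> P i t = x i + t" "v i = -1 \<Longrightarrow> P i t = x i - t"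
  by (simp_all add: pos_def)

lemma s_cases: obtains "s i = -1" | "s i = 1"
  using s_range[of i] by auto

lemma velocity_order:
  assumes "i < j" "0 \<le> t" "P i t = P j t" shows "v j < v i"
proof (rule ccontr)
  assume "\<not> v j < v i"
  then have "of_int (v i) * t \<le> of_int (v j) * t"
    using assms(2) by (intro mult_right_mono) auto
  then show False using x_less[OF assms(1)] assms(3) by (simp add: pos_def)
qed

lemma triple_velocities:
  assumes "i < j" "j < k" "0 \<le> t" "P i t = P j t" "P j t = P k t"
  shows "v i = 1" "v j = 0" "v k = -1"
  using velocity_order[of i j t] velocity_order[of j k t] assms
    v_range[of i] v_range[of j] v_range[of k] by auto

text \<open>Particles at the same place have distinct velocities, so at most three of them can meet; in
  a triple meeting the spin selects one of the two pairs containing the static particle. Hence a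
  meeting never passes without an annihilation, at least one of any two particles
  present disappears, and a static particle that is hit always disappears.\<close>
lemma resolved_exists:
  assumes "i \<in> S" "j \<in> S" "i < j" "0 < t" "P i t = P j t"
  shows "\<exists>i' j'. resolved S i' j' t \<and> P i' t = P i t \<and> (i \<in> {i', j'} \<or> j \<in> {i', j'}) \<and>
    (v i = 0 \<longrightarrow> i \<in> {i', j'}) \<and> (v j = 0 \<longrightarrow> j \<in> {i', j'})"
proof (cases "\<exists>k\<in>S - {i, j}. P k t = P i t")
  case False
  then have "resolved S i j t" using assms by (auto simp: resolved_def)
  then show ?thesis by blast
next
  case True
  then obtain k where k: "k \<in> S" "k \<noteq> i" "k \<noteq> j" "P k t = P i t" by auto
  \<comment> \<open>Sorting the three particles by index sorts them by decreasing velocity.\<close>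
  obtain a b c where abc: "a < b" "b < c" "{a, b, c} = {i, j, k}"
  proof -
    consider "k < i" | "i < k" "k < j" | "j < k" using k by linarith
    then show thesis
    proof cases
      case 1 then show thesis using that[of k i j] assms by auto
    next
      case 2 then show thesis using that[of i k j] assms by auto
    next
      case 3 then show thesis using that[of i j k] assms by auto
    qed
  qed
  have "m \<in> S \<and> P m t = P i t" if "m \<in> {a, b, c}" for m
    using that assms k unfolding abc(3) by auto
  then have in_S: "a \<in> S" "b \<in> S" "c \<in> S" and ps: "P a t = P i t" "P b t = P i t" "P c t = P i t"
    by auto
  have vs: "v a = 1" "v b = 0" "v c = -1"
    using triple_velocities[of a b c t] abc ps assms by auto
  have ij: "i \<in> {a, b, c}" "j \<in> {a, b, c}" "i \<noteq> j" using abc assms by auto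
  show ?thesis
  proof (cases rule: s_cases[of b])
    case 1
    then have "resolved S a b t" using abc in_S ps vs assms by (auto simp: resolved_def)
    then show ?thesis using ij vs ps by (intro exI[of _ a] exI[of _ b]) auto
  next
    case 2
    then have "resolved S b c t" using abc in_S ps vs assms by (auto simp: resolved_def)
    then show ?thesis using ij vs ps by (intro exI[of _ b] exI[of _ c]) auto
  qed
qed

text \<open>Two different pairs sharing a particle would be a triple meeting in which both pairs obey the
  spin rule; both would then contain the static particle, and its spin picks one of them.\<close>
lemma resolved_unique:
  assumes "resolved S i j t" "resolved S i' j' t" "{i, j} \<inter> {i', j'} \<noteq> {}"
  shows "i = i' \<and> j = j'"
proof (rule ccontr)
  assume ne: "\<not> (i = i' \<and> j = j')"
  have r: "i \<in> S" "j \<in> S" "i < j" "0 < t" "P i t = P j t"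
    "\<And>k. k \<in> S \<Longrightarrow> k \<noteq> i \<Longrightarrow> k \<noteq> j \<Longrightarrow> P k t = P i t \<Longrightarrow> v i = 0 \<and> s i = 1 \<or> v j = 0 \<and> s j = -1"
    using assms(1) by (auto simp: resolved_def)
  have r': "i' \<in> S" "j' \<in> S" "i' < j'" "P i' t = P j' t"
    "\<And>k. k \<in> S \<Longrightarrow> k \<noteq> i' \<Longrightarrow> k \<noteq> j' \<Longrightarrow> P k t = P i' t \<Longrightarrow> v i' = 0 \<and> s i' = 1 \<or> v j' = 0 \<and> s j' = -1"
    using assms(2) by (auto simp: resolved_def)
  have same: "P i' t = P i t" using assms(3) r r' by auto
  obtain k where k: "k \<in> {i', j'}" "k \<noteq> i" "k \<noteq> j"
    using ne r(3) r'(3) by (metis insertCI not_less_iff_gr_or_eq order_less_trans)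
  obtain k' where k': "k' \<in> {i, j}" "k' \<noteq> i'" "k' \<noteq> j'"
    using ne r(3) r'(3) by (metis insertCI not_less_iff_gr_or_eq order_less_trans)
  have A: "v i = 0 \<and> s i = 1 \<or> v j = 0 \<and> s j = -1" using r(6)[of k] k r' same by auto
  have B: "v i' = 0 \<and> s i' = 1 \<or> v j' = 0 \<and> s j' = -1" using r'(5)[of k'] k' r same by auto
  have e: "m = m'" if "m \<in> {i, j, i', j'}" "m' \<in> {i, j, i', j'}" "v m = v m'" for m m'
    using velocity_order[of m m' t] velocity_order[of m' m t] that r r' same
    by (metis insertE less_irrefl linorder_neqE_nat order.strict_implies_order singletonD)
  show False
  proof (cases "v i = 0 \<and> s i = 1")
    case True
    have "\<not> (v j' = 0 \<and> s j' = -1)" using e[of i j'] True by auto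
    then have "i' = i" using B e[of i i'] True by auto
    then have "j \<noteq> j'" using ne by auto
    moreover have "v j < v i" "v j' < v i'" using velocity_order[of i j t] velocity_order[of i' j' t] r r' by auto
    ultimately show False using e[of j j'] \<open>i' = i\<close> True v_range[of j] v_range[of j'] by auto
  next
    case False
    then have j: "v j = 0 \<and> s j = -1" using A by blast
    have "\<not> (v i' = 0 \<and> s i' = 1)" using e[of j i'] j by auto
    then have "j' = j" using B e[of j j'] j by auto
    then have "i \<noteq> i'" using ne by auto
    moreover have "v j < v i" "v j' < v i'" using velocity_order[of i j t] velocity_order[of i' j' t] r r' by auto
    ultimately show False using e[of i i'] \<open>j' = j\<close> j v_range[of i] v_range[of i'] by auto
  qed
qed

lemma finite_meetings:
  assumes "finite A" shows "finite (meetings x v A)"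
proof -
  have "meetings x v A \<subseteq> (\<lambda>(i, j). (i, j, (x j - x i) / of_int (v i - v j))) ` (A \<times> A)"
  proof clarsimp
    fix i j t assume "(i, j, t) \<in> meetings x v A"
    then have *: "i \<in> A" "j \<in> A" "i < j" "0 < t" "P i t = P j t" by (auto simp: meetings_def)
    then have "v j < v i" using velocity_order[of i j t] by auto
    then have "t = (x j - x i) / (of_int (v i) - of_int (v j))"
      using *(5) by (simp add: pos_def field_simps)
    then show "(i, j, t) \<in> (\<lambda>(i, j). (i, j, (x j - x i) / (of_int (v i) - of_int (v j)))) ` (A \<times> A)"
      using * by auto
  qed
  then show ?thesis using assms finite_subset by blast
qed

text \<open>Two histories agree up to the first time at which they differ, so the same particles are
  alive at that time, and then the condition forces them to agree there as well.\<close>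
lemma history_unique:
  assumes "finite A" "history A E" "history A F"
  shows "E = F"
proof (rule ccontr)
  let ?D = "(E - F) \<union> (F - E)"
  assume "E \<noteq> F"
  have sub: "E \<subseteq> meetings x v A" "F \<subseteq> meetings x v A"
    using assms(2,3) by (auto simp: history_def resolved_def meetings_def)
  have fin: "finite ((\<lambda>(i, j, t). t) ` ?D)"
    using finite_meetings[OF assms(1)] sub by (meson Diff_subset Un_least finite_imageI finite_subset order_trans)
  have ne: "(\<lambda>(i, j, t). t) ` ?D \<noteq> {}" using \<open>E \<noteq> F\<close> by auto
  define T where "T = Min ((\<lambda>(i, j, t). t) ` ?D)"
  have le: "T \<le> t" if "(i, j, t) \<in> ?D" for i j t
    unfolding T_def using fin that by (intro Min_le) force+
  have "T \<in> (\<lambda>(i, j, t). t) ` ?D" unfolding T_def using fin ne by (rule Min_in)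
  then obtain i j where ij: "(i, j, T) \<in> ?D" by auto
  have "alive E k T = alive F k T" for k
    unfolding alive_def using le by (smt (verit) Diff_iff UnCI)
  then have "(i, j, T) \<in> E \<longleftrightarrow> (i, j, T) \<in> F"
    using assms(2,3) unfolding history_def by simp
  then show False using ij by auto
qed

text \<open>The recursion of \<open>remaining\<close>, started from an arbitrary set of particles.\<close>
primrec rest :: "nat set \<Rightarrow> nat \<Rightarrow> nat set" where
  "rest A 0 = A"
| "rest A (Suc m) = rest A m - (\<Union>(i, j, t) \<in> first_annihilations x v s (rest A m). {i, j})"

lemma first_annihilations_alt:
  "(i, j, t) \<in> first_annihilations x v s A \<longleftrightarrow>
    resolved A i j t \<and> (\<forall>(i', j', t') \<in> meetings x v A. t \<le> t')"
  by (auto simp: first_annihilations_def meetings_def resolved_def)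

lemma rest_decseq: "m \<le> m' \<Longrightarrow> rest A m' \<subseteq> rest A m"
  by (induction m' rule: dec_induct) auto

lemma finite_rest: "finite A \<Longrightarrow> finite (rest A m)"
  using rest_decseq[of 0 m A] by (simp add: finite_subset)

lemma first_annihilations_nonempty:
  assumes "finite A" "meetings x v A \<noteq> {}"
  shows "first_annihilations x v s A \<noteq> {}"
proof -
  let ?t = "\<lambda>(i, j, t). t::real"
  have fin: "finite (?t ` meetings x v A)" using finite_meetings[OF assms(1)] by simp
  have "Min (?t ` meetings x v A) \<in> ?t ` meetings x v A" using fin assms(2) by (intro Min_in) auto
  then obtain i j t where ij: "(i, j, t) \<in> meetings x v A" "t = Min (?t ` meetings x v A)" by force
  have le: "\<forall>(i', j', t') \<in> meetings x v A. t \<le> t'"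
  proof clarify
    fix i' j' t' assume "(i', j', t') \<in> meetings x v A"
    then have "t' \<in> ?t ` meetings x v A" by force
    then show "t \<le> t'" using fin ij(2) by simp
  qed
  obtain i' j' where "resolved A i' j' t"
    using resolved_exists[of i A j t] ij by (auto simp: meetings_def)
  then have "(i', j', t) \<in> first_annihilations x v s A" using le by (simp add: first_annihilations_alt)
  then show ?thesis by auto
qed

text \<open>Every meeting at the earliest meeting time removes one of its two participants, so all
  meetings among the remaining particles happen strictly later.\<close>
lemma meetings_after:
  assumes "(i, j, t) \<in> first_annihilations x v s (rest A m)" "(i', j', t') \<in> meetings x v (rest A m')" "m < m'"
  shows "t < t'"
proof -
  have sub: "rest A m' \<subseteq> rest A (Suc m)" "rest A m' \<subseteq> rest A m"
    using assms(3) rest_decseq[of "Suc m" m' A] rest_decseq[of m m' A] by simp_all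
  then have m: "(i', j', t') \<in> meetings x v (rest A m)" "i' \<in> rest A (Suc m)" "j' \<in> rest A (Suc m)"
    using assms(2) by (auto simp: meetings_def)
  have le: "t \<le> t'" using assms(1) m by (auto simp: first_annihilations_alt)
  moreover have "t \<noteq> t'"
  proof
    assume "t = t'"
    obtain a b where ab: "resolved (rest A m) a b t" "i' \<in> {a, b} \<or> j' \<in> {a, b}"
      using resolved_exists[of i' "rest A m" j' t] m(1) \<open>t = t'\<close> unfolding meetings_def by blast
    then have "(a, b, t) \<in> first_annihilations x v s (rest A m)"
      using assms(1) by (auto simp: first_annihilations_alt)
    then show False using m(2,3) ab(2) by (auto simp only: rest.simps)
  qed
  ultimately show ?thesis by simp
qed

lemma first_annihilations_subset: "first_annihilations x v s A \<subseteq> meetings x v A"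
  by (auto simp: first_annihilations_def)

text \<open>By \<open>meetings_after\<close>, step \<open>m\<close> of the simulation takes place at a time when exactly the
  particles \<open>rest A m\<close> are alive. Conversely, a resolved pair cannot remain forever,
  since as long as it remains each step removes a particle from a finite set; and the step which
  removes one of its members can only happen at the time of their meeting.\<close>
lemma simulation_history:
  assumes "finite A"
  shows "history A (\<Union>m. first_annihilations x v s (rest A m))" (is "history A ?E")
  unfolding history_def
proof (intro allI iffI)
  have first: "t \<le> u" if "(i, j, t) \<in> first_annihilations x v s (rest A m)"
    "(a, b, u) \<in> first_annihilations x v s (rest A m')" "m \<le> m'" for i j t a b u m m'
  proof (cases "m = m'")
    case True
    then show ?thesis using that by (auto simp: first_annihilations_alt first_annihilations_def)
  next
    case False
    then show ?thesis using that meetings_after[of i j t A m a b u m'] first_annihilations_subset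
      by (meson le_neq_implies_less less_imp_le subsetD)
  qed
  have gone: "k \<notin> rest A m" if "(a, b, u) \<in> first_annihilations x v s (rest A m')" "k = a \<or> k = b" "m' < m" for a b u k m m'
  proof -
    have "k \<notin> rest A (Suc m')" using that(1,2) by auto
    then show ?thesis using rest_decseq[of "Suc m'" m A] that(3) by auto
  qed
  fix i j t
  {
    assume "(i, j, t) \<in> ?E"
    then obtain m where m: "(i, j, t) \<in> first_annihilations x v s (rest A m)" by auto
    then have res: "resolved (rest A m) i j t" by (simp add: first_annihilations_alt)
    have al: "alive ?E k t" if "k \<in> rest A m" for k
      unfolding alive_def
    proof (intro allI impI)
      fix a b u assume "(a, b, u) \<in> ?E" "k = a \<or> k = b"
      then obtain m' where m': "(a, b, u) \<in> first_annihilations x v s (rest A m')" by auto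
      then have "m \<le> m'" using gone[OF m' \<open>k = a \<or> k = b\<close>, of m] that by force
      then show "t \<le> u" using first m m' by auto
    qed
    have present: "k \<in> rest A m" if k: "k \<in> A" "alive ?E k t" for k
    proof (rule ccontr)
      assume out: "k \<notin> rest A m"
      have "\<exists>m'<m. \<exists>a b u. (a, b, u) \<in> first_annihilations x v s (rest A m') \<and> (k = a \<or> k = b)"
        using out
      proof (induction m)
        case 0 then show ?case using k by simp
      next
        case (Suc m)
        show ?case
        proof (cases "k \<in> rest A m")
          case True
          then have "\<exists>a b u. (a, b, u) \<in> first_annihilations x v s (rest A m) \<and> (k = a \<or> k = b)"
            using Suc.prems by fastforce
          then show ?thesis by blast
        next
          case False
          then show ?thesis using Suc.IH less_Suc_eq by blast
        qed
      qed
      then obtain m' a b u where *: "m' < m" "(a, b, u) \<in> first_annihilations x v s (rest A m')" "k = a \<or> k = b"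
        by blast
      then have "u < t" using meetings_after[OF *(2), of i j t m] m first_annihilations_subset by blast
      moreover have "t \<le> u" using k(2) * unfolding alive_def by blast
      ultimately show False by simp
    qed
    have "rest A m \<subseteq> A" using rest_decseq[of 0 m A] by simp
    then have "{k \<in> A. alive ?E k t} = rest A m" using al present by blast
    then show "resolved {k \<in> A. alive ?E k t} i j t" using res by simp
  }
  assume res: "resolved {k \<in> A. alive ?E k t} i j t"
  have "\<exists>m. i \<notin> rest A m \<or> j \<notin> rest A m"
  proof (rule ccontr)
    assume "\<not> ?thesis"
    then have "meetings x v (rest A m) \<noteq> {}" for m
      using res by (fastforce simp: meetings_def resolved_def)
    then have "first_annihilations x v s (rest A m) \<noteq> {}" for m
      using first_annihilations_nonempty finite_rest assms by blast
    then have strict_dec: "rest A (Suc m) \<subset> rest A m" for m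
    proof -
      obtain a b u where "(a, b, u) \<in> first_annihilations x v s (rest A m)"
        using \<open>first_annihilations x v s (rest A m) \<noteq> {}\<close> by auto
      moreover from this have "a \<in> rest A m" by (auto simp: first_annihilations_alt resolved_def)
      ultimately show ?thesis by auto
    qed
    have "card (rest A m) + m \<le> card A" for m
    proof (induction m)
      case (Suc m)
      have "card (rest A (Suc m)) < card (rest A m)"
        using psubset_card_mono[OF finite_rest[OF assms] strict_dec] .
      then show ?case using Suc by linarith
    qed simp
    from this[of "Suc (card A)"] show False by simp
  qed
  moreover have "i \<in> rest A 0 \<and> j \<in> rest A 0" using res by (auto simp: resolved_def)
  ultimately have "\<exists>m. (i \<in> rest A m \<and> j \<in> rest A m) \<and> \<not> (i \<in> rest A (Suc m) \<and> j \<in> rest A (Suc m))"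
    using nat_induct[of "\<lambda>m. i \<in> rest A m \<and> j \<in> rest A m"] by blast
  then obtain m where m: "i \<in> rest A m" "j \<in> rest A m" "i \<notin> rest A (Suc m) \<or> j \<notin> rest A (Suc m)"
    by blast
  then obtain a b u where abu: "(a, b, u) \<in> first_annihilations x v s (rest A m)" "i = a \<or> i = b \<or> j = a \<or> j = b"
    by fastforce
  have mt: "(i, j, t) \<in> meetings x v (rest A m)" using res m by (auto simp: meetings_def resolved_def)
  then have "u \<le> t" using abu by (auto simp: first_annihilations_alt)
  moreover have "(a, b, u) \<in> ?E" using abu(1) by blast
  then have "t \<le> u" using abu(2) res unfolding resolved_def alive_def by blast
  ultimately have "u = t" by simp
  have al: "alive ?E k t" if "k \<in> rest A m" for k
    unfolding alive_def
  proof (intro allI impI)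
    fix a' b' u' assume "(a', b', u') \<in> ?E" "k = a' \<or> k = b'"
    then obtain m' where m': "(a', b', u') \<in> first_annihilations x v s (rest A m')" by auto
    then have "m \<le> m'" using gone[OF m' \<open>k = a' \<or> k = b'\<close>, of m] that by force
    then show "t \<le> u'" using first[OF abu(1) m'] \<open>u = t\<close> by auto
  qed
  have "rest A m \<subseteq> {k \<in> A. alive ?E k t}" using al rest_decseq[of 0 m A] by auto
  then have "resolved (rest A m) i j t" using res m by (auto simp: resolved_def)
  then have "(i, j, t) \<in> first_annihilations x v s (rest A m)"
    using abu \<open>u = t\<close> by (auto simp: first_annihilations_alt)
  then show "(i, j, t) \<in> ?E" by auto
qed

text \<open>The history of the particles in \<open>A\<close>, all others being absent.\<close>
definition H :: "nat set \<Rightarrow> (nat \<times> nat \<times> real) set" where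
  "H A = (\<Union>m. first_annihilations x v s (rest A m))"

lemma history_H: "finite A \<Longrightarrow> history A (H A)"
  unfolding H_def by (rule simulation_history)

lemma H_eqI: "finite A \<Longrightarrow> history A E \<Longrightarrow> H A = E"
  using history_unique history_H by blast

lemma annihilations_eq_H: "annihilations n x v s = H {1..n}"
proof -
  have "remaining n x v s m = rest {1..n} m" for m
    by (induction m) simp_all
  then show ?thesis by (simp add: annihilations_def H_def)
qed

end

lemma alive_mono: "alive E i t \<Longrightarrow> u \<le> t \<Longrightarrow> alive E i u"
  unfolding alive_def by force

lemma alive_unmatched: "\<not> matched E i \<Longrightarrow> alive E i t"
  by (auto simp: alive_def matched_def)

lemma alive_subset: "alive F i t \<Longrightarrow> E \<subseteq> F \<Longrightarrow> alive E i t"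
  unfolding alive_def by blast

context particles
begin

lemma same_place: "0 \<le> t \<Longrightarrow> P i t = P j t \<Longrightarrow> v i = v j \<Longrightarrow> i = j"
  using velocity_order[of i j t] velocity_order[of j i t] by (cases i j rule: linorder_cases) auto

lemma historyD:
  assumes "history A E" "(i, j, t) \<in> E"
  shows "i \<in> A" "j \<in> A" "i < j" "0 < t" "P i t = P j t" "alive E i t" "alive E j t" "v j < v i"
    "\<And>k. k \<in> A \<Longrightarrow> k \<noteq> i \<Longrightarrow> k \<noteq> j \<Longrightarrow> alive E k t \<Longrightarrow> P k t = P i t \<Longrightarrow>
       v i = 0 \<and> s i = 1 \<or> v j = 0 \<and> s j = -1"
proof -
  have "resolved {k \<in> A. alive E k t} i j t" using assms by (simp add: history_def)
  then show *: "i \<in> A" "j \<in> A" "i < j" "0 < t" "P i t = P j t" "alive E i t" "alive E j t"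
    "\<And>k. k \<in> A \<Longrightarrow> k \<noteq> i \<Longrightarrow> k \<noteq> j \<Longrightarrow> alive E k t \<Longrightarrow> P k t = P i t \<Longrightarrow>
       v i = 0 \<and> s i = 1 \<or> v j = 0 \<and> s j = -1"
    by (auto simp: resolved_def)
  show "v j < v i" using velocity_order[of i j t] * by simp
qed

text \<open>A shared particle is alive at both times, so the times coincide; then \<open>resolved_unique\<close>
  applies.\<close>
lemma unique_partner:
  assumes "history A E" "(i, j, t) \<in> E" "(i', j', t') \<in> E" "{i, j} \<inter> {i', j'} \<noteq> {}"
  shows "i = i' \<and> j = j' \<and> t = t'"
proof -
  have "t \<le> t'" using historyD(6,7)[OF assms(1,2)] assms(3,4) unfolding alive_def by blast
  moreover have "t' \<le> t" using historyD(6,7)[OF assms(1,3)] assms(2,4) unfolding alive_def by blast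
  ultimately have "t = t'" by simp
  then show ?thesis using resolved_unique[of _ i j t i' j'] assms unfolding history_def by blast
qed

lemma meeting_annihilates:
  assumes "history A E" "i \<in> A" "j \<in> A" "i < j" "0 < t" "P i t = P j t" "alive E i t" "alive E j t"
  shows "\<exists>a b. (a, b, t) \<in> E \<and> (i \<in> {a, b} \<or> j \<in> {a, b}) \<and>
    (v i = 0 \<longrightarrow> i \<in> {a, b}) \<and> (v j = 0 \<longrightarrow> j \<in> {a, b})"
  using resolved_exists[of i "{k \<in> A. alive E k t}" j t] assms unfolding history_def by blast

text \<open>To change their order, two particles would have to be at the same place at an earlier
  time, where one of them would have been annihilated.\<close>
lemma order_preserved:
  assumes "history A E" "i \<in> A" "j \<in> A" "i < j" "0 \<le> t" "alive E i t" "alive E j t"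
  shows "P i t \<le> P j t"
proof (rule ccontr)
  assume "\<not> ?thesis"
  then have gt: "x i + of_int (v i) * t > x j + of_int (v j) * t" by (simp add: pos_def)
  define d :: real where "d = of_int (v i - v j)"
  have lt: "x i < x j" using x_less assms by simp
  have dt: "d * t > x j - x i" using gt by (simp add: d_def algebra_simps)
  have dpos: "d > 0"
  proof (rule ccontr)
    assume "\<not> 0 < d"
    then have "d * t \<le> 0" using assms(5) by (simp add: mult_le_0_iff)
    then show False using dt lt by simp
  qed
  \<comment> \<open>the time at which the two lines of motion cross\<close>
  define u where "u = (x j - x i) / d"
  have u: "0 < u" "u < t" using dt lt dpos by (simp_all add: u_def field_simps)
  have "d * u = x j - x i" using dpos by (simp add: u_def)
  then have "P i u = P j u" by (simp add: pos_def d_def algebra_simps)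
  then obtain a b where ab: "(a, b, u) \<in> E" "i \<in> {a, b} \<or> j \<in> {a, b}"
    using meeting_annihilates[of A E i j u] assms u alive_mono[of E _ t u] by auto
  then have "t \<le> u" using assms(6,7) unfolding alive_def by blast
  then show False using u by simp
qed

text \<open>A particle starting between \<open>a\<close> and \<open>k\<close> and alive when these annihilate each other would be
  at the place of their meeting. This would be a triple meeting in which the two moving particles
  annihilate each other, contrary to the spin rule.\<close>
lemma interior_dead:
  assumes "history A E" "(a, k, T) \<in> E" "a < i" "i < k" "i \<in> A"
  shows "\<not> alive E i T"
proof
  assume al: "alive E i T"
  note D = historyD[OF assms(1,2)]
  have "P a T \<le> P i T" "P i T \<le> P k T"
    using order_preserved[OF assms(1), of a i T] order_preserved[OF assms(1), of i k T] D assms al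
    by simp_all
  then have eq: "P a T = P i T" "P i T = P k T" using D(5) by auto
  then have "v a = 1" "v k = -1"
    using triple_velocities[of a i k T] assms D by auto
  then show False using D(9)[of i] assms al eq by auto
qed

lemma interior_matched:
  assumes "history A E" "(a, k, T) \<in> E" "a < i" "i < k" "i \<in> A"
  shows "matched E i"
  using interior_dead[OF assms] alive_unmatched by blast

text \<open>Two partners move towards their meeting point, which lies between their starting points.\<close>
lemma matched_range:
  assumes "history {L..R} E" "matched E i" "alive E i t" "0 \<le> t"
  shows "x L \<le> P i t" "P i t \<le> x R"
proof -
  obtain j k u where jk: "(j, k, u) \<in> E" "i = j \<or> i = k" using assms(2) by (auto simp: matched_def)
  note D = historyD[OF assms(1) jk(1)]
  have tu: "t \<le> u" using jk assms(3) unfolding alive_def by blast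
  have le: "x L \<le> x j" "x k \<le> x R" "x j < x k" using x_le x_less D(1-3) by auto
  have "x L \<le> P i t \<and> P i t \<le> x R"
  proof -
    have "v j = 1 \<and> v k = 0 \<or> v j = 1 \<and> v k = -1 \<or> v j = 0 \<and> v k = -1"
      using D(8) v_range[of j] v_range[of k] by auto
    moreover have "P j u = P k u" by (fact D(5))
    ultimately show ?thesis using jk(2) tu le assms(4) P_simps[of j] P_simps[of k] by fastforce
  qed
  then show "x L \<le> P i t" "P i t \<le> x R" by auto
qed

text \<open>If no particle of \<open>B\<close> ever meets one of \<open>C\<close>, this is clear. The only meeting that may be
  tolerated is a triple meeting in which two particles of \<open>B\<close> annihilate each other anyway and
  the spin lets the third particle, from \<open>C\<close>, pass unperturbed; this is how ties between equal
  distances are covered. The equivalence serves in both directions: to glue two histories and to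
  cut one.\<close>
lemma join:
  assumes sub: "\<And>i j t. (i, j, t) \<in> E \<Longrightarrow> i \<in> B \<and> j \<in> B" "\<And>i j t. (i, j, t) \<in> F \<Longrightarrow> i \<in> C \<and> j \<in> C"
    and BC: "\<And>i k. i \<in> B \<Longrightarrow> k \<in> C \<Longrightarrow> i < k"
    and harmless: "\<And>i k t. i \<in> B \<Longrightarrow> k \<in> C \<Longrightarrow> 0 < t \<Longrightarrow> alive E i t \<Longrightarrow> alive F k t \<Longrightarrow> P i t = P k t \<Longrightarrow>
      v k = -1 \<and> (\<exists>a\<in>B. \<exists>m\<in>B. v a = 1 \<and> v m = 0 \<and> s m = -1 \<and> alive E a t \<and> alive E m t \<and>
        P a t = P i t \<and> P m t = P i t)"
  shows "history (B \<union> C) (E \<union> F) \<longleftrightarrow> history B E \<and> history C F"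
proof -
  let ?S = "\<lambda>t. {k \<in> B \<union> C. alive (E \<union> F) k t}"
  let ?B = "\<lambda>t. {k \<in> B. alive E k t}"
  let ?C = "\<lambda>t. {k \<in> C. alive F k t}"
  have disj: "k \<notin> C" if "k \<in> B" for k using BC that by blast
  have S: "?S t = ?B t \<union> ?C t" for t
    using sub disj unfolding alive_def by blast
  have "resolved (?B t \<union> ?C t) i j t \<longleftrightarrow> resolved (?B t) i j t \<or> resolved (?C t) i j t" for i j t
  proof (cases "i < j \<and> 0 < t \<and> P i t = P j t")
    case True
    then have ij: "i < j" "0 < t" "P i t = P j t" by auto
    then have vij: "v j < v i" using velocity_order[of i j t] by auto
    have place: "k = k'" if "P k t = P k' t" "v k = v k'" for k k'
      using same_place[of t k k'] ij that by simp
    consider "i \<in> ?B t" "j \<in> ?B t" | "i \<in> ?C t" "j \<in> ?C t" | "i \<in> ?B t" "j \<in> ?C t"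
      | "i \<in> ?C t" "j \<in> ?B t" | "i \<notin> ?B t \<union> ?C t \<or> j \<notin> ?B t \<union> ?C t" by blast
    then show ?thesis
    proof cases
      case 1
      have "v i = 0 \<and> s i = 1 \<or> v j = 0 \<and> s j = -1" if k: "k \<in> ?C t" "P k t = P i t" for k
      proof -
        have "i \<in> B" "j \<in> B" "k \<in> C" "alive E i t" "alive F k t" using 1 k by auto
        then obtain m where m: "v k = -1" "m \<in> B" "v m = 0" "s m = -1" "P m t = P i t"
          using harmless[of i k t] ij k by auto
        have "v i \<noteq> -1" "v j \<noteq> -1"
          using place[of i k] place[of j k] m k ij \<open>i \<in> B\<close> \<open>j \<in> B\<close> \<open>k \<in> C\<close> disj by auto
        then have "v j = 0" using vij v_range[of i] v_range[of j] by auto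
        then have "j = m" using m ij by (intro place) auto
        then show ?thesis using m by simp
      qed
      then have "resolved (?B t \<union> ?C t) i j t \<longleftrightarrow> resolved (?B t) i j t"
        unfolding resolved_def using 1 by blast
      moreover have "\<not> resolved (?C t) i j t" using 1 disj by (auto simp: resolved_def)
      ultimately show ?thesis by blast
    next
      case 2
      have "False" if k: "k \<in> ?B t" "P k t = P i t" for k
      proof -
        have "k \<in> B" "i \<in> C" "j \<in> C" "alive E k t" "alive F i t" "alive F j t" using 2 k by auto
        then have "v i = -1" "v j = -1"
          using harmless[of k i t] harmless[of k j t] ij k by auto
        then have "i = j" using ij by (intro place) auto
        then show False using ij by simp
      qed
      then have "resolved (?B t \<union> ?C t) i j t \<longleftrightarrow> resolved (?C t) i j t"
        unfolding resolved_def using 2 by blast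
      moreover have "\<not> resolved (?B t) i j t" using 2 disj by (auto simp: resolved_def)
      ultimately show ?thesis by blast
    next
      case 3
      then have "i \<in> B" "j \<in> C" "alive E i t" "alive F j t" by auto
      then obtain a m where am: "v j = -1" "a \<in> B" "m \<in> B" "v a = 1" "v m = 0" "s m = -1"
        "alive E a t" "alive E m t" "P a t = P i t" "P m t = P i t"
        using harmless[of i j t] ij by meson
      have ne: "a \<noteq> j" "m \<noteq> j" "a \<in> ?B t" "m \<in> ?B t" using am \<open>j \<in> C\<close> disj by auto
      have "\<not> resolved (?B t \<union> ?C t) i j t"
      proof
        assume r: "resolved (?B t \<union> ?C t) i j t"
        have third: "k = i \<or> v i = 0 \<and> s i = 1" if "k \<in> ?B t" "k \<noteq> j" "P k t = P i t" for k
          using r that am(1) unfolding resolved_def by auto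
        show False
        proof (cases "v i = 0 \<and> s i = 1")
          case True
          then have "i = m" using am True by (intro place) auto
          then show False using True am(6) by simp
        next
          case False
          then have "a = i" "m = i" using third[of a] third[of m] ne am(9,10) by blast+
          then show False using am(4,5) by simp
        qed
      qed
      moreover have "\<not> resolved (?B t) i j t" "\<not> resolved (?C t) i j t"
        using \<open>i \<in> B\<close> \<open>j \<in> C\<close> disj by (auto simp: resolved_def)
      ultimately show ?thesis by blast
    next
      case 4
      then have "j < i" using BC by blast
      then show ?thesis using ij by simp
    next
      case 5
      then show ?thesis unfolding resolved_def by blast
    qed
  next
    case False
    then show ?thesis unfolding resolved_def by blast
  qed
  then have key: "history (B \<union> C) (E \<union> F) \<longleftrightarrow> (\<forall>i j t. (i, j, t) \<in> E \<union> F \<longleftrightarrow>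
      resolved (?B t) i j t \<or> resolved (?C t) i j t)"
    unfolding history_def S by simp
  have r: "resolved (?B t) i j t \<Longrightarrow> i \<in> B" "resolved (?C t) i j t \<Longrightarrow> i \<in> C" for i j t
    by (auto simp: resolved_def)
  show ?thesis
    unfolding key unfolding history_def using r sub disj by blast
qed

lemma history_H_interval [simp]: "history {L..R} (H {L..R})"
  by (rule history_H) simp

text \<open>Putting a static particle in front of a left-moving survivor only changes the fate of
  these two, since no other particle ever comes as far as the new one.\<close>
lemma extend_Up_NW:
  assumes "a < b" "v a = 0" "v b = -1" and T: "T = x b - x a"
    and sub: "\<And>i j t. (i, j, t) \<in> E \<Longrightarrow> i \<in> {Suc a..b} \<and> j \<in> {Suc a..b}"
    and b: "\<not> matched E b"
    and conf: "\<And>k t. k \<in> {Suc a..<b} \<Longrightarrow> 0 < t \<Longrightarrow> alive E k t \<Longrightarrow> x a < P k t"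
  shows "history {a..b} (insert (a, b, T) E) \<longleftrightarrow> history {Suc a..b} E"
proof -
  let ?F = "insert (a, b, T) E"
  let ?S = "\<lambda>t. {k \<in> {a..b}. alive ?F k t}"
  let ?C = "\<lambda>t. {k \<in> {Suc a..b}. alive E k t}"
  have Tpos: "0 < T" using x_less assms by simp
  have al: "alive ?F k t \<longleftrightarrow> alive E k t" if "k \<noteq> a" "k \<noteq> b" for k t
    using that by (auto simp: alive_def)
  have ala: "alive ?F a t \<longleftrightarrow> t \<le> T" for t
    using sub by (fastforce simp: alive_def)
  have alb: "alive ?F b t \<longleftrightarrow> t \<le> T" for t
    using b by (auto simp: alive_def matched_def)
  have alb': "alive E b t" for t using b by (rule alive_unmatched)
  have Pa: "P a t = x a" and Pb: "P b t = x b - t" for t using P_simps assms by auto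
  have claim: "resolved (?S t) i j t \<longleftrightarrow> resolved (?C t) i j t \<or> i = a \<and> j = b \<and> t = T" for i j t
  proof (cases "i < j \<and> 0 < t \<and> P i t = P j t \<and> i \<in> {a..b} \<and> j \<in> {a..b}")
    case False
    then have "\<not> (i = a \<and> j = b \<and> t = T)" using Tpos Pa Pb T assms(1) by auto
    then show ?thesis using False by (auto simp: resolved_def)
  next
    case True
    then have ij: "i < j" "0 < t" "P i t = P j t" "i \<in> {a..b}" "j \<in> {a..b}" by auto
    show ?thesis
    proof (cases "i = a")
      case ia: True
      have notC: "\<not> resolved (?C t) i j t" using ia by (auto simp: resolved_def)
      show ?thesis
      proof (cases "j = b")
        case True
        then have "t = T" using ij ia Pa Pb T by simp
        have "P k t \<noteq> x a" if "k \<in> ?S t - {a, b}" for k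
          using conf[of k t] al[of k t] that ij by force
        then have "resolved (?S t) i j t"
          using ia True ij Pa ala alb \<open>t = T\<close> by (auto simp: resolved_def)
        then show ?thesis using ia True \<open>t = T\<close> by simp
      next
        case False
        then have "alive ?F j t \<Longrightarrow> x a < P j t" using conf[of j t] al[of j t] ij ia by auto
        then have "\<not> resolved (?S t) i j t" using ij ia Pa by (auto simp: resolved_def)
        then show ?thesis using notC False by simp
      qed
    next
      case False
      have "resolved (?S t) i j t \<longleftrightarrow> resolved (?C t) i j t"
      proof (cases "x a < P i t")
        case True
        have "k \<in> ?S t \<longleftrightarrow> k \<in> ?C t" if "P k t = P i t" for k
        proof (cases "k = a \<or> k = b")
          case kab: True
          show ?thesis
          proof (cases "k = a")
            case True
            then show ?thesis using that Pa \<open>x a < P i t\<close> by simp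
          next
            case False
            then have "k = b" using kab by simp
            then have "t < T" using that Pb True T by simp
            then show ?thesis using \<open>k = b\<close> alb alb' assms(1) by auto
          qed
        next
          case False
          then show ?thesis using al by auto
        qed
        then show ?thesis using ij unfolding resolved_def by (smt (verit) DiffD1 DiffD2 DiffI)
      next
        case le: False
        have "i \<noteq> b" using ij by auto
        then have "\<not> alive E i t" "\<not> alive ?F i t" using conf[of i t] al[of i t] le False ij by force+
        then show ?thesis by (auto simp: resolved_def)
      qed
      then show ?thesis using False by simp
    qed
  qed
  have nota: "(a, j, t) \<notin> E" for j t using sub by fastforce
  have notr: "\<not> resolved (?C t) a j t" for j t by (auto simp: resolved_def)
  have "((i, j, t) \<in> ?F \<longleftrightarrow> resolved (?C t) i j t \<or> i = a \<and> j = b \<and> t = T) \<longleftrightarrow>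
      ((i, j, t) \<in> E \<longleftrightarrow> resolved (?C t) i j t)" for i j t
    using nota notr by (cases "i = a \<and> j = b \<and> t = T") auto
  then show ?thesis
    unfolding history_def claim by simp
qed

end

section \<open>Blocks in isolation\<close>

fun mirror :: "shape \<Rightarrow> shape" where
  "mirror Up = Up" | "mirror NW = NE" | "mirror NE = NW"
| "mirror NE_Up = Up_NW" | "mirror Up_NW = NE_Up" | "mirror NE_NW = NE_NW"

lemma matched_Un: "matched (E \<union> F) i \<longleftrightarrow> matched E i \<or> matched F i"
  unfolding matched_def by blast

context particles
begin

text \<open>Until \<open>a\<close> and \<open>k\<close> annihilate each other, \<open>k\<close> separates the particles on its two sides, and at
  that time all particles between \<open>a\<close> and \<open>k\<close> are gone. So the two sides can only meet if \<open>k\<close> is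
  static and a particle from the right arrives at the same time as \<open>a\<close>; as \<open>a\<close> wins, this is the
  tie tolerated by \<open>join\<close>.\<close>
lemma split_at_partner:
  assumes ak: "(a, k, T) \<in> H {a..b}"
  shows "H {a..b} = H {a..k} \<union> H {Suc k..b}" "(a, k, T) \<in> H {a..k}"
proof -
  define E where "E = H {a..b}"
  have E: "history {a..b} E" by (simp add: E_def)
  have ak: "(a, k, T) \<in> E" using ak by (simp add: E_def)
  note D = historyD[OF E ak]
  have kb: "a < k" "k \<le> b" using D by auto
  have before: "t \<le> T \<and> alive E k t \<and> P i t \<le> P k t" if i: "i \<in> {a..k}" "alive E i t" "0 \<le> t" for i t
  proof -
    have tT: "t \<le> T"
    proof (cases "i = a \<or> i = k")
      case True
      then show ?thesis using i(2) ak unfolding alive_def by blast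
    next
      case False
      then have "\<not> alive E i T" using interior_dead[OF E ak] i kb by simp
      then show ?thesis using alive_mono[OF i(2), of T] by fastforce
    qed
    then have "alive E k t" using alive_mono[OF D(7)] by blast
    moreover have "P i t \<le> P k t"
      using order_preserved[OF E, of i k t] i \<open>alive E k t\<close> kb by (cases "i = k") auto
    ultimately show ?thesis using tT by simp
  qed
  have meet: "P i t = P k t \<and> P j t = P k t \<and> alive E k t \<and> t \<le> T"
    if "i \<in> {a..k}" "j \<in> {Suc k..b}" "alive E i t" "alive E j t" "P i t = P j t" "0 \<le> t" for i j t
  proof -
    have "alive E k t" "P i t \<le> P k t" "t \<le> T" using before[of i t] that by auto
    moreover have "P k t \<le> P j t" using order_preserved[OF E, of k j t] that kb \<open>alive E k t\<close> by auto
    ultimately show ?thesis using that by simp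
  qed
  \<comment> \<open>A pair on different sides of \<open>k\<close> would meet at \<open>k\<close>, where the spin rule forbids it.\<close>
  have no_cross: "j \<le> k" if e: "(i, j, t) \<in> E" "i \<le> k" for i j t
  proof (rule ccontr)
    assume "\<not> j \<le> k"
    note D' = historyD[OF E e(1)]
    have m: "P i t = P k t" "P j t = P k t" "alive E k t"
      using meet[of i j t] D'(1-7) e(2) \<open>\<not> j \<le> k\<close> by auto
    have "i \<noteq> k" "i \<noteq> a" using unique_partner[OF E e(1) ak] \<open>\<not> j \<le> k\<close> kb by auto
    then have "i < k" "k < j" using e(2) \<open>\<not> j \<le> k\<close> by auto
    moreover have "0 \<le> t" "P k t = P j t" using m D'(4) by simp_all
    ultimately have "v i = 1" "v j = -1" using triple_velocities[of i k j t] m(1) by blast+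
    then show False using D'(9)[of k] D(2) m(1,3) \<open>i < k\<close> \<open>k < j\<close> by simp
  qed
  define E1 where "E1 = {(i, j, t) \<in> E. i \<le> k}"
  define E2 where "E2 = {(i, j, t) \<in> E. k < i}"
  have un: "E = E1 \<union> E2" by (auto simp: E1_def E2_def)
  have sub1: "i \<in> {a..k} \<and> j \<in> {a..k}" if "(i, j, t) \<in> E1" for i j t
    using that historyD(1,2)[OF E, of i j t] no_cross[of i j t] by (auto simp: E1_def)
  have sub2: "i \<in> {Suc k..b} \<and> j \<in> {Suc k..b}" if "(i, j, t) \<in> E2" for i j t
    using that historyD(1-3)[OF E, of i j t] by (auto simp: E2_def)
  have al1: "alive E1 i t \<longleftrightarrow> alive E i t" if "i \<in> {a..k}" for i t
    using that sub1 sub2 unfolding un alive_def by fastforce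
  have al2: "alive E2 i t \<longleftrightarrow> alive E i t" if "i \<in> {Suc k..b}" for i t
    using that sub1 sub2 unfolding un alive_def by fastforce
  have "{a..b} = {a..k} \<union> {Suc k..b}" using kb by auto
  then have hist: "history ({a..k} \<union> {Suc k..b}) (E1 \<union> E2)" using E un by simp
  have harmless: "v j = -1 \<and> (\<exists>a'\<in>{a..k}. \<exists>m\<in>{a..k}. v a' = 1 \<and> v m = 0 \<and> s m = -1 \<and> alive E1 a' t \<and>
      alive E1 m t \<and> P a' t = P i t \<and> P m t = P i t)"
    if ij: "i \<in> {a..k}" "j \<in> {Suc k..b}" "0 < t" "alive E1 i t" "alive E2 j t" "P i t = P j t" for i j t
  proof -
    have al: "alive E i t" "alive E j t" using ij al1 al2 by auto
    have m: "P i t = P k t" "P j t = P k t" "alive E k t" using meet[of i j t] ij al by auto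
    have kj: "k < j" "k \<in> {a..b}" "j \<in> {a..b}" using ij kb by auto
    have "v j < v k" using velocity_order[of k j t] ij(3) m(2) kj by simp
    then have "v k \<noteq> -1" using v_range[of j] by auto
    then have vs: "v k = 0" "v a = 1" "v j = -1"
      using D(8) \<open>v j < v k\<close> v_range[of k] v_range[of a] v_range[of j] by auto
    obtain p q where pq: "(p, q, t) \<in> E" "k \<in> {p, q}"
      using meeting_annihilates[OF E kj(2,3,1) ij(3) m(2)[symmetric] m(3) al(2)] vs by blast
    then have "t = T" using unique_partner[OF E pq(1) ak] by blast
    have aT: "P a t = P k t" "alive E a t" using D(5,6) \<open>t = T\<close> by simp_all
    have "s k = -1" using D(9)[of j] kj kb al(2) m(2) vs \<open>t = T\<close> aT(1) by simp
    then show ?thesis using vs m(1,3) aT kb al1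
      by (intro conjI bexI[of _ a] bexI[of _ k]) auto
  qed
  have ordered: "i < j" if "i \<in> {a..k}" "j \<in> {Suc k..b}" for i j using that by simp
  have "history {a..k} E1 \<and> history {Suc k..b} E2"
    by (rule iffD1[OF join[OF sub1 sub2 ordered harmless] hist])
  then have HE: "H {a..k} = E1" "H {Suc k..b} = E2" by (simp_all add: H_eqI)
  show "H {a..b} = H {a..k} \<union> H {Suc k..b}"
    using un unfolding HE E_def[symmetric] .
  show "(a, k, T) \<in> H {a..k}" unfolding HE using ak kb(1) by (simp add: E1_def)
qed

text \<open>The interval \<open>{L..R}\<close>, run without the other particles, has a skyline consisting of one
  block of the given shape. In isolation nothing can hit the end points from outside.\<close>
fun block :: "nat \<Rightarrow> nat \<Rightarrow> shape \<Rightarrow> bool" where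
  "block L R NW \<longleftrightarrow> L \<le> R \<and> v R = -1 \<and> (\<forall>i\<in>{L..<R}. matched (H {L..R}) i) \<and> \<not> matched (H {L..R}) R"
| "block L R NE \<longleftrightarrow> L \<le> R \<and> v L = 1 \<and> (\<forall>i\<in>{L<..R}. matched (H {L..R}) i) \<and> \<not> matched (H {L..R}) L"
| "block L R Up \<longleftrightarrow> L = R \<and> v L = 0"
| "block L R NE_Up \<longleftrightarrow> v L = 1 \<and> v R = 0 \<and> (\<exists>t. (L, R, t) \<in> H {L..R})"
| "block L R Up_NW \<longleftrightarrow> v L = 0 \<and> v R = -1 \<and> (\<exists>t. (L, R, t) \<in> H {L..R})"
| "block L R NE_NW \<longleftrightarrow> v L = 1 \<and> v R = -1 \<and> (\<exists>t. (L, R, t) \<in> H {L..R})"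

lemma H_subset: "(i, j, t) \<in> H {L..R} \<Longrightarrow> i \<in> {L..R} \<and> j \<in> {L..R}"
  using historyD(1,2)[OF history_H_interval] by blast

lemma matched_H_in: "matched (H {L..R}) i \<Longrightarrow> i \<in> {L..R}"
  using H_subset unfolding matched_def by blast

lemma block_le: "block L R \<Sigma> \<Longrightarrow> L \<le> R"
  by (cases \<Sigma>) (auto dest: historyD(3)[OF history_H_interval])

lemma matched_ends:
  assumes "(L, R, T) \<in> H {L..R}" "i \<in> {L..R}"
  shows "matched (H {L..R}) i"
proof (cases "i = L \<or> i = R")
  case True then show ?thesis using assms unfolding matched_def by blast
next
  case False then show ?thesis using interior_matched[OF history_H_interval assms(1)] assms(2) by auto
qed

text \<open>The functions \<open>upper\<close> and \<open>lower\<close> bound the space-time region that contains all particles of a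
  block while they are alive. The extrema \<open>max\<close> and \<open>min\<close> for the shapes \<open>\<nearrow>\<close> and \<open>\<nwarrow>\<close> are due to the
  surviving particle, which crosses the territory of the others.\<close>
fun upper :: "nat \<Rightarrow> nat \<Rightarrow> shape \<Rightarrow> real \<Rightarrow> real" where
  "upper L R NW t = x R - t"
| "upper L R Up_NW t = x R - t"
| "upper L R NE_NW t = x R - t"
| "upper L R NE t = max (x R) (x L + t)"
| "upper L R Up t = x R"
| "upper L R NE_Up t = x R"

fun lower :: "nat \<Rightarrow> nat \<Rightarrow> shape \<Rightarrow> real \<Rightarrow> real" where
  "lower L R NE t = x L + t"
| "lower L R NE_Up t = x L + t"
| "lower L R NE_NW t = x L + t"
| "lower L R NW t = min (x L) (x R - t)"
| "lower L R Up t = x L"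
| "lower L R Up_NW t = x L"

lemma block_confined:
  assumes "block L R \<Sigma>" "i \<in> {L..R}" "alive (H {L..R}) i t" "0 \<le> t"
  shows "lower L R \<Sigma> t \<le> P i t \<and> P i t \<le> upper L R \<Sigma> t"
proof -
  have range: "x L \<le> P i t \<and> P i t \<le> x R" if "matched (H {L..R}) i"
    using matched_range[OF history_H_interval that assms(3,4)] by simp
  have pair: "x L \<le> P i t \<and> P i t \<le> x R \<and> P L t \<le> P i t \<and> P i t \<le> P R t" if T: "(L, R, T) \<in> H {L..R}" for T
  proof -
    note D = historyD[OF history_H_interval T]
    have "t \<le> T"
    proof (cases "i = L \<or> i = R")
      case True then show ?thesis using assms(3) T unfolding alive_def by blast
    next
      case False
      then have "\<not> alive (H {L..R}) i T" using interior_dead[OF history_H_interval T] assms(2) by simp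
      then show ?thesis using alive_mono[OF assms(3), of T] by fastforce
    qed
    then have al: "alive (H {L..R}) L t" "alive (H {L..R}) R t" using alive_mono D(6,7) by blast+
    have LR: "L \<in> {L..R}" "R \<in> {L..R}" using D by auto
    have "P L t \<le> P i t"
      using order_preserved[OF history_H_interval LR(1) assms(2) _ assms(4) al(1) assms(3)] assms(2)
      by (cases "i = L") auto
    moreover have "P i t \<le> P R t"
      using order_preserved[OF history_H_interval assms(2) LR(2) _ assms(4) assms(3) al(2)] assms(2)
      by (cases "i = R") auto
    ultimately show ?thesis using range matched_ends[OF T assms(2)] by simp
  qed
  show ?thesis
  proof (cases \<Sigma>)
    case Up
    then show ?thesis using assms by (auto simp: P_simps)
  next
    case NW
    then have b: "v R = -1" "\<forall>i\<in>{L..<R}. matched (H {L..R}) i" "\<not> matched (H {L..R}) R" "L \<le> R"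
      using assms(1) by auto
    show ?thesis
    proof (cases "i = R")
      case True then show ?thesis using NW b by (simp add: P_simps)
    next
      case False
      then have "P i t \<le> P R t"
        using order_preserved[OF history_H_interval assms(2) _ _ assms(4) assms(3) alive_unmatched[OF b(3)]] assms(2) b(4)
        by auto
      moreover have "x L \<le> P i t" using range b False assms(2) by simp
      ultimately show ?thesis using NW b by (simp add: P_simps)
    qed
  next
    case NE
    then have b: "v L = 1" "\<forall>i\<in>{L<..R}. matched (H {L..R}) i" "\<not> matched (H {L..R}) L" "L \<le> R"
      using assms(1) by auto
    show ?thesis
    proof (cases "i = L")
      case True then show ?thesis using NE b by (simp add: P_simps)
    next
      case False
      then have "P L t \<le> P i t"
        using order_preserved[OF history_H_interval _ assms(2) _ assms(4) alive_unmatched[OF b(3)] assms(3)] assms(2) b(4)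
        by auto
      moreover have "P i t \<le> x R" using range b False assms(2) by simp
      ultimately show ?thesis using NE b by (simp add: P_simps)
    qed
  next
    case NE_Up
    then obtain T where "(L, R, T) \<in> H {L..R}" "v L = 1" using assms(1) by auto
    then show ?thesis using pair NE_Up P_simps(2)[of L] by auto
  next
    case Up_NW
    then obtain T where "(L, R, T) \<in> H {L..R}" "v R = -1" using assms(1) by auto
    then show ?thesis using pair Up_NW P_simps(3)[of R] by auto
  next
    case NE_NW
    then obtain T where "(L, R, T) \<in> H {L..R}" "v R = -1" "v L = 1" using assms(1) by auto
    then show ?thesis using pair NE_NW P_simps(3)[of R] P_simps(2)[of L] by fastforce
  qed
qed

text \<open>The survivor of the right-hand part is the only particle that leaves its territory to the left,
  so it is the one that hits a static particle placed in front.\<close>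
lemma block_Up_NW_iff: "block a b Up_NW \<longleftrightarrow> v a = 0 \<and> block (Suc a) b NW"
proof
  assume "block a b Up_NW"
  then obtain T where T: "(a, b, T) \<in> H {a..b}" and vs: "v a = 0" "v b = -1" by auto
  note D = historyD[OF history_H_interval T]
  define E where "E = H {a..b} - {(a, b, T)}"
  have ins: "H {a..b} = insert (a, b, T) E" using T by (auto simp: E_def)
  have Teq: "T = x b - x a" using D(5) vs by (simp add: P_simps)
  have other: "{i, j} \<inter> {a, b} = {}" if "(i, j, t) \<in> E" for i j t
    using unique_partner[OF history_H_interval _ T, of i j t] that by (auto simp: E_def)
  have sub: "i \<in> {Suc a..b} \<and> j \<in> {Suc a..b}" if "(i, j, t) \<in> E" for i j t
    using other[OF that] H_subset[of i j t a b] that unfolding ins by auto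
  have b: "\<not> matched E b" using other unfolding matched_def by blast
  have matched_E: "matched E k" if "k \<in> {Suc a..<b}" for k
    using interior_matched[OF history_H_interval T, of k] that unfolding ins matched_def by fastforce
  have conf: "x a < P k t" if k: "k \<in> {Suc a..<b}" "0 < t" "alive E k t" for k t
  proof -
    obtain i j u where iju: "(i, j, u) \<in> E" "k = i \<or> k = j" using matched_E[OF k(1)] unfolding matched_def by blast
    have h: "(i, j, u) \<in> H {a..b}" using iju ins by simp
    note D' = historyD[OF history_H_interval h]
    have tu: "t \<le> u" using k(3) iju unfolding alive_def by blast
    have "v i \<ge> 0" using D'(8) v_range[of i] v_range[of j] by auto
    then have "x i \<le> P i u" using D'(4) by (simp add: pos_def)
    then have "x a < P j u" "x a < P i u" using sub[OF iju(1)] x_less[of a i] D'(5) by auto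
    moreover have "x a < x k" using k x_less by simp
    ultimately show ?thesis using iju(2) tu k(2) P_simps[of k] v_range[of k] by force
  qed
  have "history {Suc a..b} E"
    using extend_Up_NW[OF D(3) vs Teq sub b conf] history_H_interval[of a b] ins by simp
  then have "H {Suc a..b} = E" by (intro H_eqI) auto
  then show "v a = 0 \<and> block (Suc a) b NW" using vs b matched_E D(3) by auto
next
  assume asm: "v a = 0 \<and> block (Suc a) b NW"
  let ?E = "H {Suc a..b}"
  have b: "v b = -1" "\<not> matched ?E b" "a < b" and m: "\<And>i. i \<in> {Suc a..<b} \<Longrightarrow> matched ?E i" using asm by auto
  have conf: "x a < P k t" if "k \<in> {Suc a..<b}" "0 < t" "alive ?E k t" for k t
    using matched_range(1)[OF history_H_interval m[OF that(1)] that(3)] that(2) x_less[of a "Suc a"] by simp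
  have "history {a..b} (insert (a, b, x b - x a) ?E)"
    using extend_Up_NW[OF b(3) _ b(1) refl H_subset b(2) conf] asm by simp
  then have "H {a..b} = insert (a, b, x b - x a) ?E" by (intro H_eqI) auto
  then show "block a b Up_NW" using asm b by auto
qed

text \<open>The static particle \<open>k\<close> is hit by \<open>a\<close> from the left before \<open>b\<close> would hit it from the right;
  in a tie, spin \<open>-1\<close> means that the left-moving \<open>b\<close> continues.\<close>
definition beats :: "nat \<Rightarrow> nat \<Rightarrow> nat \<Rightarrow> bool" where
  "beats a k b \<longleftrightarrow> x k - x a < x b - x k \<or> x k - x a = x b - x k \<and> s k = -1"

lemma H_join:
  assumes "a \<le> k" "k \<le> b"
    "\<And>i j t. i \<in> {a..k} \<Longrightarrow> j \<in> {Suc k..b} \<Longrightarrow> 0 < t \<Longrightarrow> alive (H {a..k}) i t \<Longrightarrow>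
      alive (H {Suc k..b}) j t \<Longrightarrow> P i t = P j t \<Longrightarrow>
      v j = -1 \<and> (\<exists>a'\<in>{a..k}. \<exists>m\<in>{a..k}. v a' = 1 \<and> v m = 0 \<and> s m = -1 \<and> alive (H {a..k}) a' t \<and>
        alive (H {a..k}) m t \<and> P a' t = P i t \<and> P m t = P i t)"
  shows "H {a..b} = H {a..k} \<union> H {Suc k..b}"
proof -
  have "{a..b} = {a..k} \<union> {Suc k..b}" using assms(1,2) by auto
  moreover have "history ({a..k} \<union> {Suc k..b}) (H {a..k} \<union> H {Suc k..b})"
    by (subst join[OF H_subset H_subset _ assms(3)]) auto
  ultimately show ?thesis by (intro H_eqI) auto
qed

text \<open>The region of the block on \<open>{a..k}\<close> stays away from that of the block on its right, except
  that for a static \<open>k\<close> the left-moving survivor \<open>b\<close> reaches \<open>k\<close>. As \<open>a\<close> is there first, \<open>b\<close> finds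
  an empty interval or comes in a tie that it survives.\<close>
lemma block_then_NW:
  assumes "\<Sigma> \<in> {NE_NW, Up_NW, NE_Up}" "block a k \<Sigma>" "block (Suc k) b NW" "\<Sigma> = NE_Up \<Longrightarrow> beats a k b"
  shows "block a b NW" "H {a..b} = H {a..k} \<union> H {Suc k..b}" "\<exists>T. (a, k, T) \<in> H {a..b}"
proof -
  obtain T where T: "(a, k, T) \<in> H {a..k}" using assms(1,2) by auto
  note D = historyD[OF history_H_interval T]
  have kb: "k < b" "v b = -1" using assms(3) by auto
  show un: "H {a..b} = H {a..k} \<union> H {Suc k..b}"
  proof (rule H_join)
    fix i j t
    assume ij: "i \<in> {a..k}" "j \<in> {Suc k..b}" "0 < t" "alive (H {a..k}) i t"
      "alive (H {Suc k..b}) j t" "P i t = P j t"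
    have i: "P i t \<le> upper a k \<Sigma> t" using block_confined[OF assms(2) ij(1,4)] ij(3) by simp
    have j: "min (x (Suc k)) (x b - t) \<le> P j t" using block_confined[OF assms(3) ij(2,5)] ij(3) by simp
    have lt: "x k < x (Suc k)" "x k < x b" using x_less kb by auto
    have \<Sigma>: "\<Sigma> = NE_Up" using assms(1) i j ij lt by auto
    then have vs: "v a = 1" "v k = 0" using assms(2) by auto
    have T_eq: "T = x k - x a" using D(5) vs P_simps[of a T] P_simps[of k T] by simp
    have "matched (H {a..k}) i" using matched_ends[OF T ij(1)] .
    have "\<not> T < t"
    proof
      assume "T < t"
      then have "alive (H {a..k}) i T" using alive_mono ij(4) by (meson less_imp_le)
      moreover have "i \<noteq> a \<and> i \<noteq> k" using ij(4) T \<open>T < t\<close> unfolding alive_def by force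
      ultimately show False using interior_dead[OF history_H_interval T, of i] ij(1) by auto
    qed
    then have tT: "t \<le> T" by simp
    have Pi: "P i t \<le> x k" using i \<Sigma> by simp
    have jb: "j = b"
    proof (rule ccontr)
      assume "j \<noteq> b"
      then have "matched (H {Suc k..b}) j" using assms(3) ij(2) by auto
      then have "x (Suc k) \<le> P j t" using matched_range[OF history_H_interval _ ij(5)] ij(3) by simp
      then show False using Pi lt ij(6) by simp
    qed
    then have "x b - t \<le> x k" using Pi ij(6) kb by (simp add: P_simps)
    then have "t = T" "x k - x a = x b - x k" "s k = -1"
      using assms(4)[OF \<Sigma>] tT T_eq unfolding beats_def by auto
    moreover have "P i t = x k" using jb ij(6) kb P_simps(3)[of b t] calculation T_eq by simp
    moreover have "P a t = x k" "P k t = x k" using P_simps vs T_eq calculation by auto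
    ultimately show "v j = -1 \<and> (\<exists>a'\<in>{a..k}. \<exists>m\<in>{a..k}. v a' = 1 \<and> v m = 0 \<and> s m = -1 \<and>
        alive (H {a..k}) a' t \<and> alive (H {a..k}) m t \<and> P a' t = P i t \<and> P m t = P i t)"
      using jb kb vs D by (intro conjI bexI[of _ a] bexI[of _ k]) auto
  qed (use D kb in auto)
  show "\<exists>T. (a, k, T) \<in> H {a..b}" using un T by auto
  have "matched (H {a..b}) i" if "i \<in> {a..<b}" for i
  proof (cases "i \<le> k")
    case True
    then show ?thesis using matched_ends[OF T, of i] that un by (auto simp: matched_Un)
  next
    case False
    then have "matched (H {Suc k..b}) i" using assms(3) that by auto
    then show ?thesis using un by (auto simp: matched_Un)
  qed
  moreover have "\<not> matched (H {a..b}) b"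
    using assms(3) un kb matched_H_in[of a k b] by (auto simp: matched_Un)
  ultimately show "block a b NW" using D kb by auto
qed

text \<open>If \<open>j\<close> came first, it would meet \<open>k\<close> and annihilate it; in a tie it only survives
  if the spin of \<open>k\<close> favours it.\<close>
lemma survivor_beats:
  assumes T: "(a, k, T) \<in> H {a..b}" and vs: "v a = 1" "v k = 0" "v j = -1"
    and j: "k < j" "j \<le> b" "\<not> matched (H {a..b}) j"
  shows "beats a k j"
proof -
  note D = historyD[OF history_H_interval T]
  have T_eq: "T = x k - x a" using D(5) vs P_simps[of a T] P_simps[of k T] by simp
  have al: "alive (H {a..b}) j T" using j(3) by (rule alive_unmatched)
  have jb: "j \<in> {a..b}" using D(1,3) j by simp
  have "P k T \<le> P j T"
    using order_preserved[OF history_H_interval D(2) jb j(1) _ D(7) al] D(4) by simp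
  then have le: "x k - x a \<le> x j - x k" using vs T_eq by (simp add: P_simps)
  have "s k = -1" if "x k - x a = x j - x k"
  proof -
    have "P j T = P a T" using that T_eq vs by (simp add: P_simps)
    then show ?thesis using D(9)[of j] D(3) jb j(1) al vs by auto
  qed
  then show ?thesis using le unfolding beats_def by auto
qed

text \<open>Here \<open>k\<close> is the particle that annihilates \<open>a\<close>.\<close>
lemma block_NW_cases:
  assumes "a < b" "block a b NW"
  obtains k \<Sigma> where "k \<in> {a..<b}" "\<Sigma> \<in> {NE_NW, Up_NW, NE_Up}" "block a k \<Sigma>" "block (Suc k) b NW"
    "\<Sigma> = NE_Up \<Longrightarrow> beats a k b"
proof -
  let ?E = "H {a..b}"
  have b: "v b = -1" "\<not> matched ?E b" and m: "\<And>i. i \<in> {a..<b} \<Longrightarrow> matched ?E i" using assms(2) by auto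
  obtain i j T where ij: "(i, j, T) \<in> ?E" "a = i \<or> a = j" using m[of a] assms(1) unfolding matched_def by auto
  then have "i = a" using historyD(1,3)[OF history_H_interval ij(1)] by auto
  then obtain k where T: "(a, k, T) \<in> ?E" using ij by auto
  note D = historyD[OF history_H_interval T]
  have kb: "k < b" using D(2) T b(2) unfolding matched_def by (cases "k = b") auto
  have un: "?E = H {a..k} \<union> H {Suc k..b}" and T': "(a, k, T) \<in> H {a..k}"
    using split_at_partner[OF T] by auto
  have "matched (H {Suc k..b}) i" if "i \<in> {Suc k..<b}" for i
    using m[of i] that D(3) un matched_H_in[of a k i] by (auto simp: matched_Un)
  moreover have "\<not> matched (H {Suc k..b}) b" using b un by (auto simp: matched_Un)
  ultimately have NW: "block (Suc k) b NW" using b kb by auto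
  obtain \<Sigma> where \<Sigma>: "\<Sigma> \<in> {NE_NW, Up_NW, NE_Up}" "block a k \<Sigma>"
  proof -
    have "v a = 1 \<and> v k = 0 \<or> v a = 1 \<and> v k = -1 \<or> v a = 0 \<and> v k = -1"
      using D(8) v_range[of a] v_range[of k] by auto
    then have "block a k NE_Up \<or> block a k NE_NW \<or> block a k Up_NW" using T' by auto
    then show thesis using that by blast
  qed
  have "beats a k b" if "\<Sigma> = NE_Up"
    using survivor_beats[OF T _ _ b(1) kb _ b(2)] \<Sigma> that by auto
  then show thesis using that[of k \<Sigma>] D(3) kb \<Sigma> NW by auto
qed

section \<open>Translation and mirror symmetry\<close>

lemma history_translate:
  assumes "particles y w r" and "\<And>i. i \<in> A \<Longrightarrow> y i = x i + c \<and> w i = v i \<and> r i = s i"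
    and "history A E"
  shows "particles.history y w r A E"
proof -
  interpret m: particles y w r by fact
  have "m.P i t = P i t + c" if "i \<in> A" for i t using assms(2)[OF that] by (simp add: pos_def)
  then have "m.resolved {k \<in> A. alive E k t} i j t \<longleftrightarrow> resolved {k \<in> A. alive E k t} i j t" for i j t
    unfolding m.resolved_def resolved_def using assms(2) by auto
  then show ?thesis using assms(3) unfolding m.history_def history_def by blast
qed

lemma H_translate:
  assumes "particles y w r" and "\<And>i. i \<in> A \<Longrightarrow> y i = x i + c \<and> w i = v i \<and> r i = s i" "finite A"
  shows "particles.H y w r A = H A"
  using particles.H_eqI[OF assms(1,3)] history_translate[OF assms(1,2) history_H[OF assms(3)]] by blast

lemma block_translate:
  assumes "particles y w r" and "\<And>i. i \<in> {L..R} \<Longrightarrow> y i = x i + c \<and> w i = v i \<and> r i = s i"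
  shows "particles.block y w r L R \<Sigma> \<longleftrightarrow> block L R \<Sigma>"
proof (cases "L \<le> R")
  case True
  interpret m: particles y w r by fact
  have "m.H {L..R} = H {L..R}" using H_translate[of y w r "{L..R}" c] assms by simp
  then show ?thesis using True assms(2)[of L] assms(2)[of R] by (cases \<Sigma>) auto
next
  case False
  then show ?thesis using block_le particles.block_le[OF assms(1)] by blast
qed

lemma mem_mirror_iff:
  "(p, q, t) \<in> (\<lambda>(i, j, t). (N - j, N - i, t)) ` E \<longleftrightarrow> (\<exists>i j. (i, j, t) \<in> E \<and> p = N - j \<and> q = N - i)"
  for N p q :: nat
  by (auto intro: rev_image_eqI)

text \<open>Reversing space exchanges left and right, so velocities and spins change sign; the spin rule
  is invariant because it is stated symmetrically in the two directions.\<close>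
lemma history_mirror:
  assumes "particles y w r" and A: "A \<subseteq> {..N}"
    and refl: "\<And>i. i \<in> A \<Longrightarrow> y (N - i) = c - x i \<and> w (N - i) = - v i \<and> r (N - i) = - s i"
    and E: "history A E"
  shows "particles.history y w r ((\<lambda>i. N - i) ` A) ((\<lambda>(i, j, t). (N - j, N - i, t)) ` E)"
proof -
  interpret m: particles y w r by fact
  let ?A = "(\<lambda>i. N - i) ` A" and ?E = "(\<lambda>(i, j, t). (N - j, N - i, t)) ` E"
  have inj: "N - i = N - j \<longleftrightarrow> i = j" "N - i < N - j \<longleftrightarrow> j < i" if "i \<in> A" "j \<in> A" for i j
    using A subsetD[OF A that(1)] subsetD[OF A that(2)] by auto
  have sub: "i \<in> A \<and> j \<in> A" if "(i, j, t) \<in> E" for i j t using historyD(1,2)[OF E that] by simp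
  have mem: "(N - j, N - i, t) \<in> ?E \<longleftrightarrow> (i, j, t) \<in> E" if "i \<in> A" "j \<in> A" for i j t
  proof
    assume "(N - j, N - i, t) \<in> ?E"
    then obtain i' j' where *: "(i', j', t) \<in> E" "N - j = N - j'" "N - i = N - i'" by auto
    then have "j = j'" "i = i'" using inj(1) sub[OF *(1)] that by blast+
    then show "(i, j, t) \<in> E" using *(1) by simp
  next
    assume "(i, j, t) \<in> E"
    then show "(N - j, N - i, t) \<in> ?E" by (rule rev_image_eqI) simp
  qed
  have al: "alive ?E (N - i) t \<longleftrightarrow> alive E i t" if "i \<in> A" for i t
  proof -
    have "alive ?E (N - i) t \<longleftrightarrow> (\<forall>j k u. (j, k, u) \<in> E \<longrightarrow> N - i = N - k \<or> N - i = N - j \<longrightarrow> t \<le> u)"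
      unfolding alive_def mem_mirror_iff by blast
    also have "\<dots> \<longleftrightarrow> alive E i t"
      unfolding alive_def using inj[OF that] sub by blast
    finally show ?thesis .
  qed
  have P: "m.P (N - i) t = c - P i t" if "i \<in> A" for i t
    using refl[OF that] by (simp add: pos_def)
  have "(i', j', t) \<in> ?E \<longleftrightarrow> m.resolved {k \<in> ?A. alive ?E k t} i' j' t" for i' j' t
  proof (cases "i' \<in> ?A \<and> j' \<in> ?A")
    case False
    then show ?thesis using sub by (fastforce simp: m.resolved_def)
  next
    case True
    then obtain i j where ij: "i \<in> A" "j \<in> A" "i' = N - j" "j' = N - i" by auto
    have "m.resolved {k \<in> ?A. alive ?E k t} i' j' t \<longleftrightarrow>
      i' < j' \<and> 0 < t \<and> m.P i' t = m.P j' t \<and> alive ?E i' t \<and> alive ?E j' t \<and>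
      (\<forall>k\<in>A. N - k \<noteq> i' \<and> N - k \<noteq> j' \<and> alive ?E (N - k) t \<and> m.P (N - k) t = m.P i' t \<longrightarrow>
        w i' = 0 \<and> r i' = 1 \<or> w j' = 0 \<and> r j' = -1)"
      using True unfolding m.resolved_def by auto
    also have "\<dots> \<longleftrightarrow> i < j \<and> 0 < t \<and> P i t = P j t \<and> alive E i t \<and> alive E j t \<and>
      (\<forall>k\<in>A. k \<noteq> i \<and> k \<noteq> j \<and> alive E k t \<and> P k t = P i t \<longrightarrow>
        v i = 0 \<and> s i = 1 \<or> v j = 0 \<and> s j = -1)"
      using ij(1,2) refl[OF ij(1)] refl[OF ij(2)] unfolding ij(3,4)
      by (auto simp: al P inj)
    also have "\<dots> \<longleftrightarrow> resolved {k \<in> A. alive E k t} i j t"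
      using ij unfolding resolved_def by auto
    also have "\<dots> \<longleftrightarrow> (i, j, t) \<in> E" using E unfolding history_def by simp
    also have "\<dots> \<longleftrightarrow> (i', j', t) \<in> ?E" using mem ij by simp
    finally show ?thesis by simp
  qed
  then show ?thesis unfolding m.history_def by simp
qed

lemma H_mirror:
  assumes "particles y w r" and "R \<le> N"
    and refl: "\<And>i. i \<in> {L..R} \<Longrightarrow> y (N - i) = c - x i \<and> w (N - i) = - v i \<and> r (N - i) = - s i"
    and "L \<le> R"
  shows "particles.H y w r {N - R..N - L} = (\<lambda>(i, j, t). (N - j, N - i, t)) ` H {L..R}"
proof -
  interpret m: particles y w r by fact
  have im: "(\<lambda>i. N - i) ` {L..R} = {N - R..N - L}"
  proof -
    have "i \<in> (\<lambda>i. N - i) ` {L..R}" if "i \<in> {N - R..N - L}" for i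
      using that assms(2,4) by (intro image_eqI[of _ _ "N - i"]) auto
    then show ?thesis using assms(2,4) by auto
  qed
  have le_N: "{L..R} \<subseteq> {..N}" using assms(2) by auto
  have "m.history {N - R..N - L} ((\<lambda>(i, j, t). (N - j, N - i, t)) ` H {L..R})"
    using history_mirror[OF assms(1) le_N refl history_H_interval] unfolding im .
  then show ?thesis by (intro m.H_eqI) auto
qed

lemma block_mirror:
  assumes "particles y w r" and "R \<le> N"
    and refl: "\<And>i. i \<in> {L..R} \<Longrightarrow> y (N - i) = c - x i \<and> w (N - i) = - v i \<and> r (N - i) = - s i"
    and "L \<le> R"
  shows "particles.block y w r (N - R) (N - L) (mirror \<Sigma>) \<longleftrightarrow> block L R \<Sigma>"
proof -
  interpret m: particles y w r by fact
  have H: "m.H {N - R..N - L} = (\<lambda>(i, j, t). (N - j, N - i, t)) ` H {L..R}"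
    by (rule H_mirror) fact+
  have inj: "N - i = N - j \<longleftrightarrow> i = j" if "i \<in> {L..R}" "j \<in> {L..R}" for i j
    using assms(2) that by auto
  have mem: "(N - j, N - i, t) \<in> m.H {N - R..N - L} \<longleftrightarrow> (i, j, t) \<in> H {L..R}"
    if "i \<in> {L..R}" "j \<in> {L..R}" for i j t
  proof
    assume "(N - j, N - i, t) \<in> m.H {N - R..N - L}"
    then obtain i' j' where *: "(i', j', t) \<in> H {L..R}" "N - j = N - j'" "N - i = N - i'"
      unfolding H by auto
    then have "j = j'" "i = i'" using inj H_subset[OF *(1)] that by blast+
    then show "(i, j, t) \<in> H {L..R}" using *(1) by simp
  next
    assume "(i, j, t) \<in> H {L..R}"
    then show "(N - j, N - i, t) \<in> m.H {N - R..N - L}" unfolding H by (rule rev_image_eqI) simp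
  qed
  have mat: "matched (m.H {N - R..N - L}) (N - i) \<longleftrightarrow> matched (H {L..R}) i" if "i \<in> {L..R}" for i
  proof -
    have "matched (m.H {N - R..N - L}) (N - i) \<longleftrightarrow>
      (\<exists>j k u. (j, k, u) \<in> H {L..R} \<and> (N - i = N - k \<or> N - i = N - j))"
      unfolding matched_def H mem_mirror_iff by blast
    also have "\<dots> \<longleftrightarrow> matched (H {L..R}) i"
      unfolding matched_def using inj[OF that] H_subset by blast
    finally show ?thesis .
  qed
  have im1: "(\<lambda>i. N - i) ` {L<..R} = {N - R..<N - L}" and im2: "(\<lambda>i. N - i) ` {L..<R} = {N - R<..N - L}"
  proof -
    have mem: "i \<in> (\<lambda>i. N - i) ` A" if "N - i \<in> A" "i \<le> N" for i A
      using that by (intro image_eqI[of _ _ "N - i"]) auto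
    then show "(\<lambda>i. N - i) ` {L<..R} = {N - R..<N - L}" "(\<lambda>i. N - i) ` {L..<R} = {N - R<..N - L}"
      using assms(2,4) by (auto intro!: mem)
  qed
  have ends: "w (N - L) = - v L" "w (N - R) = - v R" "L \<in> {L..R}" "R \<in> {L..R}" "N - R \<le> N - L"
    "N - R = N - L \<longleftrightarrow> L = R"
    using refl assms(2,4) by auto
  show ?thesis
  proof (cases \<Sigma>)
    case NW
    have "m.block (N - R) (N - L) NE \<longleftrightarrow> v R = -1 \<and>
      (\<forall>i\<in>(\<lambda>i. N - i) ` {L..<R}. matched (m.H {N - R..N - L}) i) \<and> \<not> matched (m.H {N - R..N - L}) (N - R)"
      using ends unfolding im2 by auto
    also have "\<dots> \<longleftrightarrow> block L R NW" using mat assms(4) by auto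
    finally show ?thesis using NW by simp
  next
    case NE
    have "m.block (N - R) (N - L) NW \<longleftrightarrow> v L = 1 \<and>
      (\<forall>i\<in>(\<lambda>i. N - i) ` {L<..R}. matched (m.H {N - R..N - L}) i) \<and> \<not> matched (m.H {N - R..N - L}) (N - L)"
      using ends unfolding im1 by auto
    also have "\<dots> \<longleftrightarrow> block L R NE" using mat assms(4) by auto
    finally show ?thesis using NE by simp
  qed (use ends mem in auto)
qed

end

section \<open>Decomposition into blocks\<close>

text \<open>Left-going blocks come first, right-going ones last: any other order would make a survivor
  run into a neighbouring block.\<close>
fun rank :: "shape \<Rightarrow> nat" where
  "rank NW = 0" | "rank NE = 2" | "rank _ = 1"

fun tiles :: "nat \<Rightarrow> nat \<Rightarrow> (nat \<times> nat \<times> shape) list \<Rightarrow> bool" where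
  "tiles a b [] \<longleftrightarrow> a = Suc b"
| "tiles a b ((L, R, \<Sigma>) # bs) \<longleftrightarrow> L = a \<and> L \<le> R \<and> R \<le> b \<and> tiles (Suc R) b bs"

lemma tiles_mem: "tiles a b bs \<Longrightarrow> (L, R, \<Sigma>) \<in> set bs \<Longrightarrow> a \<le> L \<and> L \<le> R \<and> R \<le> b"
  by (induction a b bs rule: tiles.induct) force+

lemma tiles_le: "tiles a b bs \<Longrightarrow> a \<le> Suc b"
  by (induction a b bs rule: tiles.induct) auto

lemma tiles_Union: "tiles a b bs \<Longrightarrow> (\<Union>(L, R, \<Sigma>)\<in>set bs. {L..R}) = {a..b}"
proof (induction a b bs rule: tiles.induct)
  case (2 a b L R \<Sigma> bs)
  then have "(\<Union>(L, R, \<Sigma>)\<in>set ((L, R, \<Sigma>) # bs). {L..R}) = {a..R} \<union> {Suc R..b}" by simp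
  then show ?case using 2(2) tiles_le[of "Suc R" b bs] by auto
qed simp

lemma tiles_iff:
  assumes "a \<le> Suc b"
  shows "tiles a b bs \<longleftrightarrow> (\<forall>(L, R, \<Sigma>)\<in>set bs. L \<le> R) \<and>
    sorted_wrt (\<lambda>(L, R, \<Sigma>) (L', R', \<Sigma>'). R < L') bs \<and> (\<Union>(L, R, \<Sigma>)\<in>set bs. {L..R}) = {a..b}"
  using assms
proof (induction bs arbitrary: a)
  case (Cons B bs)
  obtain L R \<Sigma> where B: "B = (L, R, \<Sigma>)" by (cases B)
  show ?case
  proof
    assume t: "tiles a b (B # bs)"
    then have h: "L = a" "L \<le> R" "R \<le> b" "tiles (Suc R) b bs" by (auto simp: B)
    then have IH: "(\<forall>(L, R, \<Sigma>)\<in>set bs. L \<le> R) \<and> sorted_wrt (\<lambda>(L, R, \<Sigma>) (L', R', \<Sigma>'). R < L') bs"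
      using Cons.IH[of "Suc R"] by blast
    have "\<forall>(L', R', \<Sigma>')\<in>set bs. R < L'" using tiles_mem[OF h(4)] by fastforce
    then show "(\<forall>(L, R, \<Sigma>)\<in>set (B # bs). L \<le> R) \<and>
      sorted_wrt (\<lambda>(L, R, \<Sigma>) (L', R', \<Sigma>'). R < L') (B # bs) \<and>
      (\<Union>(L, R, \<Sigma>)\<in>set (B # bs). {L..R}) = {a..b}"
      using IH h(2) tiles_Union[OF t] by (simp add: B)
  next
    assume *: "(\<forall>(L, R, \<Sigma>)\<in>set (B # bs). L \<le> R) \<and>
      sorted_wrt (\<lambda>(L, R, \<Sigma>) (L', R', \<Sigma>'). R < L') (B # bs) \<and>
      (\<Union>(L, R, \<Sigma>)\<in>set (B # bs). {L..R}) = {a..b}"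
    let ?U = "\<Union>(L, R, \<Sigma>)\<in>set bs. {L..R}"
    have un: "{L..R} \<union> ?U = {a..b}" and LR: "L \<le> R" using * by (auto simp: B)
    have after: "R < i" if "i \<in> ?U" for i using * that by (fastforce simp: B)
    have "L \<in> {a..b}" "R \<in> {a..b}" using un LR by auto
    moreover have "a \<in> {L..R} \<union> ?U" using un \<open>L \<in> {a..b}\<close> by auto
    ultimately have "L = a" using after[of a] LR by fastforce
    have "?U = {Suc R..b}"
    proof (intro set_eqI iffI)
      fix i assume "i \<in> ?U"
      then show "i \<in> {Suc R..b}" using after[of i] un by auto
    next
      fix i assume "i \<in> {Suc R..b}"
      then have "i \<in> {L..R} \<union> ?U" "i \<notin> {L..R}" using un \<open>R \<in> {a..b}\<close> by auto
      then show "i \<in> ?U" by blast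
    qed
    moreover have "R \<le> b" using \<open>R \<in> {a..b}\<close> by simp
    moreover have "\<forall>(L, R, \<Sigma>)\<in>set bs. L \<le> R" "sorted_wrt (\<lambda>(L, R, \<Sigma>) (L', R', \<Sigma>'). R < L') bs"
      using * by simp_all
    moreover have "Suc R \<le> Suc b" using \<open>R \<in> {a..b}\<close> by simp
    ultimately have "tiles (Suc R) b bs" using iffD2[OF Cons.IH[of "Suc R"]] by blast
    then show "tiles a b (B # bs)" using \<open>L = a\<close> LR \<open>R \<le> b\<close> by (simp add: B)
  qed
qed auto

text \<open>Indices are reflected at \<open>N\<close>. Above \<open>N\<close>, where there is nothing to
  reflect, the positions are continued so as to be increasing on all of \<open>nat\<close>.\<close>
definition mirror_pos :: "nat \<Rightarrow> (nat \<Rightarrow> real) \<Rightarrow> nat \<Rightarrow> real" where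
  "mirror_pos N x i = (if i \<le> N then - x (N - i) else real (i - N) - x 0)"

definition mirror_block :: "nat \<Rightarrow> nat \<times> nat \<times> shape \<Rightarrow> nat \<times> nat \<times> shape" where
  "mirror_block N = (\<lambda>(L, R, \<Sigma>). (N - R, N - L, mirror \<Sigma>))"

lemma rank_mirror: "rank (mirror \<Sigma>) = 2 - rank \<Sigma>" "rank \<Sigma> \<le> 2"
  by (cases \<Sigma>; simp)+

context particles
begin

lemma particles_mirror: "particles (mirror_pos N x) (\<lambda>i. - v (N - i)) (\<lambda>i. - s (N - i))"
proof
  show "strict_mono (mirror_pos N x)"
  proof (rule strict_monoI)
    fix i j :: nat assume "i < j"
    moreover have "x 0 \<le> x (N - i)" by (rule x_le) simp
    moreover have "x (N - j) < x (N - i)" if "j \<le> N" using that \<open>i < j\<close> by (intro x_less) auto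
    ultimately show "mirror_pos N x i < mirror_pos N x j" by (auto simp: mirror_pos_def)
  qed
  show "- v (N - i) \<in> {-1, 0, 1}" "- s (N - i) \<in> {-1, 1}" for i
    using v_range[of "N - i"] s_range[of "N - i"] by auto
qed

text \<open>This is \<open>block_Up_NW_iff\<close>, mirrored.\<close>
lemma block_NE_Up_iff:
  assumes "a < b"
  shows "block a b NE_Up \<longleftrightarrow> v b = 0 \<and> block a (b - 1) NE"
proof -
  let ?y = "mirror_pos b x" and ?w = "\<lambda>i. - v (b - i)" and ?r = "\<lambda>i. - s (b - i)"
  note pm = particles_mirror[of b]
  interpret m: particles ?y ?w ?r by (rule pm)
  have refl: "?y (b - i) = 0 - x i \<and> ?w (b - i) = - v i \<and> ?r (b - i) = - s i" if "i \<in> {a..b}" for i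
    using that by (simp add: mirror_pos_def)
  have "block a b NE_Up \<longleftrightarrow> m.block (b - b) (b - a) (mirror NE_Up)"
    by (rule block_mirror[OF pm _ refl, symmetric]) (use assms in auto)
  also have "\<dots> \<longleftrightarrow> ?w 0 = 0 \<and> m.block (Suc 0) (b - a) NW"
    using m.block_Up_NW_iff[of 0 "b - a"] by (simp only: mirror.simps diff_self_eq_0)
  also have "m.block (Suc 0) (b - a) NW \<longleftrightarrow> m.block (b - (b - 1)) (b - a) (mirror NE)"
    using assms by (simp only: mirror.simps) (simp add: Suc_leI)
  also have "\<dots> \<longleftrightarrow> block a (b - 1) NE"
    by (rule block_mirror[OF pm _ refl]) (use assms in auto)
  finally show ?thesis by simp
qed

fun decomposition :: "nat \<Rightarrow> nat \<Rightarrow> (nat \<times> nat \<times> shape) list \<Rightarrow> bool" where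
  "decomposition a b [] \<longleftrightarrow> a = Suc b"
| "decomposition a b ((L, R, \<Sigma>) # bs) \<longleftrightarrow> L = a \<and> R \<le> b \<and> block L R \<Sigma> \<and>
     (\<forall>(L', R', \<Sigma>')\<in>set bs. rank \<Sigma> \<le> rank \<Sigma>') \<and> decomposition (Suc R) b bs"

lemma decomposition_tiles: "decomposition a b bs \<Longrightarrow> tiles a b bs"
  by (induction a b bs rule: decomposition.induct) (auto dest: block_le)

lemma decomposition_block: "decomposition a b bs \<Longrightarrow> (L, R, \<Sigma>) \<in> set bs \<Longrightarrow> block L R \<Sigma>"
  by (induction a b bs rule: decomposition.induct) auto

lemma decomposition_pair:
  assumes "decomposition a b bs" "(L, R, \<Sigma>) \<in> set bs" "(L', R', \<Sigma>') \<in> set bs"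
  shows "(L, R, \<Sigma>) = (L', R', \<Sigma>') \<or> R < L' \<and> rank \<Sigma> \<le> rank \<Sigma>' \<or> R' < L \<and> rank \<Sigma>' \<le> rank \<Sigma>"
  using assms
proof (induction a b bs rule: decomposition.induct)
  case (2 a b L1 R1 \<Sigma>1 bs)
  have later: "R1 < L2 \<and> rank \<Sigma>1 \<le> rank \<Sigma>2" if "(L2, R2, \<Sigma>2) \<in> set bs" for L2 R2 \<Sigma>2
    using 2(2) that tiles_mem[OF decomposition_tiles, of "Suc R1" b bs L2 R2 \<Sigma>2] by auto
  show ?case using 2 later by auto
qed simp

lemma decomposition_append:
  assumes "decomposition a k bs" "decomposition (Suc k) b cs" "k \<le> b"
    "\<And>L R \<Sigma> L' R' \<Sigma>'. (L, R, \<Sigma>) \<in> set bs \<Longrightarrow> (L', R', \<Sigma>') \<in> set cs \<Longrightarrow> rank \<Sigma> \<le> rank \<Sigma>'"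
  shows "decomposition a b (bs @ cs)"
  using assms
proof (induction a k bs rule: decomposition.induct)
  case (2 a k L R \<Sigma> bs)
  have dR: "decomposition (Suc R) k bs" using 2(2) by simp
  have "decomposition (Suc R) b (bs @ cs)"
    by (rule 2(1)[OF dR 2(3,4)]) (erule (1) 2(5)[OF list.set_intros(2)])
  moreover have "rank \<Sigma> \<le> rank \<Sigma>'" if "(L', R', \<Sigma>') \<in> set cs" for L' R' \<Sigma>'
    by (rule 2(5)[OF list.set_intros(1) that])
  then have "\<forall>(L', R', \<Sigma>')\<in>set (bs @ cs). rank \<Sigma> \<le> rank \<Sigma>'" using 2(2) by auto
  ultimately show ?case using 2(2,4) by auto
qed simp

lemma decomposition_mirror:
  assumes "particles y w r" and "b < N"
    and refl: "\<And>i. i \<in> {a..b} \<Longrightarrow> y (N - i) = c - x i \<and> w (N - i) = - v i \<and> r (N - i) = - s i"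
    and "decomposition a b bs"
  shows "particles.decomposition y w r (N - b) (N - a) (rev (map (mirror_block N) bs))"
  using assms(4,3)
proof (induction bs arbitrary: a)
  case Nil
  interpret m: particles y w r by fact
  show ?case using Nil assms(2) by auto
next
  case (Cons B bs)
  interpret m: particles y w r by fact
  obtain R \<Sigma> where B: "B = (a, R, \<Sigma>)" using Cons(2) by (cases B) auto
  have d: "R \<le> b" "block a R \<Sigma>" "\<forall>(L', R', \<Sigma>')\<in>set bs. rank \<Sigma> \<le> rank \<Sigma>'" "decomposition (Suc R) b bs"
    using Cons(2) by (auto simp: B)
  have aR: "a \<le> R" using block_le[OF d(2)] .
  have IH: "m.decomposition (N - b) (N - Suc R) (rev (map (mirror_block N) bs))"
    using Cons.IH[OF d(4)] Cons.prems(2) aR by simp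
  have "m.block (N - R) (N - a) (mirror \<Sigma>)"
    using block_mirror[OF assms(1), of R N a c \<Sigma>] Cons.prems(2) d(1,2) aR assms(2) by auto
  then have last: "m.decomposition (Suc (N - Suc R)) (N - a) [mirror_block N B]"
    using d(1) assms(2) by (simp add: mirror_block_def B Suc_diff_Suc)
  have "rank \<Sigma>1 \<le> rank \<Sigma>2"
    if "(L1, R1, \<Sigma>1) \<in> set (rev (map (mirror_block N) bs))" "(L2, R2, \<Sigma>2) \<in> set [mirror_block N B]"
    for L1 R1 \<Sigma>1 L2 R2 \<Sigma>2
    using that d(3) by (auto simp: mirror_block_def B rank_mirror split: prod.splits)
  then show ?case
    using m.decomposition_append[OF IH last] aR by simp
qed

text \<open>The regions of two blocks in the right order of ranks are disjoint. This is the reason why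
  blocks do not influence each other.\<close>
lemma upper_less_lower:
  assumes "rank \<Sigma> \<le> rank \<Sigma>'" "L \<le> R" "R < L'" "L' \<le> R'" "0 \<le> t"
  shows "upper L R \<Sigma> t < lower L' R' \<Sigma>' t"
proof -
  have "x L < x L'" "x R < x L'" "x R < x R'" using assms x_less by auto
  then show ?thesis using assms(1,5) by (cases \<Sigma>; cases \<Sigma>'; simp)
qed

lemma decomposition_H:
  "decomposition a b bs \<Longrightarrow> H {a..b} = (\<Union>(L, R, \<Sigma>)\<in>set bs. H {L..R})"
proof (induction a b bs rule: decomposition.induct)
  case (1 a b)
  have "H {} = {}" by (intro H_eqI) (auto simp: history_def resolved_def)
  then show ?case using 1 by simp
next
  case (2 a b L R \<Sigma> bs)
  then have d: "L = a" "R \<le> b" "block a R \<Sigma>" "decomposition (Suc R) b bs" by auto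
  have IH: "H {Suc R..b} = (\<Union>(L, R, \<Sigma>)\<in>set bs. H {L..R})" using 2 by simp
  have "H {a..b} = H {a..R} \<union> H {Suc R..b}"
  proof (rule H_join)
    show "a \<le> R" "R \<le> b" using block_le d by auto
    fix i j t
    assume ij: "i \<in> {a..R}" "j \<in> {Suc R..b}" "0 < t" "alive (H {a..R}) i t" "alive (H {Suc R..b}) j t"
      and eq: "P i t = P j t"
    obtain L' R' \<Sigma>' where B: "(L', R', \<Sigma>') \<in> set bs" "j \<in> {L'..R'}"
      using tiles_Union[OF decomposition_tiles[OF d(4)]] ij(2) by blast
    have al: "alive (H {L'..R'}) j t" using alive_subset[OF ij(5)] B(1) unfolding IH by blast
    have bl: "block L' R' \<Sigma>'" and L': "Suc R \<le> L'" "L' \<le> R'"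
      using decomposition_block[OF d(4) B(1)] tiles_mem[OF decomposition_tiles[OF d(4)] B(1)] by auto
    have rk: "rank \<Sigma> \<le> rank \<Sigma>'" using 2(2) B(1) by auto
    have "P i t \<le> upper a R \<Sigma> t" using block_confined[OF d(3) ij(1,4)] ij(3) by simp
    also have "\<dots> < lower L' R' \<Sigma>' t" using upper_less_lower[OF rk] L' block_le[OF d(3)] ij(3) by simp
    also have "\<dots> \<le> P j t" using block_confined[OF bl B(2) al] ij(3) by simp
    finally show "v j = -1 \<and> (\<exists>a'\<in>{a..R}. \<exists>m\<in>{a..R}. v a' = 1 \<and> v m = 0 \<and> s m = -1 \<and>
      alive (H {a..R}) a' t \<and> alive (H {a..R}) m t \<and> P a' t = P i t \<and> P m t = P i t)"
      using eq by simp
  qed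
  then show ?case using IH d(1) by simp
qed

lemma decomposition_matched:
  assumes "decomposition a b bs" "(L, R, \<Sigma>) \<in> set bs" "i \<in> {L..R}"
  shows "matched (H {a..b}) i \<longleftrightarrow> matched (H {L..R}) i"
proof
  assume "matched (H {L..R}) i"
  then show "matched (H {a..b}) i"
    using assms(2) unfolding decomposition_H[OF assms(1)] matched_def by blast
next
  assume "matched (H {a..b}) i"
  then obtain L' R' \<Sigma>' where B: "(L', R', \<Sigma>') \<in> set bs" "matched (H {L'..R'}) i"
    unfolding decomposition_H[OF assms(1)] matched_def by blast
  then have "i \<in> {L'..R'}" using matched_H_in by blast
  then have "(L, R, \<Sigma>) = (L', R', \<Sigma>')" using decomposition_pair[OF assms(1,2) B(1)] assms(3) by auto
  then show "matched (H {L..R}) i" using B by simp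
qed

lemma rank_positive:
  assumes "decomposition a b cs" "\<nexists>k cs'. cs = (a, k, NW) # cs'" "(L, R, \<Sigma>) \<in> set cs"
  shows "1 \<le> rank \<Sigma>"
proof (cases cs)
  case (Cons C cs')
  then obtain R0 \<Sigma>0 where C: "C = (a, R0, \<Sigma>0)" using assms(1) by (cases C) auto
  then have "\<Sigma>0 \<noteq> NW" using assms(2) Cons by blast
  then have "1 \<le> rank \<Sigma>0" by (cases \<Sigma>0) auto
  moreover have "rank \<Sigma>0 \<le> rank \<Sigma>" using assms(1,3) Cons C by auto
  ultimately show ?thesis by simp
qed (use assms(3) in simp)

text \<open>A left-going survivor following the new block passes through it as its last particles
  disappear or later, and absorbs it into a larger block \<open>\<nwarrow>\<close>. Otherwise all following blocks have positive rank.\<close>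
lemma prepend_middle:
  assumes "\<Sigma> \<in> {NE_NW, Up_NW, NE_Up}" "block a k \<Sigma>" "decomposition (Suc k) b cs" "k \<le> b"
    "\<And>k' cs'. cs = (Suc k, k', NW) # cs' \<Longrightarrow> \<Sigma> = NE_Up \<Longrightarrow> beats a k k'"
  shows "\<exists>bs. decomposition a b bs"
proof (cases "\<exists>k' cs'. cs = (Suc k, k', NW) # cs'")
  case True
  then obtain k' cs' where cs: "cs = (Suc k, k', NW) # cs'" by blast
  have "block a k' NW" using block_then_NW(1)[OF assms(1,2)] assms(3,5) cs by auto
  then have "decomposition a b ((a, k', NW) # cs')" using assms(3) cs by auto
  then show ?thesis by blast
next
  case False
  have rk: "rank \<Sigma> = 1" using assms(1) by auto
  have "\<forall>(L', R', \<Sigma>')\<in>set cs. 1 \<le> rank \<Sigma>'"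
    using rank_positive[OF assms(3)] False by blast
  then have "decomposition a b ((a, k, \<Sigma>) # cs)" using assms(2,3,4) rk by auto
  then show ?thesis by blast
qed

lemma block_single: "v a = -1 \<Longrightarrow> block a a NW" "v a = 0 \<Longrightarrow> block a a Up"
proof -
  have "(i, j, t) \<notin> H {a..a}" for i j t
    using historyD(1-3)[OF history_H_interval, of i j t a a] by auto
  then show "v a = -1 \<Longrightarrow> block a a NW" "v a = 0 \<Longrightarrow> block a a Up" by (auto simp: matched_def)
qed

text \<open>A left-moving \<open>a\<close> is a block by itself. A static \<open>a\<close> stays forever unless the
  particles behind it begin with a block \<open>\<nwarrow>\<close>, whose survivor then annihilates it.\<close>
lemma decomposition_exists_slow:
  assumes "a \<le> b" "v a \<noteq> 1" "decomposition (Suc a) b cs"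
  shows "\<exists>bs. decomposition a b bs"
proof (cases "v a = -1")
  case True
  then have "decomposition a b ((a, a, NW) # cs)" using block_single(1)[OF True] assms by auto
  then show ?thesis by blast
next
  case False
  then have va: "v a = 0" using assms(2) v_range[of a] by auto
  show ?thesis
  proof (cases "\<exists>k cs'. cs = (Suc a, k, NW) # cs'")
    case True
    then obtain k cs' where cs: "cs = (Suc a, k, NW) # cs'" by blast
    have bl: "block a k Up_NW" unfolding block_Up_NW_iff using va assms(3) cs by simp
    show ?thesis using prepend_middle[OF _ bl, of b cs'] assms(3) cs by auto
  next
    case False
    have "\<forall>(L', R', \<Sigma>')\<in>set cs. 1 \<le> rank \<Sigma>'"
      using rank_positive[OF assms(3)] False by blast
    then have "decomposition a b ((a, a, Up) # cs)" using assms va by auto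
    then show ?thesis by blast
  qed
qed

lemma decomposition_exists_matched:
  assumes T: "(a, k, T) \<in> H {a..b}" and va: "v a = 1" and cs: "decomposition (Suc k) b cs"
  shows "\<exists>bs. decomposition a b bs"
proof -
  note D = historyD[OF history_H_interval T]
  have T': "(a, k, T) \<in> H {a..k}" and un: "H {a..b} = H {a..k} \<union> H {Suc k..b}"
    using split_at_partner[OF T] by auto
  have "v k = 0 \<or> v k = -1" using D(8) va v_range[of k] by auto
  then obtain \<Sigma> where \<Sigma>: "\<Sigma> \<in> {NE_NW, Up_NW, NE_Up}" "block a k \<Sigma>" "\<Sigma> = NE_Up \<Longrightarrow> v k = 0"
  proof
    assume "v k = 0" then show thesis using that[of NE_Up] va T' by auto
  next
    assume "v k = -1" then show thesis using that[of NE_NW] va T' by auto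
  qed
  have "beats a k k'" if c: "cs = (Suc k, k', NW) # cs'" "\<Sigma> = NE_Up" for k' cs'
  proof -
    have bl: "block (Suc k) k' NW" "k' \<le> b" using cs c by auto
    then have "\<not> matched (H {Suc k..b}) k'"
      using decomposition_matched[OF cs, of "Suc k" k' NW k'] c by auto
    then have "\<not> matched (H {a..b}) k'" using un matched_H_in[of a k k'] bl(1) by (auto simp: matched_Un)
    then show ?thesis using survivor_beats[OF T va \<Sigma>(3)[OF c(2)]] bl by auto
  qed
  then show ?thesis using prepend_middle[OF \<Sigma>(1,2) cs] D(2) by auto
qed

end

text \<open>Induction on the number of particles. If \<open>a\<close> does not move right, or is annihilated, then the
  block of \<open>a\<close> can be split off and the induction hypothesis applies to the rest. The mirror
  image of this argument applies to \<open>b\<close>. One of the two cases must occur: a right-moving \<open>a\<close> and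
  a left-moving \<open>b\<close> meet if both survive up to then.\<close>
lemma decomposition_exists:
  assumes "particles x v s" "1 \<le> a" "a \<le> Suc b"
  shows "\<exists>bs. particles.decomposition x v s a b bs"
  using assms
proof (induction "Suc b - a" arbitrary: x v s a b rule: less_induct)
  case less
  have front: "\<exists>bs. particles.decomposition x' v' s' a' b' bs"
    if p: "particles x' v' s'" and a': "1 \<le> a'" "a' \<le> b'" "Suc b' - a' = Suc b - a"
      and good: "v' a' \<noteq> 1 \<or> matched (particles.H x' v' s' {a'..b'}) a'" for x' v' s' a' b'
  proof -
    interpret q: particles x' v' s' by fact
    show ?thesis
    proof (cases "v' a' = 1")
      case False
      have "\<exists>cs. q.decomposition (Suc a') b' cs" using less.hyps[OF _ p, of b' "Suc a'"] a' by simp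
      then show ?thesis using q.decomposition_exists_slow[OF a'(2) False] by blast
    next
      case True
      then obtain i j T where ij: "(i, j, T) \<in> q.H {a'..b'}" "a' = i \<or> a' = j"
        using good unfolding matched_def by auto
      then have "i = a'" using q.historyD(1,3)[OF q.history_H_interval ij(1)] by auto
      then obtain k where T: "(a', k, T) \<in> q.H {a'..b'}" using ij by auto
      have k: "a' < k" "k \<le> b'" using q.historyD(2,3)[OF q.history_H_interval T] by auto
      then have "\<exists>cs. q.decomposition (Suc k) b' cs" using less.hyps[OF _ p, of b' "Suc k"] a' by simp
      then show ?thesis using q.decomposition_exists_matched[OF T True] by blast
    qed
  qed
  interpret particles x v s by fact
  show ?case
  proof (cases "a \<le> b")
    case False
    then have "a = Suc b" using less.prems by simp
    then have "decomposition a b []" by simp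
    then show ?thesis by blast
  next
    case ab: True
    \<comment> \<open>With this \<open>N\<close> the particles \<open>{a..b}\<close> become \<open>{1..N - a}\<close>, and \<open>b\<close> becomes the first one.\<close>
    define N where "N = Suc b"
    define y where "y = mirror_pos N x"
    define w where "w = (\<lambda>i. - v (N - i))"
    define r where "r = (\<lambda>i. - s (N - i))"
    have pm: "particles y w r" using particles_mirror[of N] by (simp add: y_def w_def r_def)
    interpret m: particles y w r by (rule pm)
    have refl: "y (N - i) = 0 - x i \<and> w (N - i) = - v i \<and> r (N - i) = - s i" if "i \<in> {a..b}" for i
      using that by (simp add: y_def w_def r_def mirror_pos_def N_def)
    have refl': "x (N - i) = 0 - y i \<and> v (N - i) = - w i \<and> s (N - i) = - r i" if "i \<in> {1..N - a}" for i
      using that by (auto simp add: y_def w_def r_def mirror_pos_def N_def)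
    have H: "m.H {1..N - a} = (\<lambda>(i, j, t). (N - j, N - i, t)) ` H {a..b}"
      using H_mirror[OF pm _ refl ab] by (simp add: N_def)
    consider "v a \<noteq> 1 \<or> matched (H {a..b}) a" | "v b \<noteq> -1 \<or> matched (H {a..b}) b"
    proof -
      have False if va: "v a = 1" "v b = -1" and m: "\<not> matched (H {a..b}) a" "\<not> matched (H {a..b}) b"
      proof -
        have "a \<noteq> b" using va by auto
        then have "a < b" using ab by simp
        define t where "t = (x b - x a) / 2"
        have t: "0 < t" using x_less[OF \<open>a < b\<close>] by (simp add: t_def)
        have "P a t = P b t" using va by (simp add: P_simps t_def field_simps)
        then obtain p q where "(p, q, t) \<in> H {a..b}" "a \<in> {p, q} \<or> b \<in> {p, q}"
          using meeting_annihilates[OF history_H_interval, of a a b b t] \<open>a < b\<close> t alive_unmatched m by auto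
        then show False using m unfolding matched_def by blast
      qed
      then show thesis using that by blast
    qed
    then show ?thesis
    proof cases
      case 1
      then show ?thesis using front[OF less.prems(1,2) ab] by simp
    next
      case 2
      have "w 1 \<noteq> 1 \<or> matched (m.H {1..N - a}) 1"
        using 2
      proof
        assume "v b \<noteq> -1" then show ?thesis by (simp add: w_def N_def)
      next
        assume "matched (H {a..b}) b"
        then obtain i j t where ij: "(i, j, t) \<in> H {a..b}" "b = i \<or> b = j" unfolding matched_def by blast
        then have "j = b" using historyD(2,3)[OF history_H_interval ij(1)] by auto
        then have "(1, N - i, t) \<in> m.H {1..N - a}"
          unfolding H mem_mirror_iff using ij(1) by (intro exI[of _ i] exI[of _ b]) (simp add: N_def)
        then show ?thesis unfolding matched_def by blast
      qed
      moreover have "1 \<le> N - a" "Suc (N - a) - 1 = Suc b - a" using ab by (auto simp: N_def)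
      ultimately obtain bs where bs: "m.decomposition 1 (N - a) bs"
        using front[OF pm, of 1 "N - a"] by blast
      have "decomposition (N - (N - a)) (N - 1) (rev (map (mirror_block N) bs))"
        using m.decomposition_mirror[OF less.prems(1) _ refl' bs] less.prems(2) ab by (simp add: N_def)
      moreover have "N - (N - a) = a" "N - 1 = b" using ab by (auto simp: N_def)
      ultimately show ?thesis by auto
    qed
  qed
qed

context particles
begin

section \<open>The skyline is the block decomposition\<close>

definition sealed :: "nat set \<Rightarrow> (nat \<times> nat \<times> real) set \<Rightarrow> nat \<Rightarrow> nat \<Rightarrow> bool" where
  "sealed A E L R \<longleftrightarrow> (\<forall>i\<in>A. \<forall>t\<ge>0. alive E i t \<longrightarrow>
     (i < L \<longrightarrow> P i t \<noteq> x L) \<and> (R < i \<longrightarrow> P i t \<noteq> x R))"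

text \<open>The conditions of \<open>has_shape\<close>, for an arbitrary history \<open>E\<close> of the particles in \<open>A\<close>.\<close>
fun fits :: "nat set \<Rightarrow> (nat \<times> nat \<times> real) set \<Rightarrow> nat \<Rightarrow> nat \<Rightarrow> shape \<Rightarrow> bool" where
  "fits A E L R NW \<longleftrightarrow> v R = -1 \<and> (\<forall>i\<in>{L..<R}. matched E i) \<and> \<not> matched E R"
| "fits A E L R NE \<longleftrightarrow> v L = 1 \<and> (\<forall>i\<in>{L<..R}. matched E i) \<and> \<not> matched E L"
| "fits A E L R Up \<longleftrightarrow> R = L \<and> v L = 0 \<and> \<not> matched E L"
| "fits A E L R NE_Up \<longleftrightarrow> v L = 1 \<and> v R = 0 \<and> (\<exists>t. (L, R, t) \<in> E) \<and> sealed A E L R"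
| "fits A E L R Up_NW \<longleftrightarrow> v L = 0 \<and> v R = -1 \<and> (\<exists>t. (L, R, t) \<in> E) \<and> sealed A E L R"
| "fits A E L R NE_NW \<longleftrightarrow> v L = 1 \<and> v R = -1 \<and> (\<exists>t. (L, R, t) \<in> E) \<and> sealed A E L R"

lemma annihilated_iff: "annihilated n x v s i \<longleftrightarrow> matched (H {1..n}) i"
  unfolding annihilated_def annihilated_at_def annihilations_eq_H matched_def by blast

lemma reaches_iff: "reaches n x v s i y \<longleftrightarrow> (\<exists>t\<ge>0. P i t = y \<and> alive (H {1..n}) i t)"
  unfolding reaches_def annihilated_at_def annihilations_eq_H alive_def by blast

lemma sealed_iff: "sealed {1..n} (H {1..n}) L R \<longleftrightarrow>
    \<not> hit_from_left n x v s (x L) \<and> \<not> hit_from_right n x v s (x R)"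
proof -
  have "x i < x j \<longleftrightarrow> i < j" for i j using x_mono by (simp add: strict_mono_less)
  then show ?thesis unfolding sealed_def hit_from_left_def hit_from_right_def reaches_iff by blast
qed

lemma has_shape_iff:
  assumes "L \<le> R" shows "has_shape n x v s L R \<Sigma> \<longleftrightarrow> fits {1..n} (H {1..n}) L R \<Sigma>"
proof -
  have "annihilate_each_other n x v s L R \<longleftrightarrow> (\<exists>t. (L, R, t) \<in> H {1..n})"
    using assms historyD(3)[OF history_H_interval, of R L _ 1 n]
    unfolding annihilate_each_other_def annihilations_eq_H by fastforce
  then show ?thesis by (cases \<Sigma>) (auto simp: annihilated_iff sealed_iff simp del: One_nat_def)
qed

lemma is_skyline_iff:
  "is_skyline n x v s bs \<longleftrightarrow> tiles 1 n bs \<and> (\<forall>(L, R, \<Sigma>)\<in>set bs. fits {1..n} (H {1..n}) L R \<Sigma>)"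
proof -
  have "is_skyline n x v s bs \<longleftrightarrow> (\<forall>(L, R, \<Sigma>)\<in>set bs. L \<le> R \<and> fits {1..n} (H {1..n}) L R \<Sigma>) \<and>
      sorted_wrt (\<lambda>(L, R, \<Sigma>) (L', R', \<Sigma>'). R < L') bs \<and> (\<Union>(L, R, \<Sigma>)\<in>set bs. {L..R}) = {1..n}"
    unfolding is_skyline_def using has_shape_iff by fastforce
  also have "\<dots> \<longleftrightarrow> tiles 1 n bs \<and> (\<forall>(L, R, \<Sigma>)\<in>set bs. fits {1..n} (H {1..n}) L R \<Sigma>)"
    by (subst tiles_iff) (auto split: prod.splits)
  finally show ?thesis .
qed

lemma middle_between: "rank \<Sigma> \<le> 1 \<Longrightarrow> 0 \<le> t \<Longrightarrow> upper L R \<Sigma> t \<le> x R"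
  "1 \<le> rank \<Sigma> \<Longrightarrow> 0 \<le> t \<Longrightarrow> x L \<le> lower L R \<Sigma> t"
  by (cases \<Sigma>; simp)+

lemma unmatched_singleton: "\<not> matched (H {a}) i"
  using historyD(1-3)[OF history_H, of "{a}"] unfolding matched_def by fastforce

text \<open>Inside each block the full history coincides with the isolated one, and by
  \<open>middle_between\<close> and the order of ranks the other blocks stay away from its borders.\<close>
lemma decomposition_fits:
  assumes d: "decomposition a b bs" and B: "(L, R, \<Sigma>) \<in> set bs"
  shows "fits {a..b} (H {a..b}) L R \<Sigma>"
proof -
  have bl: "block L R \<Sigma>" using decomposition_block[OF d B] .
  have LR: "a \<le> L" "L \<le> R" "R \<le> b" using tiles_mem[OF decomposition_tiles[OF d] B] by auto
  have m: "matched (H {a..b}) i \<longleftrightarrow> matched (H {L..R}) i" if "i \<in> {L..R}" for i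
    using decomposition_matched[OF d B that] .
  have sub: "H {L..R} \<subseteq> H {a..b}" using B unfolding decomposition_H[OF d] by blast
  have sealed: "sealed {a..b} (H {a..b}) L R" if rk: "rank \<Sigma> = 1"
    unfolding sealed_def
  proof (intro ballI allI impI)
    fix i t assume i: "i \<in> {a..b}" "(0::real) \<le> t" "alive (H {a..b}) i t"
    obtain L' R' \<Sigma>' where B': "(L', R', \<Sigma>') \<in> set bs" "i \<in> {L'..R'}"
      using tiles_Union[OF decomposition_tiles[OF d]] i(1) by blast
    have al: "alive (H {L'..R'}) i t"
      using alive_subset[OF i(3)] B'(1) unfolding decomposition_H[OF d] by blast
    have conf: "lower L' R' \<Sigma>' t \<le> P i t \<and> P i t \<le> upper L' R' \<Sigma>' t"
      using block_confined[OF decomposition_block[OF d B'(1)] B'(2) al i(2)] .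
    have pr: "(L, R, \<Sigma>) = (L', R', \<Sigma>') \<or> R < L' \<and> rank \<Sigma> \<le> rank \<Sigma>' \<or> R' < L \<and> rank \<Sigma>' \<le> rank \<Sigma>"
      using decomposition_pair[OF d B B'(1)] .
    show "(i < L \<longrightarrow> P i t \<noteq> x L) \<and> (R < i \<longrightarrow> P i t \<noteq> x R)"
    proof (intro conjI impI)
      assume "i < L"
      then have "R' < L" "rank \<Sigma>' \<le> 1" using pr B'(2) LR rk by auto
      then show "P i t \<noteq> x L" using conf middle_between(1)[of \<Sigma>' t L' R'] i(2) x_less[of R' L] by auto
    next
      assume "R < i"
      then have "R < L'" "1 \<le> rank \<Sigma>'" using pr B'(2) LR rk by auto
      then show "P i t \<noteq> x R" using conf middle_between(2)[of \<Sigma>' t L' R'] i(2) x_less[of R L'] by auto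
    qed
  qed
  show ?thesis using bl m LR sub sealed by (cases \<Sigma>) (auto simp: unmatched_singleton)
qed

text \<open>For most pairs of shapes the fates of the end points are contradictory. If both are \<open>\<nearrow>\<close> with
  different right ends, the contradiction comes from the block following the shorter one: its
  first particle is annihilated, so it is either crossed by the survivor \<open>c\<close>, which violates its
  seal, or it has a left-going survivor, which would meet \<open>c\<close>.\<close>
lemma fits_same_start:
  assumes E: "history A E" and sub: "{c..R'} \<subseteq> A" "c \<le> R" "R \<le> R'"
    and f: "fits A E c R \<Sigma>" "fits A E c R' \<Sigma>'"
    and later: "R < R' \<Longrightarrow> \<exists>R2 \<Sigma>2. Suc R \<le> R2 \<and> R2 \<in> A \<and> fits A E (Suc R) R2 \<Sigma>2"
  shows "R = R' \<and> \<Sigma> = \<Sigma>'"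
proof (cases "R = R'")
  case True
  have ends: "matched E c" "matched E R" if "(c, R, t) \<in> E" for t
    using that unfolding matched_def by blast+
  have "\<Sigma> = \<Sigma>'"
  proof (cases "c = R")
    case eq: True
    show ?thesis using f True eq historyD(3)[OF E, of c R] by (cases \<Sigma>; cases \<Sigma>') auto
  next
    case False
    then have "c \<in> {c..<R}" "R \<in> {c<..R}" using assms by auto
    then show ?thesis using f True ends by (cases \<Sigma>; cases \<Sigma>') auto
  qed
  then show ?thesis using True by simp
next
  case False
  then have lt: "R < R'" using sub by simp
  have c: "c < R'" "c \<in> {c..<R'}" "R \<in> {c..<R'}" using lt sub by auto
  have in_A: "c \<in> A" "R \<in> A" "R' \<in> A" using sub by auto
  have ends: "matched E c" "matched E k" if "(c, k, t) \<in> E" for k t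
    using that unfolding matched_def by blast+
  have crossing: False if "v k = -1" "\<not> matched E k" "R < k" "k \<in> A" "sealed A E c R" for k
  proof -
    have "P k (x k - x R) = x R" using that(1) by (simp add: P_simps)
    moreover have "0 \<le> x k - x R" using x_less[OF that(3)] by simp
    ultimately show False using that alive_unmatched unfolding sealed_def by blast
  qed
  have middle: False if t: "(c, R, t) \<in> E" and "sealed A E c R" for t
  proof -
    have "(c, R', t') \<notin> E" for t' using unique_partner[OF E t, of c R' t'] lt by auto
    then show False using f(2) that ends[OF t] crossing[of R'] lt in_A(3) by (cases \<Sigma>') auto
  qed
  have False
  proof (cases \<Sigma>)
    case NW
    then have R: "v R = -1" "\<not> matched E R" "\<forall>i\<in>{c..<R}. matched E i" using f(1) by auto
    have no_pair: False if "(c, R', t) \<in> E" "v c \<noteq> -1" for t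
    proof -
      have "c < R" using that(2) R(1) sub(2) by (cases "c = R") auto
      then show False using interior_matched[OF E that(1) _ lt in_A(2)] R(2) by simp
    qed
    show False
    proof (cases \<Sigma>')
      case NE
      then have "v c = 1" "\<not> matched E c" using f(2) by auto
      then show False using R sub(2) by (cases "c = R") auto
    qed (use f(2) no_pair R(2) c in auto)
  next
    case NE
    then have cs: "v c = 1" "\<not> matched E c" using f(1) by auto
    show False
    proof (cases \<Sigma>')
      case NE' : NE
      then have "matched E (Suc R)" using f(2) lt sub(2) by auto
      obtain R2 \<Sigma>2 where R2: "Suc R \<le> R2" "R2 \<in> A" "fits A E (Suc R) R2 \<Sigma>2" using later[OF lt] by blast
      have hits: False if "sealed A E (Suc R) R2"
      proof -
        have "P c (x (Suc R) - x c) = x (Suc R)" using cs(1) by (simp add: P_simps)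
        moreover have "0 \<le> x (Suc R) - x c" "c < Suc R" using x_less[of c "Suc R"] sub(2) by auto
        ultimately show False using that cs(2) alive_unmatched in_A(1) unfolding sealed_def by blast
      qed
      have facing: False if R2': "v R2 = -1" "\<not> matched E R2"
      proof -
        have cR2: "c < R2" using R2(1) sub(2) by simp
        define t where "t = (x R2 - x c) / 2"
        have t: "0 < t" using x_less[OF cR2] by (simp add: t_def)
        have "P c t = P R2 t" using that cs by (simp add: P_simps t_def field_simps)
        then obtain p q where "(p, q, t) \<in> E" "c \<in> {p, q} \<or> R2 \<in> {p, q}"
          using meeting_annihilates[OF E in_A(1) R2(2) cR2 t] alive_unmatched cs(2) R2'(2) by blast
        then show False using cs(2) R2'(2) unfolding matched_def by blast
      qed
      show False using R2(3) \<open>matched E (Suc R)\<close> hits facing by (cases \<Sigma>2) auto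
    qed (use f(2) cs c ends in auto)
  next
    case Up
    then show False using f c ends lt by (cases \<Sigma>') auto
  qed (use f(1) middle in auto)
  then show ?thesis ..
qed

lemma tiles_head: "tiles a b bs \<Longrightarrow> a \<le> b \<Longrightarrow> \<exists>R \<Sigma> bs'. bs = (a, R, \<Sigma>) # bs' \<and> a \<le> R \<and> R \<le> b"
  by (cases bs) auto

text \<open>By \<open>fits_same_start\<close>, the blocks of two such tilings agree one after the other from the left.\<close>
lemma fitting_tiling_unique:
  assumes E: "history A E" and sub: "{c..b} \<subseteq> A"
    and "tiles c b bs" "\<forall>(L, R, \<Sigma>)\<in>set bs. fits A E L R \<Sigma>"
    and "tiles c b bs'" "\<forall>(L, R, \<Sigma>)\<in>set bs'. fits A E L R \<Sigma>"
  shows "bs = bs'"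
  using sub assms(3-)
proof (induction bs arbitrary: c bs')
  case Nil
  then show ?case by (cases bs') auto
next
  case (Cons B bs)
  obtain R \<Sigma> where B: "B = (c, R, \<Sigma>)" "c \<le> R" "R \<le> b" "tiles (Suc R) b bs" "fits A E c R \<Sigma>"
    using Cons.prems(2,3) by (cases B) auto
  obtain R' \<Sigma>' cs where B': "bs' = (c, R', \<Sigma>') # cs" "c \<le> R'" "R' \<le> b" "tiles (Suc R') b cs" "fits A E c R' \<Sigma>'"
    using tiles_head[OF Cons.prems(4)] Cons.prems(4,5) B(2,3) by auto
  have next_block: "\<exists>R2 \<Sigma>2. Suc r \<le> R2 \<and> R2 \<in> A \<and> fits A E (Suc r) R2 \<Sigma>2"
    if t: "tiles (Suc r) b ds" "\<forall>(L, R, \<Sigma>)\<in>set ds. fits A E L R \<Sigma>" "c \<le> r" "r < b" for r ds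
  proof -
    obtain R2 \<Sigma>2 ds' where "ds = (Suc r, R2, \<Sigma>2) # ds'" "Suc r \<le> R2" "R2 \<le> b"
      using tiles_head[OF t(1)] t(4) by auto
    then show ?thesis using t(2,3) Cons.prems(1) by (intro exI[of _ R2] exI[of _ \<Sigma>2]) auto
  qed
  have "R = R' \<and> \<Sigma> = \<Sigma>'"
  proof (cases "R \<le> R'")
    case True
    have "{c..R'} \<subseteq> A" using Cons.prems(1) B'(3) by auto
    then show ?thesis
      using fits_same_start[OF E _ B(2) True B(5) B'(5)] next_block[OF B(4)] Cons.prems(3) B'(3) B(2)
      by (auto simp: B(1))
  next
    case False
    have "{c..R} \<subseteq> A" using Cons.prems(1) B(3) by auto
    then have "R' = R \<and> \<Sigma>' = \<Sigma>"
      using fits_same_start[OF E _ B'(2) _ B'(5) B(5)] next_block[OF B'(4)] Cons.prems(5) B(3) B'(2) False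
      by (auto simp: B'(1))
    then show ?thesis by simp
  qed
  moreover have "bs = cs" if "R = R'"
  proof (rule Cons.IH[of "Suc R"])
    show "{Suc R..b} \<subseteq> A" using Cons.prems(1) B(2) by auto
  qed (use B B' Cons.prems(3,5) that in auto)
  ultimately show ?case using B(1) B'(1) by simp
qed

lemma decomposition_unique:
  assumes "decomposition a b bs" "decomposition a b bs'" shows "bs = bs'"
  using fitting_tiling_unique[OF history_H_interval subset_refl] decomposition_tiles decomposition_fits assms
  by blast

text \<open>A decomposition exists and is a skyline, and skylines are unique.\<close>
lemma is_skyline_iff_decomposition:
  "is_skyline n x v s bs \<longleftrightarrow> decomposition 1 n bs"
proof
  assume d: "decomposition 1 n bs"
  show "is_skyline n x v s bs"
    unfolding is_skyline_iff using decomposition_tiles[OF d] decomposition_fits[OF d] by auto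
next
  assume sk: "is_skyline n x v s bs"
  obtain cs where d: "decomposition 1 n cs" using decomposition_exists[OF particles_axioms, of 1 n] by auto
  then have "bs = cs"
    using fitting_tiling_unique[OF history_H_interval subset_refl, of 1 n] sk decomposition_tiles[OF d]
      decomposition_fits[OF d] unfolding is_skyline_iff by blast
  then show "decomposition 1 n bs" using d by simp
qed

end

lemma skyline_eq_iff:
  assumes "particles (start l \<sigma>) v s"
  shows "skyline n l v s \<sigma> = bs \<longleftrightarrow> particles.decomposition (start l \<sigma>) v s 1 n bs"
proof -
  interpret particles "start l \<sigma>" v s by fact
  obtain cs where cs: "decomposition 1 n cs" using decomposition_exists[OF assms, of 1 n] by auto
  then have "skyline n l v s \<sigma> = cs"
    unfolding skyline_def is_skyline_iff_decomposition using decomposition_unique by blast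
  then show ?thesis using cs decomposition_unique by blast
qed

section \<open>Random configurations and events whose probability ignores the lengths\<close>

text \<open>A configuration is a pair of a gap function \<open>h\<close> and a mark function \<open>u\<close>; the mark of a particle
  consists of its velocity and its spin.\<close>
definition walk :: "(nat \<Rightarrow> real) \<Rightarrow> nat \<Rightarrow> real" where
  "walk h k = (\<Sum>i=1..k. h i)"

definition valid :: "(nat \<Rightarrow> real) \<Rightarrow> (nat \<Rightarrow> int \<times> int) \<Rightarrow> bool" where
  "valid h u \<longleftrightarrow> (\<forall>i. 0 < h i) \<and> (\<forall>i. u i \<in> {-1, 0, 1} \<times> {-1, 1})"

lemma valid_particles:
  assumes "valid h u" shows "particles (walk h) (\<lambda>i. fst (u i)) (\<lambda>i. snd (u i))"
proof
  show "strict_mono (walk h)"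
    using assms by (intro strict_mono_Suc_iff[THEN iffD2] allI) (simp add: walk_def valid_def)
  show "fst (u i) \<in> {-1, 0, 1}" "snd (u i) \<in> {-1, 1}" for i
    using assms unfolding valid_def by (metis mem_Times_iff)+
qed

definition has_block :: "nat \<Rightarrow> nat \<Rightarrow> shape \<Rightarrow> (nat \<Rightarrow> real) \<Rightarrow> (nat \<Rightarrow> int \<times> int) \<Rightarrow> bool" where
  "has_block L R \<Sigma> h u \<longleftrightarrow> particles.block (walk h) (\<lambda>i. fst (u i)) (\<lambda>i. snd (u i)) L R \<Sigma>"

definition has_decomposition ::
  "nat \<Rightarrow> nat \<Rightarrow> (nat \<times> nat \<times> shape) list \<Rightarrow> (nat \<Rightarrow> real) \<Rightarrow> (nat \<Rightarrow> int \<times> int) \<Rightarrow> bool" where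
  "has_decomposition a b bs h u \<longleftrightarrow>
     particles.decomposition (walk h) (\<lambda>i. fst (u i)) (\<lambda>i. snd (u i)) a b bs"

text \<open>The translation by \<open>c\<close> is allowed because the gaps in front of \<open>L\<close> move the interval as a
  whole, without changing what happens inside.\<close>
definition local_event :: "nat \<Rightarrow> nat \<Rightarrow> ((nat \<Rightarrow> real) \<Rightarrow> (nat \<Rightarrow> int \<times> int) \<Rightarrow> bool) \<Rightarrow> bool" where
  "local_event L R Q \<longleftrightarrow> (\<forall>h u h' u' c. valid h u \<longrightarrow> valid h' u' \<longrightarrow>
     (\<forall>i\<in>{L..R}. walk h' i = walk h i + c \<and> u' i = u i) \<longrightarrow> (Q h' u' \<longleftrightarrow> Q h u))"

lemma local_eventD:
  assumes "local_event L R Q" "valid h u" "valid h' u'"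
    "\<And>i. i \<in> {L..R} \<Longrightarrow> walk h' i = walk h i + c \<and> u' i = u i"
  shows "Q h' u' \<longleftrightarrow> Q h u"
  using assms unfolding local_event_def by blast

lemma local_has_block: "local_event L R (has_block L R \<Sigma>)"
  unfolding local_event_def has_block_def
proof (intro allI impI)
  fix h u h' u' c
  assume val: "valid h u" "valid h' u'" and eq: "\<forall>i\<in>{L..R}. walk h' i = walk h i + c \<and> u' i = u i"
  show "particles.block (walk h') (\<lambda>i. fst (u' i)) (\<lambda>i. snd (u' i)) L R \<Sigma> \<longleftrightarrow>
      particles.block (walk h) (\<lambda>i. fst (u i)) (\<lambda>i. snd (u i)) L R \<Sigma>"
    by (rule particles.block_translate[OF valid_particles[OF val(1)] valid_particles[OF val(2)], of L R c])
      (use eq in simp)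
qed

lemma has_decomposition_Cons:
  assumes "valid h u"
  shows "has_decomposition a b ((L, R, \<Sigma>) # bs) h u \<longleftrightarrow>
    (L = a \<and> R \<le> b \<and> (\<forall>(L', R', \<Sigma>')\<in>set bs. rank \<Sigma> \<le> rank \<Sigma>')) \<and>
      has_block L R \<Sigma> h u \<and> has_decomposition (Suc R) b bs h u"
  unfolding has_decomposition_def has_block_def particles.decomposition.simps(2)[OF valid_particles[OF assms]]
  by (simp only: conj_ac)

lemma has_decomposition_Nil:
  assumes "valid h u" shows "has_decomposition a b [] h u \<longleftrightarrow> a = Suc b"
  unfolding has_decomposition_def particles.decomposition.simps(1)[OF valid_particles[OF assms]] ..

lemma has_block_le: "valid h u \<Longrightarrow> has_block L R \<Sigma> h u \<Longrightarrow> L \<le> R"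
  unfolding has_block_def using particles.block_le[OF valid_particles] by blast

lemma local_has_decomposition: "local_event a b (has_decomposition a b bs)"
proof (induction bs arbitrary: a)
  case Nil
  then show ?case using has_decomposition_Nil unfolding local_event_def by blast
next
  case (Cons B bs)
  obtain L R \<Sigma> where B: "B = (L, R, \<Sigma>)" by (cases B)
  show ?case
    unfolding local_event_def
  proof (intro allI impI)
    fix h u h' u' c
    assume val: "valid h u" "valid h' u'" and eq: "\<forall>i\<in>{a..b}. walk h' i = walk h i + c \<and> u' i = u i"
    show "has_decomposition a b (B # bs) h' u' \<longleftrightarrow> has_decomposition a b (B # bs) h u"
    proof (cases "L = a \<and> R \<le> b \<and> a \<le> R")
      case True
      have "has_block L R \<Sigma> h' u' \<longleftrightarrow> has_block L R \<Sigma> h u"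
        using local_eventD[OF local_has_block val] eq True by auto
      moreover have "has_decomposition (Suc R) b bs h' u' \<longleftrightarrow> has_decomposition (Suc R) b bs h u"
        using local_eventD[OF Cons.IH val] eq True by auto
      ultimately show ?thesis
        by (simp add: B has_decomposition_Cons[OF val(1)] has_decomposition_Cons[OF val(2)])
    next
      case False
      then show ?thesis using has_block_le[OF val(1)] has_block_le[OF val(2)]
        by (auto simp: B has_decomposition_Cons[OF val(1)] has_decomposition_Cons[OF val(2)])
    qed
  qed
qed

text \<open>Shuffling the gaps of an interval only moves the particles inside it: all others,
  including its right end point, keep their positions.\<close>
lemma walk_permute:
  assumes "\<rho> permutes {L..R}" "1 \<le> L" "i < L \<or> R \<le> i"
  shows "walk (h \<circ> \<rho>) i = walk h i"
proof (cases "i < L")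
  case True
  then have "\<rho> j = j" if "j \<in> {1..i}" for j
    using assms(1) that by (intro permutes_not_in[OF assms(1)]) auto
  then show ?thesis unfolding walk_def by (intro sum.cong) auto
next
  case False
  then have "\<rho> permutes {1..i}" using assms by (intro permutes_subset[OF assms(1)]) auto
  then show ?thesis unfolding walk_def using sum.permute[of \<rho> "{1..i}" h] by simp
qed

text \<open>The symmetry makes the mirror image of a random configuration as likely as the configuration
  itself; changing the sign of a mark \<open>(v, s)\<close> is what a reflection does to it.\<close>
locale mark_law =
  fixes U :: "(int \<times> int) pmf"
  assumes U_support: "set_pmf U \<subseteq> {-1, 0, 1} \<times> {-1, 1}"
    and U_symmetric: "map_pmf uminus U = U"
begin

definition perms :: "nat set \<Rightarrow> (nat \<Rightarrow> nat) pmf" where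
  "perms A = pmf_of_set {\<tau>. \<tau> permutes A}"

definition marks :: "nat set \<Rightarrow> (nat \<Rightarrow> int \<times> int) pmf" where
  "marks A = Pi_pmf A (0, 1) (\<lambda>_. U)"

text \<open>The first component is the shuffled gap function and not the permutation, so that the gaps of
  a subset can be shuffled again starting from the outcome (\<open>resample\<close>).\<close>
definition conf :: "nat set \<Rightarrow> (nat \<Rightarrow> real) \<Rightarrow> ((nat \<Rightarrow> real) \<times> (nat \<Rightarrow> int \<times> int)) pmf" where
  "conf A g = pair_pmf (map_pmf (\<lambda>\<tau>. g \<circ> \<tau>) (perms A)) (marks A)"

lemma set_perms: "finite A \<Longrightarrow> set_pmf (perms A) = {\<tau>. \<tau> permutes A}"
  unfolding perms_def using finite_permutations[of A] permutes_id[of A] by (intro set_pmf_of_set) blast+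

lemma perms_compose_right:
  assumes "finite A" "\<rho> permutes A"
  shows "map_pmf (\<lambda>\<tau>. \<tau> \<circ> \<rho>) (perms A) = perms A"
  unfolding perms_def
proof (rule map_pmf_of_set_bij_betw)
  show "bij_betw (\<lambda>\<tau>. \<tau> \<circ> \<rho>) {\<tau>. \<tau> permutes A} {\<tau>. \<tau> permutes A}"
  proof (rule bij_betw_imageI)
    show "inj_on (\<lambda>\<tau>. \<tau> \<circ> \<rho>) {\<tau>. \<tau> permutes A}"
      using permutes_surj[OF assms(2)] by (intro inj_onI) (metis fun.map_comp permutes_inv_o(1)[OF assms(2)] comp_id)
    show "(\<lambda>\<tau>. \<tau> \<circ> \<rho>) ` {\<tau>. \<tau> permutes A} = {\<tau>. \<tau> permutes A}"
      using image_compose_permutations_right[OF assms(2)] by (simp add: setcompr_eq_image)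
  qed
  show "{\<tau>. \<tau> permutes A} \<noteq> {}" using permutes_id by blast
  show "finite {\<tau>. \<tau> permutes A}" by (rule finite_permutations[OF assms(1)])
qed

lemma marks_support: "finite A \<Longrightarrow> u \<in> set_pmf (marks A) \<Longrightarrow> u i \<in> {-1, 0, 1} \<times> {-1, 1}"
  using U_support by (cases "i \<in> A") (auto simp: marks_def set_Pi_pmf PiE_dflt_def)

lemma conf_valid:
  assumes "finite A" "\<And>i. 0 < g i" "(h, u) \<in> set_pmf (conf A g)"
  shows "valid h u" "\<exists>\<tau>. \<tau> permutes A \<and> h = g \<circ> \<tau>"
proof -
  show "\<exists>\<tau>. \<tau> permutes A \<and> h = g \<circ> \<tau>" using assms(3) set_perms[OF assms(1)] by (auto simp: conf_def)
  then show "valid h u" using assms marks_support[OF assms(1), of u]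
    unfolding valid_def conf_def by auto
qed

definition override :: "nat set \<Rightarrow> (nat \<Rightarrow> 'b) \<Rightarrow> (nat \<Rightarrow> 'b) \<Rightarrow> nat \<Rightarrow> 'b" where
  "override B u u' = (\<lambda>i. if i \<in> B then u' i else u i)"

lemma resample_perms:
  assumes "finite A" "B \<subseteq> A"
  shows "bind_pmf (perms A) (\<lambda>\<tau>. bind_pmf (perms B) (\<lambda>\<rho>. return_pmf (\<tau> \<circ> \<rho>))) = perms A"
proof -
  have fB: "finite B" using assms finite_subset by blast
  have "bind_pmf (perms A) (\<lambda>\<tau>. bind_pmf (perms B) (\<lambda>\<rho>. return_pmf (\<tau> \<circ> \<rho>)))
    = bind_pmf (perms B) (\<lambda>\<rho>. map_pmf (\<lambda>\<tau>. \<tau> \<circ> \<rho>) (perms A))"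
    by (subst bind_commute_pmf) (simp add: map_pmf_def)
  also have "\<dots> = bind_pmf (perms B) (\<lambda>\<rho>. perms A)"
    using set_perms[OF fB] perms_compose_right[OF assms(1)] permutes_subset[OF _ assms(2)]
    by (intro bind_pmf_cong) auto
  finally show ?thesis by simp
qed

lemma resample_marks:
  assumes "finite A" "B \<subseteq> A"
  shows "bind_pmf (marks A) (\<lambda>u. bind_pmf (marks B) (\<lambda>u'. return_pmf (override B u u'))) = marks A"
proof -
  have fin: "finite B" "finite (A - B)" using assms finite_subset by blast+
  have A: "A = (A - B) \<union> B" using assms by auto
  have eq: "marks A = bind_pmf (marks (A - B)) (\<lambda>u. bind_pmf (marks B) (\<lambda>u'.
      return_pmf (\<lambda>i. if i \<in> A - B then u i else u' i)))"
    unfolding marks_def by (subst A, subst Pi_pmf_union)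
      (use fin in \<open>auto simp: pair_pmf_def map_pmf_def bind_assoc_pmf bind_return_pmf\<close>)
  have "bind_pmf (marks A) (\<lambda>u. bind_pmf (marks B) (\<lambda>u'. return_pmf (override B u u')))
    = bind_pmf (marks (A - B)) (\<lambda>u. bind_pmf (marks B) (\<lambda>u'. bind_pmf (marks B) (\<lambda>u''.
        return_pmf (override B (\<lambda>i. if i \<in> A - B then u i else u' i) u''))))"
    unfolding eq by (simp add: bind_assoc_pmf bind_return_pmf)
  also have "\<dots> = bind_pmf (marks (A - B)) (\<lambda>u. bind_pmf (marks B) (\<lambda>u'. bind_pmf (marks B) (\<lambda>u''.
        return_pmf (\<lambda>i. if i \<in> A - B then u i else u'' i))))"
  proof (intro bind_pmf_cong refl arg_cong[where f = return_pmf] ext)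
    fix u u' u'' i
    assume "u' \<in> set_pmf (marks B)" "u'' \<in> set_pmf (marks B)"
    then have "u' i = (0, 1)" "u'' i = (0, 1)" if "i \<notin> B"
      using subsetD[OF set_Pi_pmf_subset[OF fin(1), of "(0, 1)" "\<lambda>_. U"]] that
      unfolding marks_def by blast+
    then show "override B (\<lambda>i. if i \<in> A - B then u i else u' i) u'' i = (if i \<in> A - B then u i else u'' i)"
      by (auto simp: override_def)
  qed
  also have "\<dots> = marks A" by (simp add: eq)
  finally show ?thesis .
qed

text \<open>Reshuffling the gaps of a subset and drawing its marks anew does not change the law, since
  composing a uniform permutation with an independent one is again uniform. Conditioning on the
  contents of the subset is expressed in this way.\<close>
lemma resample:
  assumes "finite A" "B \<subseteq> A"
  shows "bind_pmf (conf A g) (\<lambda>(h, u). map_pmf (\<lambda>(h', u'). (h', override B u u')) (conf B h)) = conf A g"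
proof -
  have "bind_pmf (conf A g) (\<lambda>(h, u). map_pmf (\<lambda>(h', u'). (h', override B u u')) (conf B h))
    = bind_pmf (perms A) (\<lambda>\<tau>. bind_pmf (marks A) (\<lambda>u. bind_pmf (perms B) (\<lambda>\<rho>.
        bind_pmf (marks B) (\<lambda>u'. return_pmf (g \<circ> (\<tau> \<circ> \<rho>), override B u u')))))"
    by (simp add: conf_def pair_pmf_def map_pmf_def bind_assoc_pmf bind_return_pmf comp_assoc)
  also have "\<dots> = bind_pmf (perms A) (\<lambda>\<tau>. bind_pmf (perms B) (\<lambda>\<rho>. bind_pmf (marks A) (\<lambda>u.
        bind_pmf (marks B) (\<lambda>u'. return_pmf (g \<circ> (\<tau> \<circ> \<rho>), override B u u')))))"
    by (subst bind_commute_pmf[of "marks A"]) (rule refl)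
  also have "\<dots> = bind_pmf (bind_pmf (perms A) (\<lambda>\<tau>. bind_pmf (perms B) (\<lambda>\<rho>. return_pmf (\<tau> \<circ> \<rho>))))
      (\<lambda>\<tau>. bind_pmf (bind_pmf (marks A) (\<lambda>u. bind_pmf (marks B) (\<lambda>u'. return_pmf (override B u u'))))
        (\<lambda>w. return_pmf (g \<circ> \<tau>, w)))"
    by (simp add: bind_assoc_pmf bind_return_pmf)
  also have "\<dots> = conf A g"
    unfolding resample_perms[OF assms] resample_marks[OF assms]
    by (simp add: conf_def pair_pmf_def map_pmf_def bind_assoc_pmf bind_return_pmf)
  finally show ?thesis .
qed

definition pr :: "nat set \<Rightarrow> (nat \<Rightarrow> real) \<Rightarrow> ((nat \<Rightarrow> real) \<Rightarrow> (nat \<Rightarrow> int \<times> int) \<Rightarrow> bool) \<Rightarrow> real" where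
  "pr A g Q = measure_pmf.prob (conf A g) {(h, u). Q h u}"

lemma pr_cong:
  assumes "finite A" "\<And>i. 0 < g i" "\<And>h u. valid h u \<Longrightarrow> Q h u \<longleftrightarrow> Q' h u"
  shows "pr A g Q = pr A g Q'"
proof -
  have val: "pmf (conf A g) (h, u) = 0 \<or> valid h u" for h u
    using conf_valid(1)[OF assms(1), of g h u] assms(2) by (auto simp: set_pmf_iff)
  show ?thesis
    unfolding pr_def
  proof (rule measure_prob_cong_0)
  qed (use val assms(3) in auto)
qed

definition universal :: "nat set \<Rightarrow> ((nat \<Rightarrow> real) \<Rightarrow> (nat \<Rightarrow> int \<times> int) \<Rightarrow> bool) \<Rightarrow> bool" where
  "universal A Q \<longleftrightarrow> (\<forall>g g'. (\<forall>i. 0 < g i) \<longrightarrow> (\<forall>i. 0 < g' i) \<longrightarrow> pr A g Q = pr A g' Q)"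

lemma universal_cong:
  assumes "finite A" "\<And>h u. valid h u \<Longrightarrow> Q h u \<longleftrightarrow> Q' h u"
  shows "universal A Q \<longleftrightarrow> universal A Q'"
proof -
  have "pr A g Q = pr A g Q'" if "\<forall>i. 0 < g i" for g
    using that assms by (intro pr_cong) auto
  then show ?thesis unfolding universal_def by simp
qed

lemma universal_marks: "universal A (\<lambda>h u. q u)"
proof -
  have "pr A g (\<lambda>h u. q u) = measure_pmf.prob (marks A) {u. q u}" for g
  proof -
    have "measure_pmf.prob (marks A) {u. q u} = measure_pmf.prob (map_pmf snd (conf A g)) {u. q u}"
      by (simp add: conf_def map_snd_pair_pmf)
    then show ?thesis by (simp add: pr_def vimage_def case_prod_beta')
  qed
  then show ?thesis by (simp add: universal_def)
qed

text \<open>After resampling \<open>{L..R}\<close>, the event \<open>E\<close> has the same conditional probability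
  whatever the gaps inside are, because it is universal, while \<open>Q\<close> does not notice the
  resampling. So the probability is a product, although the gaps are not independent.\<close>
lemma pr_factor:
  assumes LR: "1 \<le> L" "{L..R} \<subseteq> A" "finite A" and E: "local_event L R E" "universal {L..R} E"
    and Q: "\<And>h u h' u'. valid h u \<Longrightarrow> valid h' u' \<Longrightarrow>
      (\<And>i. i < L \<or> R \<le> i \<Longrightarrow> walk h' i = walk h i) \<Longrightarrow> (\<And>i. i \<notin> {L..R} \<Longrightarrow> u' i = u i) \<Longrightarrow> Q h' u' \<longleftrightarrow> Q h u"
    and g: "\<And>i. 0 < g i" "\<And>i. 0 < g0 i"
  shows "pr A g (\<lambda>h u. E h u \<and> Q h u) = pr {L..R} g0 E * pr A g Q"
proof -
  let ?B = "{L..R}"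
  define \<alpha> where "\<alpha> = pr ?B g0 E"
  have \<alpha>: "0 \<le> \<alpha>" by (simp add: \<alpha>_def pr_def)
  have inner: "emeasure (map_pmf (\<lambda>(h', u'). (h', override ?B u u')) (conf ?B h)) {(h, u). E h u \<and> Q h u}
      = ennreal \<alpha> * indicator {(h, u). Q h u} (h, u)" if hu: "(h, u) \<in> set_pmf (conf A g)" for h u
  proof -
    have val: "valid h u" using conf_valid(1)[OF LR(3) g(1) hu] .
    then have hpos: "0 < h i" for i by (simp add: valid_def)
    have same: "E h' (override ?B u u') \<and> Q h' (override ?B u u') \<longleftrightarrow> E h' u' \<and> Q h u"
      if hu': "(h', u') \<in> set_pmf (conf ?B h)" for h' u'
    proof -
      have val': "valid h' u'" using conf_valid(1)[OF _ hpos hu'] by simp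
      obtain \<rho> where \<rho>: "\<rho> permutes ?B" "h' = h \<circ> \<rho>" using conf_valid(2)[OF _ hpos hu'] by auto
      have valo: "valid h' (override ?B u u')" using val val' by (auto simp: valid_def override_def)
      have "E h' (override ?B u u') \<longleftrightarrow> E h' u'"
        by (rule local_eventD[OF E(1) val' valo, of 0]) (simp add: override_def)
      moreover have "Q h' (override ?B u u') \<longleftrightarrow> Q h u"
        by (rule Q[OF val valo]) (use walk_permute[OF \<rho>(1) LR(1)] \<rho>(2) in \<open>auto simp: override_def\<close>)
      ultimately show ?thesis by simp
    qed
    have "measure_pmf.prob (map_pmf (\<lambda>(h', u'). (h', override ?B u u')) (conf ?B h)) {(h, u). E h u \<and> Q h u}
      = measure_pmf.prob (conf ?B h) {(h', u'). E h' u' \<and> Q h u}"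
      unfolding measure_map_pmf
    proof (rule measure_prob_cong_0)
    qed (use same in \<open>auto simp: set_pmf_iff\<close>)
    also have "\<dots> = (if Q h u then pr ?B h E else 0)" by (simp add: pr_def)
    also have "pr ?B h E = \<alpha>" using E(2) hpos g(2) unfolding universal_def \<alpha>_def by blast
    finally show ?thesis
      unfolding measure_pmf.emeasure_eq_measure using \<alpha> by (auto simp: indicator_def ennreal_mult)
  qed
  have "emeasure (conf A g) {(h, u). E h u \<and> Q h u} =
    (\<integral>\<^sup>+z. emeasure ((\<lambda>(h, u). map_pmf (\<lambda>(h', u'). (h', override ?B u u')) (conf ?B h)) z)
      {(h, u). E h u \<and> Q h u} \<partial>conf A g)"
    by (subst resample[OF LR(3,2), of g, symmetric]) (rule emeasure_bind_pmf)
  also have "\<dots> = (\<integral>\<^sup>+z. ennreal \<alpha> * indicator {(h, u). Q h u} z \<partial>conf A g)"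
    using inner by (intro nn_integral_cong_AE) (auto simp: AE_measure_pmf_iff)
  also have "\<dots> = ennreal \<alpha> * emeasure (conf A g) {(h, u). Q h u}"
    by (rule nn_integral_cmult_indicator) simp
  finally show ?thesis
    unfolding measure_pmf.emeasure_eq_measure pr_def[symmetric] \<alpha>_def[symmetric]
    using \<alpha> by (simp add: ennreal_mult[symmetric] pr_def)
qed

lemma universal_factor:
  assumes "1 \<le> L" "{L..R} \<subseteq> A" "finite A" "local_event L R E" "universal {L..R} E"
    and "\<And>h u h' u'. valid h u \<Longrightarrow> valid h' u' \<Longrightarrow>
      (\<And>i. i < L \<or> R \<le> i \<Longrightarrow> walk h' i = walk h i) \<Longrightarrow> (\<And>i. i \<notin> {L..R} \<Longrightarrow> u' i = u i) \<Longrightarrow> Q h' u' \<longleftrightarrow> Q h u"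
    and "universal A Q"
  shows "universal A (\<lambda>h u. E h u \<and> Q h u)"
  unfolding universal_def
proof (intro allI impI)
  fix g g' :: "nat \<Rightarrow> real"
  assume g: "\<forall>i. 0 < g i" "\<forall>i. 0 < g' i"
  have "pr A g Q = pr A g' Q" using assms(7) g unfolding universal_def by blast
  moreover have factor: "pr A f (\<lambda>h u. E h u \<and> Q h u) = pr {L..R} g E * pr A f Q" if "\<forall>i. 0 < f i" for f
  proof (rule pr_factor[OF assms(1-5)])
    show "Q h' u' \<longleftrightarrow> Q h u" if "valid h u" "valid h' u'" "\<And>i. i < L \<or> R \<le> i \<Longrightarrow> walk h' i = walk h i"
      "\<And>i. i \<notin> {L..R} \<Longrightarrow> u' i = u i" for h u h' u'
      by (rule assms(6)[OF that])
  qed (use that g in auto)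
  ultimately show "pr A g (\<lambda>h u. E h u \<and> Q h u) = pr A g' (\<lambda>h u. E h u \<and> Q h u)"
    using factor[of g] factor[of g'] g by simp
qed

lemma universal_extend:
  assumes "1 \<le> L" "{L..R} \<subseteq> A" "finite A" "local_event L R E" "universal {L..R} E"
  shows "universal A E"
  using universal_factor[OF assms, of "\<lambda>_ _. True"] universal_marks[of A "\<lambda>_. True"] by simp

lemma universal_adjacent:
  assumes "1 \<le> a" "a \<le> Suc k" "k \<le> b"
    and "local_event a k E" "universal {a..k} E" "local_event (Suc k) b F" "universal {Suc k..b} F"
  shows "universal {a..b} (\<lambda>h u. E h u \<and> F h u)"
proof (rule universal_factor[OF assms(1) _ _ assms(4,5)])
  show "universal {a..b} F" by (rule universal_extend[OF _ _ _ assms(6,7)]) (use assms(1-3) in auto)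
  show "F h' u' \<longleftrightarrow> F h u" if "valid h u" "valid h' u'" "\<And>i. i < a \<or> k \<le> i \<Longrightarrow> walk h' i = walk h i"
    "\<And>i. i \<notin> {a..k} \<Longrightarrow> u' i = u i" for h u h' u'
    by (rule local_eventD[OF assms(6) that(1,2), of 0]) (use that(3,4) in auto)
qed (use assms(1-3) in auto)


lemma pr_sum:
  assumes "finite I" "finite A" "\<And>i. 0 < g i"
    and "\<And>h u. valid h u \<Longrightarrow> Q h u \<longleftrightarrow> (\<exists>i\<in>I. E i h u)"
    and "\<And>h u i j. valid h u \<Longrightarrow> i \<in> I \<Longrightarrow> j \<in> I \<Longrightarrow> E i h u \<Longrightarrow> E j h u \<Longrightarrow> i = j"
  shows "pr A g Q = (\<Sum>i\<in>I. pr A g (E i))"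
proof -
  let ?S = "\<lambda>i. {(h, u). valid h u \<and> E i h u}"
  have "pr A g Q = pr A g (\<lambda>h u. \<exists>i\<in>I. valid h u \<and> E i h u)"
    using assms(4) by (intro pr_cong assms) auto
  also have "\<dots> = measure_pmf.prob (conf A g) (\<Union>i\<in>I. ?S i)"
    unfolding pr_def by (rule arg_cong[where f = "measure_pmf.prob _"]) auto
  also have "\<dots> = (\<Sum>i\<in>I. measure_pmf.prob (conf A g) (?S i))"
    using assms(1,5) by (intro measure_pmf.finite_measure_finite_Union) (auto simp: disjoint_family_on_def)
  also have "\<dots> = (\<Sum>i\<in>I. pr A g (E i))"
  proof (intro sum.cong refl)
    fix i
    have "pr A g (E i) = pr A g (\<lambda>h u. valid h u \<and> E i h u)" by (intro pr_cong assms) auto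
    then show "measure_pmf.prob (conf A g) (?S i) = pr A g (E i)" by (simp add: pr_def)
  qed
  finally show ?thesis .
qed

end

section \<open>The law of a single block\<close>

lemma tiles_length: "tiles a b bs \<Longrightarrow> length bs + a \<le> Suc b"
  by (induction a b bs rule: tiles.induct) auto

lemma finite_tiles: "finite {bs. tiles a b bs}"
proof (rule finite_subset)
  have "(UNIV :: shape set) \<subseteq> {Up, NW, NE, NE_Up, Up_NW, NE_NW}" using shape.exhaust by blast
  then have fin: "finite (UNIV :: shape set)" using finite_subset by blast
  show "finite {bs. set bs \<subseteq> {a..b} \<times> {a..b} \<times> (UNIV :: shape set) \<and> length bs \<le> Suc b}"
    using fin by (intro finite_lists_length_le) auto
  show "{bs. tiles a b bs} \<subseteq> {bs. set bs \<subseteq> {a..b} \<times> {a..b} \<times> UNIV \<and> length bs \<le> Suc b}"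
  proof (intro subsetI CollectI conjI)
    fix bs :: "(nat \<times> nat \<times> shape) list" and B
    assume "bs \<in> {bs. tiles a b bs}" "B \<in> set bs"
    then show "B \<in> {a..b} \<times> {a..b} \<times> UNIV" using tiles_mem[of a b bs] by (cases B) fastforce
  next
    fix bs :: "(nat \<times> nat \<times> shape) list" assume "bs \<in> {bs. tiles a b bs}"
    then show "length bs \<le> Suc b" using tiles_length[of a b bs] by simp
  qed
qed

definition wins :: "nat \<Rightarrow> nat \<Rightarrow> nat \<Rightarrow> (nat \<Rightarrow> real) \<Rightarrow> (nat \<Rightarrow> int \<times> int) \<Rightarrow> bool" where
  "wins a k b h u \<longleftrightarrow> walk h k - walk h a < walk h b - walk h k \<or>
     walk h k - walk h a = walk h b - walk h k \<and> snd (u k) = -1"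

lemma wins_iff_beats: "valid h u \<Longrightarrow> wins a k b h u \<longleftrightarrow> particles.beats (walk h) (\<lambda>i. snd (u i)) a k b"
  unfolding wins_def by (rule particles.beats_def[OF valid_particles, symmetric])

context
  fixes h u assumes val: "valid h u"
begin

interpretation particles "walk h" "\<lambda>i. fst (u i)" "\<lambda>i. snd (u i)"
  by (rule valid_particles[OF val])

lemma has_block_Up: "has_block a b Up h u \<longleftrightarrow> a = b \<and> fst (u a) = 0"
  by (simp add: has_block_def)

lemma has_block_single_NW: "has_block a a NW h u \<longleftrightarrow> fst (u a) = -1"
  using block_single(1)[of a] by (auto simp: has_block_def)

lemma has_block_Up_NW: "has_block a b Up_NW h u \<longleftrightarrow> fst (u a) = 0 \<and> has_block (Suc a) b NW h u"
  unfolding has_block_def by (rule block_Up_NW_iff)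

lemma has_block_NE_Up: "a < b \<Longrightarrow> has_block a b NE_Up h u \<longleftrightarrow> fst (u b) = 0 \<and> has_block a (b - 1) NE h u"
  unfolding has_block_def by (rule block_NE_Up_iff)

end

text \<open>The data \<open>(k, \<Sigma>)\<close> in the decomposition of a block \<open>\<nwarrow>\<close> by the particle \<open>k\<close> that annihilates the
  first particle \<open>a\<close>, and the shape \<open>\<Sigma>\<close> that the two form.\<close>
definition first_encounter ::
  "nat \<Rightarrow> nat \<Rightarrow> nat \<times> shape \<Rightarrow> (nat \<Rightarrow> real) \<Rightarrow> (nat \<Rightarrow> int \<times> int) \<Rightarrow> bool" where
  "first_encounter a b = (\<lambda>(k, \<Sigma>) h u. has_block a k \<Sigma> h u \<and> has_block (Suc k) b NW h u \<and>
     (\<Sigma> = NE_Up \<longrightarrow> wins a k b h u))"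

lemma has_block_NW:
  assumes val: "valid h u" and "a < b"
  shows "has_block a b NW h u \<longleftrightarrow>
    (\<exists>e\<in>{a..<b} \<times> {NE_NW, Up_NW} \<union> {a<..<b} \<times> {NE_Up}. first_encounter a b e h u)"
    (is "_ \<longleftrightarrow> (\<exists>e\<in>?I. _)")
proof -
  interpret particles "walk h" "\<lambda>i. fst (u i)" "\<lambda>i. snd (u i)" by (rule valid_particles[OF val])
  note defs = first_encounter_def prod.case has_block_def wins_iff_beats[OF val]
  show ?thesis
  proof
    assume "has_block a b NW h u"
    then have "block a b NW" by (simp add: has_block_def)
    then obtain k \<Sigma> where k: "k \<in> {a..<b}" "\<Sigma> \<in> {NE_NW, Up_NW, NE_Up}" "block a k \<Sigma>" "block (Suc k) b NW"
      "\<Sigma> = NE_Up \<Longrightarrow> beats a k b"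
      using block_NW_cases[OF assms(2)] by metis
    have "a < k" if "\<Sigma> = NE_Up"
      using that k(1,3) by (cases "a = k") auto
    then have "(k, \<Sigma>) \<in> ?I" using k(1,2) by auto
    moreover have "first_encounter a b (k, \<Sigma>) h u" using k(3-5) by (simp add: defs)
    ultimately show "\<exists>e\<in>?I. first_encounter a b e h u" by blast
  next
    assume "\<exists>e\<in>?I. first_encounter a b e h u"
    then obtain e where "e \<in> ?I" "first_encounter a b e h u" by blast
    moreover obtain k \<Sigma> where "e = (k, \<Sigma>)" by (cases e)
    ultimately have "(k, \<Sigma>) \<in> ?I" "first_encounter a b (k, \<Sigma>) h u" by auto
    then show "has_block a b NW h u"
      using block_then_NW(1)[of \<Sigma> a k b] unfolding defs by auto
  qed
qed

lemma first_encounter_unique: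
  assumes val: "valid h u" and "first_encounter a b (k, \<Sigma>) h u" "first_encounter a b (k', \<Sigma>') h u"
    "\<Sigma> \<in> {NE_NW, Up_NW, NE_Up}" "\<Sigma>' \<in> {NE_NW, Up_NW, NE_Up}"
  shows "k = k' \<and> \<Sigma> = \<Sigma>'"
proof -
  interpret particles "walk h" "\<lambda>i. fst (u i)" "\<lambda>i. snd (u i)" by (rule valid_particles[OF val])
  note defs = first_encounter_def prod.case has_block_def wins_iff_beats[OF val]
  have e: "block a k \<Sigma>" "block (Suc k) b NW" "\<Sigma> = NE_Up \<Longrightarrow> beats a k b"
    "block a k' \<Sigma>'" "block (Suc k') b NW" "\<Sigma>' = NE_Up \<Longrightarrow> beats a k' b"
    using assms(2,3) unfolding defs by auto
  obtain T T' where "(a, k, T) \<in> H {a..b}" "(a, k', T') \<in> H {a..b}"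
    using block_then_NW(3)[OF assms(4) e(1-3)] block_then_NW(3)[OF assms(5) e(4-6)] by auto
  then have "k = k'" using unique_partner[OF history_H_interval] by blast
  moreover have "\<Sigma> = \<Sigma>'" using e(1,4) assms(4,5) \<open>k = k'\<close> by auto
  ultimately show ?thesis ..
qed

text \<open>The mirror image of the configuration on \<open>{a..b}\<close>. The gap \<open>h a\<close> lies in front of the first
  particle and is kept; only the gaps between particles of the interval are reversed.\<close>
definition flip_gaps :: "nat \<Rightarrow> nat \<Rightarrow> (nat \<Rightarrow> real) \<Rightarrow> nat \<Rightarrow> real" where
  "flip_gaps a b h j = (if j \<in> {Suc a..b} then h (Suc (a + b) - j) else h j)"

definition flip_marks :: "nat \<Rightarrow> nat \<Rightarrow> (nat \<Rightarrow> int \<times> int) \<Rightarrow> nat \<Rightarrow> int \<times> int" where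
  "flip_marks a b u i = (if i \<in> {a..b} then - u (a + b - i) else u i)"

lemma valid_flip: "valid h u \<Longrightarrow> valid (flip_gaps a b h) (flip_marks a b u)"
proof -
  assume v: "valid h u"
  have "- q \<in> {-1, 0, 1} \<times> {-1, 1}" if "q \<in> {-1, 0, 1} \<times> {-1, 1}" for q :: "int \<times> int"
    using that by (cases q) auto
  then show ?thesis using v by (auto simp: valid_def flip_gaps_def flip_marks_def)
qed

lemma walk_Suc: "walk h (Suc i) = walk h i + h (Suc i)"
  by (simp add: walk_def)

lemma walk_flip:
  assumes "a \<le> i" "i \<le> b"
  shows "walk (flip_gaps a b h) i = walk h a + walk h b - walk h (a + b - i)"
  using assms
proof (induction i rule: dec_induct)
  case base
  have "walk (flip_gaps a b h) a = walk h a"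
    unfolding walk_def by (intro sum.cong) (auto simp: flip_gaps_def)
  then show ?case by simp
next
  case (step i)
  have "a + b - i = Suc (a + b - Suc i)" using step.hyps step.prems by simp
  then have "walk h (a + b - i) = walk h (a + b - Suc i) + h (a + b - i)" using walk_Suc by simp
  moreover have "flip_gaps a b h (Suc i) = h (a + b - i)"
    using step.hyps step.prems by (simp add: flip_gaps_def)
  ultimately show ?case using step.IH step.prems by (simp add: walk_Suc)
qed

lemma has_block_flip:
  assumes "valid h u" "a \<le> L" "L \<le> R" "R \<le> b"
  shows "has_block (a + b - R) (a + b - L) (mirror \<Sigma>) (flip_gaps a b h) (flip_marks a b u) \<longleftrightarrow>
    has_block L R \<Sigma> h u"
proof -
  interpret particles "walk h" "\<lambda>i. fst (u i)" "\<lambda>i. snd (u i)" by (rule valid_particles[OF assms(1)])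
  show ?thesis
    unfolding has_block_def
  proof (rule block_mirror[OF valid_particles[OF valid_flip[OF assms(1)]], where c = "walk h a + walk h b"])
    fix i assume i: "i \<in> {L..R}"
    then have "a \<le> a + b - i" "a + b - i \<le> b" "a + b - (a + b - i) = i" using assms by auto
    then show "walk (flip_gaps a b h) (a + b - i) = walk h a + walk h b - walk h i \<and>
      fst (flip_marks a b u (a + b - i)) = - fst (u i) \<and> snd (flip_marks a b u (a + b - i)) = - snd (u i)"
      using walk_flip[of a "a + b - i" b h] by (simp add: flip_marks_def)
  qed (use assms in auto)
qed

lemma wins_flip:
  assumes "valid h u" "a \<le> k" "k \<le> b"
  shows "wins a k b (flip_gaps a b h) (flip_marks a b u) \<longleftrightarrow> \<not> wins a (a + b - k) b h u"
proof -
  have "snd (u i) = -1 \<or> snd (u i) = 1" for i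
    using assms(1) unfolding valid_def by (metis insertE mem_Times_iff singletonD)
  from this[of "a + b - k"] show ?thesis
    using walk_flip[of a k b h] walk_flip[of a a b h] walk_flip[of a b b h] assms
    by (auto simp: wins_def flip_marks_def)
qed

context mark_law
begin

lemma flip_perms:
  assumes "a \<le> b"
  shows "map_pmf (flip_gaps a b) (map_pmf (\<lambda>\<tau>. g \<circ> \<tau>) (perms {a..b})) = map_pmf (\<lambda>\<tau>. g \<circ> \<tau>) (perms {a..b})"
proof -
  define \<rho> where "\<rho> j = (if j \<in> {Suc a..b} then Suc (a + b) - j else j)" for j
  have "bij_betw \<rho> {a..b} {a..b}"
    by (rule bij_betw_byWitness[where f' = \<rho>]) (auto simp: \<rho>_def)
  then have \<rho>: "\<rho> permutes {a..b}" by (rule bij_imp_permutes) (auto simp: \<rho>_def)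
  have "flip_gaps a b h = h \<circ> \<rho>" for h by (auto simp: flip_gaps_def \<rho>_def)
  then have "map_pmf (flip_gaps a b) (map_pmf (\<lambda>\<tau>. g \<circ> \<tau>) (perms {a..b})) =
      map_pmf (\<lambda>\<tau>. g \<circ> \<tau>) (map_pmf (\<lambda>\<tau>. \<tau> \<circ> \<rho>) (perms {a..b}))"
    by (simp add: pmf.map_comp o_def)
  then show ?thesis using perms_compose_right[OF _ \<rho>] by simp
qed

lemma flip_marks_law: "map_pmf (flip_marks a b) (marks {a..b}) = marks {a..b}"
proof -
  let ?A = "{a..b}"
  define r where "r i = (if i \<in> ?A then a + b - i else i)" for i
  have bij: "bij_betw r ?A ?A"
    by (rule bij_betw_byWitness[where f' = r]) (auto simp: r_def)
  have "map_pmf (flip_marks a b) (marks ?A) =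
    map_pmf (\<lambda>f x. if x \<in> ?A then f x else (0, 1)) (map_pmf (\<lambda>u. uminus \<circ> u) (map_pmf (\<lambda>u. u \<circ> r) (marks ?A)))"
    unfolding pmf.map_comp
  proof (rule map_pmf_cong[OF refl])
    fix u assume "u \<in> set_pmf (marks ?A)"
    then have "u i = (0, 1)" if "i \<notin> ?A" for i
      using subsetD[OF set_Pi_pmf_subset[of ?A "(0, 1)" "\<lambda>_. U"]] that unfolding marks_def by blast
    then show "flip_marks a b u = ((\<lambda>f x. if x \<in> ?A then f x else (0, 1)) \<circ> ((\<lambda>u. uminus \<circ> u) \<circ> (\<lambda>u. u \<circ> r))) u"
      by (auto simp: flip_marks_def r_def)
  qed
  also have "map_pmf (\<lambda>u. u \<circ> r) (marks ?A) = marks ?A"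
    unfolding marks_def by (rule Pi_pmf_bij_betw[symmetric, OF _ bij]) (auto simp: r_def)
  also have "map_pmf (\<lambda>u. uminus \<circ> u) (marks ?A) = Pi_pmf ?A (- (0, 1)) (\<lambda>_. U)"
    unfolding marks_def using Pi_pmf_map[of ?A uminus "(0, 1)" "- (0, 1)" "\<lambda>_. U"] U_symmetric by simp
  also have "map_pmf (\<lambda>f x. if x \<in> ?A then f x else (0, 1)) \<dots> = marks ?A"
    unfolding marks_def by (rule Pi_pmf_default_swap) simp
  finally show ?thesis .
qed

lemma pr_flip:
  assumes "a \<le> b"
  shows "pr {a..b} g (\<lambda>h u. Q (flip_gaps a b h) (flip_marks a b u)) = pr {a..b} g Q"
proof -
  have "map_pmf (\<lambda>(h, u). (flip_gaps a b h, flip_marks a b u)) (conf {a..b} g) = conf {a..b} g"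
    unfolding conf_def map_pair flip_perms[OF assms] flip_marks_law ..
  then have "pr {a..b} g Q =
      measure_pmf.prob (map_pmf (\<lambda>(h, u). (flip_gaps a b h, flip_marks a b u)) (conf {a..b} g)) {(h, u). Q h u}"
    by (simp add: pr_def)
  then show ?thesis by (simp add: pr_def vimage_def case_prod_beta')
qed

lemma pr_split: "pr A g Q = pr A g (\<lambda>h u. Q h u \<and> W h u) + pr A g (\<lambda>h u. Q h u \<and> \<not> W h u)"
proof -
  have "{(h, u). Q h u} = {(h, u). Q h u \<and> W h u} \<union> {(h, u). Q h u \<and> \<not> W h u}" by auto
  then show ?thesis unfolding pr_def by (subst measure_pmf.finite_measure_Union[symmetric]) auto
qed

lemma universal_decomposition:
  assumes "1 \<le> a" "\<And>L R \<Sigma>. (L, R, \<Sigma>) \<in> set bs \<Longrightarrow> universal {L..R} (has_block L R \<Sigma>)"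
  shows "universal {a..b} (has_decomposition a b bs)"
  using assms
proof (induction bs arbitrary: a)
  case Nil
  have "universal {a..b} (has_decomposition a b []) \<longleftrightarrow> universal {a..b} (\<lambda>h u. a = Suc b)"
    by (rule universal_cong) (auto simp: has_decomposition_Nil)
  then show ?case using universal_marks by simp
next
  case (Cons B bs)
  obtain L R \<Sigma> where B: "B = (L, R, \<Sigma>)" by (cases B)
  show ?case
  proof (cases "L = a \<and> R \<le> b \<and> (\<forall>(L', R', \<Sigma>')\<in>set bs. rank \<Sigma> \<le> rank \<Sigma>') \<and> a \<le> R")
    case True
    have "universal {a..b} (\<lambda>h u. has_block a R \<Sigma> h u \<and> has_decomposition (Suc R) b bs h u)"
    proof (rule universal_adjacent)
      show "universal {a..R} (has_block a R \<Sigma>)" using Cons.prems(2)[of L R \<Sigma>] True by (simp add: B)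
      show "universal {Suc R..b} (has_decomposition (Suc R) b bs)"
        using Cons.prems(2) by (intro Cons.IH) auto
    qed (use True Cons.prems(1) local_has_block local_has_decomposition in auto)
    moreover have "universal {a..b} (has_decomposition a b (B # bs)) \<longleftrightarrow>
      universal {a..b} (\<lambda>h u. has_block a R \<Sigma> h u \<and> has_decomposition (Suc R) b bs h u)"
      by (rule universal_cong) (use True in \<open>auto simp: B has_decomposition_Cons\<close>)
    ultimately show ?thesis by simp
  next
    case False
    have "universal {a..b} (has_decomposition a b (B # bs)) \<longleftrightarrow> universal {a..b} (\<lambda>h u. False)"
      by (rule universal_cong) (use False has_block_le in \<open>auto simp: B has_decomposition_Cons\<close>)
    then show ?thesis using universal_marks by simp
  qed
qed

text \<open>Every configuration has exactly one decomposition.\<close>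
lemma pr_decomposition_total:
  assumes "1 \<le> a" "a \<le> Suc b" "\<And>i. 0 < g i"
  shows "(\<Sum>bs\<in>{bs. tiles a b bs}. pr {a..b} g (has_decomposition a b bs)) = 1"
proof -
  have "pr {a..b} g (\<lambda>_ _. True) = (\<Sum>bs\<in>{bs. tiles a b bs}. pr {a..b} g (has_decomposition a b bs))"
  proof (rule pr_sum[OF finite_tiles])
    fix h u assume val: "valid h u"
    interpret particles "walk h" "\<lambda>i. fst (u i)" "\<lambda>i. snd (u i)" by (rule valid_particles[OF val])
    show "True \<longleftrightarrow> (\<exists>bs\<in>{bs. tiles a b bs}. has_decomposition a b bs h u)"
      using decomposition_exists[OF particles_axioms assms(1,2)] decomposition_tiles
      by (auto simp: has_decomposition_def)
    show "bs = bs'" if "has_decomposition a b bs h u" "has_decomposition a b bs' h u" for bs bs'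
      using decomposition_unique that by (simp add: has_decomposition_def)
  qed (use assms in auto)
  moreover have "pr {a..b} g (\<lambda>_ _. True) = 1" by (simp add: pr_def)
  ultimately show ?thesis by simp
qed

lemma universalI_pr:
  assumes "\<And>g. \<forall>i. 0 < g i \<Longrightarrow> pr A g Q = f g" "\<And>g g'. \<forall>i. 0 < g i \<Longrightarrow> \<forall>i. 0 < g' i \<Longrightarrow> f g = f g'"
  shows "universal A Q"
  using assms unfolding universal_def by metis

lemma universalD: "universal A Q \<Longrightarrow> \<forall>i. 0 < g i \<Longrightarrow> \<forall>i. 0 < g' i \<Longrightarrow> pr A g Q = pr A g' Q"
  unfolding universal_def by blast

text \<open>The static particle \<open>k\<close> is approached by \<open>a\<close> from the left and by \<open>b\<close> from the right, and each
  of them would hit it in the absence of the other. The right-hand side looks asymmetric, but by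
  \<open>block_NE_Up_iff\<close> it says that \<open>k\<close> is static, the particles on its left form a block \<open>\<nearrow>\<close>, and
  those on its right form a block \<open>\<nwarrow>\<close>.\<close>
definition contested :: "nat \<Rightarrow> nat \<Rightarrow> nat \<Rightarrow> (nat \<Rightarrow> real) \<Rightarrow> (nat \<Rightarrow> int \<times> int) \<Rightarrow> bool" where
  "contested a b k h u \<longleftrightarrow> has_block a k NE_Up h u \<and> has_block (Suc k) b NW h u"

lemma contested_flip:
  assumes val: "valid h u" and k: "k \<in> {a<..<b}"
  shows "contested a b k (flip_gaps a b h) (flip_marks a b u) \<longleftrightarrow> contested a b (a + b - k) h u"
proof -
  let ?k = "a + b - k"
  have k': "a \<le> ?k" "?k \<le> b" "a + b - ?k = k" using k by auto
  have "has_block a k NE_Up (flip_gaps a b h) (flip_marks a b u) \<longleftrightarrow> has_block ?k b Up_NW h u"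
    using has_block_flip[OF val, of a ?k b b Up_NW] k' by simp
  also have "\<dots> \<longleftrightarrow> fst (u ?k) = 0 \<and> has_block (Suc ?k) b NW h u" by (rule has_block_Up_NW[OF val])
  finally have 1: "has_block a k NE_Up (flip_gaps a b h) (flip_marks a b u) \<longleftrightarrow>
    fst (u ?k) = 0 \<and> has_block (Suc ?k) b NW h u" .
  have e: "a + b - (?k - 1) = Suc k" "a \<le> ?k - 1" "?k - 1 \<le> b" "a < ?k" using k by auto
  then have 2: "has_block (Suc k) b NW (flip_gaps a b h) (flip_marks a b u) \<longleftrightarrow> has_block a (?k - 1) NE h u"
    using has_block_flip[OF val, of a a "?k - 1" b NE] by simp
  show ?thesis
    unfolding contested_def 1 2 has_block_NE_Up[OF val e(4)] by blast
qed

text \<open>Reflection maps the event that \<open>k\<close> is contested and \<open>a\<close> wins to the event that \<open>a + b - k\<close> is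
  contested and \<open>a\<close> does not win. Summed over \<open>k\<close>, the two alternatives are equally likely.\<close>
lemma pr_contested_wins:
  assumes "a \<le> b" "\<And>i. 0 < g i"
  shows "(\<Sum>k\<in>{a<..<b}. pr {a..b} g (\<lambda>h u. contested a b k h u \<and> wins a k b h u)) =
    (\<Sum>k\<in>{a<..<b}. pr {a..b} g (contested a b k)) / 2"
proof -
  let ?W = "\<lambda>k. pr {a..b} g (\<lambda>h u. contested a b k h u \<and> wins a k b h u)"
  let ?L = "\<lambda>k. pr {a..b} g (\<lambda>h u. contested a b k h u \<and> \<not> wins a k b h u)"
  have WL: "?W k = ?L (a + b - k)" if k: "k \<in> {a<..<b}" for k
  proof -
    have "?W k = pr {a..b} g (\<lambda>h u. contested a b k (flip_gaps a b h) (flip_marks a b u) \<and>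
        wins a k b (flip_gaps a b h) (flip_marks a b u))"
      by (rule pr_flip[OF assms(1), symmetric])
    also have "\<dots> = ?L (a + b - k)"
      by (rule pr_cong) (use contested_flip wins_flip k assms(2) in auto)
    finally show ?thesis .
  qed
  have "(\<Sum>k\<in>{a<..<b}. ?W k) = (\<Sum>k\<in>{a<..<b}. ?L (a + b - k))" using WL by simp
  also have "\<dots> = (\<Sum>k\<in>{a<..<b}. ?L k)"
    by (rule sum.reindex_bij_witness[of _ "\<lambda>k. a + b - k" "\<lambda>k. a + b - k"]) auto
  finally have "(\<Sum>k\<in>{a<..<b}. ?W k) = (\<Sum>k\<in>{a<..<b}. ?L k)" .
  moreover have "(\<Sum>k\<in>{a<..<b}. pr {a..b} g (contested a b k)) = (\<Sum>k\<in>{a<..<b}. ?W k) + (\<Sum>k\<in>{a<..<b}. ?L k)"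
    unfolding sum.distrib[symmetric] by (intro sum.cong refl pr_split)
  ultimately show ?thesis by simp
qed

text \<open>The induction described at the beginning: the shapes \<open>\<uparrow>\<close>, \<open>\<uparrow>\<nwarrow>\<close> and \<open>\<nwarrow>\<close> are treated directly,
  their mirror images follow by reflection, and \<open>\<nearrow>\<nwarrow>\<close> is what remains of the total mass.\<close>
lemma universal_block:
  assumes "1 \<le> a" "a \<le> b"
  shows "universal {a..b} (has_block a b \<Sigma>)"
  using assms
proof (induction "b - a" arbitrary: a b \<Sigma> rule: less_induct)
  case less
  have a: "1 \<le> a" "a \<le> b" by fact+
  have IH: "universal {a'..b'} (has_block a' b' \<Sigma>)" if "a \<le> a'" "a' \<le> b'" "b' \<le> b" "a < a' \<or> b' < b" for a' b' \<Sigma>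
    using that a by (intro less.hyps) auto
  have Up: "universal {a..b} (has_block a b Up)"
    using universal_cong[of "{a..b}" "has_block a b Up" "\<lambda>h u. a = b \<and> fst (u a) = 0"]
      universal_marks[of "{a..b}" "\<lambda>u. a = b \<and> fst (u a) = 0"] by (simp add: has_block_Up)
  have Up_NW: "universal {a..b} (has_block a b Up_NW)"
  proof (cases "a = b")
    case True
    have "universal {a..b} (has_block a b Up_NW) \<longleftrightarrow> universal {a..b} (\<lambda>h u. False)"
      by (rule universal_cong) (use True has_block_le[of _ _ "Suc a" b NW] in \<open>auto simp: has_block_Up_NW\<close>)
    then show ?thesis using universal_marks by simp
  next
    case False
    have "universal {a..b} (\<lambda>h u. has_block (Suc a) b NW h u \<and> fst (u a) = 0)"
    proof (rule universal_factor[OF _ _ _ local_has_block])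
      show "universal {Suc a..b} (has_block (Suc a) b NW)" using False a by (intro IH) auto
    qed (use a universal_marks in auto)
    moreover have "universal {a..b} (has_block a b Up_NW) \<longleftrightarrow>
      universal {a..b} (\<lambda>h u. has_block (Suc a) b NW h u \<and> fst (u a) = 0)"
      by (rule universal_cong) (auto simp: has_block_Up_NW)
    ultimately show ?thesis by simp
  qed
  have NW: "universal {a..b} (has_block a b NW)"
  proof (cases "a = b")
    case True
    have "universal {a..b} (has_block a b NW) \<longleftrightarrow> universal {a..b} (\<lambda>h u. fst (u a) = -1)"
      by (rule universal_cong) (use True in \<open>auto simp: has_block_single_NW\<close>)
    then show ?thesis using universal_marks by simp
  next
    case False
    then have ab: "a < b" using a by simp
    \<comment> \<open>Over \<open>?I\<close> the lengths play no part beyond the two blocks; \<open>?J\<close> collects the contested cases.\<close>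
    let ?I = "{a..<b} \<times> {NE_NW, Up_NW}" and ?J = "{a<..<b} \<times> {NE_Up}"
    let ?F = "\<lambda>(k, \<Sigma>) h u. has_block a k \<Sigma> h u \<and> has_block (Suc k) b NW h u"
    have UF: "universal {a..b} (\<lambda>h u. has_block a k \<Sigma> h u \<and> has_block (Suc k) b NW h u)"
      if "k \<in> {a..<b}" for k \<Sigma>
      by (rule universal_adjacent[OF _ _ _ local_has_block IH local_has_block IH]) (use that a in auto)
    show ?thesis
    proof (rule universalI_pr)
      fix g :: "nat \<Rightarrow> real" assume g: "\<forall>i. 0 < g i"
      have "pr {a..b} g (has_block a b NW) = (\<Sum>e\<in>?I \<union> ?J. pr {a..b} g (first_encounter a b e))"
      proof (rule pr_sum)
        fix h u e e'
        assume val: "valid h u" and e: "e \<in> ?I \<union> ?J" "e' \<in> ?I \<union> ?J"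
          "first_encounter a b e h u" "first_encounter a b e' h u"
        obtain k \<Sigma> k' \<Sigma>' where [simp]: "e = (k, \<Sigma>)" "e' = (k', \<Sigma>')" by (cases e; cases e')
        show "e = e'" using first_encounter_unique[OF val, of a b k \<Sigma> k' \<Sigma>'] e by auto
      qed (use g has_block_NW[OF _ ab] in auto)
      also have "\<dots> = (\<Sum>e\<in>?I. pr {a..b} g (first_encounter a b e)) +
          (\<Sum>e\<in>?J. pr {a..b} g (first_encounter a b e))"
        by (rule sum.union_disjoint) auto
      also have "(\<Sum>e\<in>?I. pr {a..b} g (first_encounter a b e)) = (\<Sum>e\<in>?I. pr {a..b} g (?F e))"
        by (intro sum.cong refl pr_cong) (use g in \<open>auto simp: first_encounter_def\<close>)
      also have "(\<Sum>e\<in>?J. pr {a..b} g (first_encounter a b e)) =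
          (\<Sum>k\<in>{a<..<b}. pr {a..b} g (\<lambda>h u. contested a b k h u \<and> wins a k b h u))"
        by (rule sum.reindex_bij_witness[of _ "\<lambda>k. (k, NE_Up)" fst])
          (use g in \<open>auto intro!: pr_cong simp: first_encounter_def contested_def\<close>)
      also have "\<dots> = (\<Sum>k\<in>{a<..<b}. pr {a..b} g (contested a b k)) / 2"
        using pr_contested_wins[OF a(2)] g by simp
      finally show "pr {a..b} g (has_block a b NW) = (\<Sum>e\<in>?I. pr {a..b} g (?F e)) +
        (\<Sum>k\<in>{a<..<b}. pr {a..b} g (contested a b k)) / 2" .
    next
      fix g g' :: "nat \<Rightarrow> real" assume g: "\<forall>i. 0 < g i" "\<forall>i. 0 < g' i"
      have "(\<Sum>e\<in>?I. pr {a..b} g (?F e)) = (\<Sum>e\<in>?I. pr {a..b} g' (?F e))"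
        by (intro sum.cong refl) (use universalD[OF UF g] in auto)
      moreover have "(\<Sum>k\<in>{a<..<b}. pr {a..b} g (contested a b k)) = (\<Sum>k\<in>{a<..<b}. pr {a..b} g' (contested a b k))"
        unfolding contested_def by (intro sum.cong refl universalD[OF UF g]) auto
      ultimately show "(\<Sum>e\<in>?I. pr {a..b} g (?F e)) + (\<Sum>k\<in>{a<..<b}. pr {a..b} g (contested a b k)) / 2 =
        (\<Sum>e\<in>?I. pr {a..b} g' (?F e)) + (\<Sum>k\<in>{a<..<b}. pr {a..b} g' (contested a b k)) / 2" by simp
    qed
  qed
  have mirrored: "universal {a..b} (has_block a b (mirror \<Sigma>))" if U: "universal {a..b} (has_block a b \<Sigma>)" for \<Sigma>
  proof (rule universalI_pr)
    fix g :: "nat \<Rightarrow> real" assume g: "\<forall>i. 0 < g i"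
    have "pr {a..b} g (has_block a b (mirror \<Sigma>)) =
        pr {a..b} g (\<lambda>h u. has_block a b (mirror \<Sigma>) (flip_gaps a b h) (flip_marks a b u))"
      by (rule pr_flip[OF a(2), symmetric])
    also have "\<dots> = pr {a..b} g (has_block a b \<Sigma>)"
      by (rule pr_cong) (use g has_block_flip[of _ _ a a b b \<Sigma>] a(2) in auto)
    finally show "pr {a..b} g (has_block a b (mirror \<Sigma>)) = pr {a..b} g (has_block a b \<Sigma>)" .
  qed (rule universalD[OF U])
  have NE: "universal {a..b} (has_block a b NE)" using mirrored[OF NW] by simp
  have NE_Up: "universal {a..b} (has_block a b NE_Up)" using mirrored[OF Up_NW] by simp
  \<comment> \<open>the only list whose probability is not yet known to be universal\<close>
  let ?whole = "[(a, b, NE_NW)]" and ?T = "{bs. tiles a b bs}"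
  have others: "universal {a..b} (has_decomposition a b bs)" if bs: "bs \<in> ?T - {?whole}" for bs
  proof (rule universal_decomposition[OF a(1)])
    fix L R \<Sigma> assume B: "(L, R, \<Sigma>) \<in> set bs"
    have LR: "a \<le> L" "L \<le> R" "R \<le> b" using tiles_mem[OF _ B] bs by auto
    show "universal {L..R} (has_block L R \<Sigma>)"
    proof (cases "a < L \<or> R < b")
      case True then show ?thesis using IH LR by blast
    next
      case False
      then have "L = a" "R = b" using LR by auto
      have "bs = [(a, b, \<Sigma>)]"
      proof (cases bs)
        case (Cons C cs)
        obtain R0 \<Sigma>0 where C: "C = (a, R0, \<Sigma>0)" "a \<le> R0" "tiles (Suc R0) b cs"
          using bs Cons by (cases C) auto
        have "(L, R, \<Sigma>) \<notin> set cs" using tiles_mem[OF C(3)] C(2) \<open>L = a\<close> by fastforce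
        then have "C = (a, b, \<Sigma>)" using B Cons \<open>L = a\<close> \<open>R = b\<close> by auto
        then have "cs = []" using C by (cases cs) auto
        then show ?thesis using Cons \<open>C = (a, b, \<Sigma>)\<close> by simp
      qed (use B in simp)
      then have "\<Sigma> \<noteq> NE_NW" using bs by auto
      then show ?thesis using \<open>L = a\<close> \<open>R = b\<close> Up NW NE Up_NW NE_Up by (cases \<Sigma>) auto
    qed
  qed
  have NE_NW: "universal {a..b} (has_block a b NE_NW)"
  proof (rule universalI_pr)
    fix g :: "nat \<Rightarrow> real" assume g: "\<forall>i. 0 < g i"
    have "pr {a..b} g (has_block a b NE_NW) = pr {a..b} g (has_decomposition a b ?whole)"
      by (rule pr_cong) (use g in \<open>auto simp: has_decomposition_Cons has_decomposition_Nil\<close>)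
    moreover have "(\<Sum>bs\<in>?T. pr {a..b} g (has_decomposition a b bs)) =
      pr {a..b} g (has_decomposition a b ?whole) + (\<Sum>bs\<in>?T - {?whole}. pr {a..b} g (has_decomposition a b bs))"
      by (rule sum.remove[OF finite_tiles]) (use a in simp)
    ultimately show "pr {a..b} g (has_block a b NE_NW) =
      1 - (\<Sum>bs\<in>?T - {?whole}. pr {a..b} g (has_decomposition a b bs))"
      using pr_decomposition_total[of a b g] a g by simp
  next
    fix g g' :: "nat \<Rightarrow> real" assume g: "\<forall>i. 0 < g i" "\<forall>i. 0 < g' i"
    show "1 - (\<Sum>bs\<in>?T - {?whole}. pr {a..b} g (has_decomposition a b bs)) =
      1 - (\<Sum>bs\<in>?T - {?whole}. pr {a..b} g' (has_decomposition a b bs))"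
      by (intro arg_cong2[where f = minus] sum.cong refl universalD[OF others g])
  qed
  show ?case using Up NW NE Up_NW NE_Up NE_NW by (cases \<Sigma>) auto
qed

lemma universal_has_decomposition: "universal {1..n} (has_decomposition 1 n bs)"
proof (cases "tiles 1 n bs")
  case True
  show ?thesis
    by (rule universal_decomposition) (use tiles_mem[OF True] in \<open>auto intro!: universal_block\<close>)
next
  case False
  have "universal {1..n} (has_decomposition 1 n bs) \<longleftrightarrow> universal {1..n} (\<lambda>h u. False)"
    by (rule universal_cong)
      (use False particles.decomposition_tiles[OF valid_particles] in \<open>auto simp: has_decomposition_def\<close>)
  then show ?thesis using universal_marks by simp
qed

end

section \<open>From the model to finitely many configurations\<close>

text \<open>The skyline only depends on the values at \<open>{1..n}\<close>. So velocities and spins enter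
  through countably many possible values, which makes it measurable.\<close>
lemma skyline_cong:
  assumes "\<And>i. i \<in> {1..n} \<Longrightarrow> start l \<sigma> i = start l' \<sigma>' i"
    and "\<And>i. i \<in> {1..n} \<Longrightarrow> v i = v' i" "\<And>i. i \<in> {1..n} \<Longrightarrow> s i = s' i"
  shows "skyline n l v s \<sigma> = skyline n l' v' s' \<sigma>'"
proof -
  let ?x = "start l \<sigma>" and ?x' = "start l' \<sigma>'"
  have pos: "pos ?x v i t = pos ?x' v' i t" if "i \<in> {1..n}" for i t
    using assms that by (simp add: pos_def)
  have meetings: "meetings ?x v A = meetings ?x' v' A" if "A \<subseteq> {1..n}" for A
    unfolding meetings_def using pos subsetD[OF that] by auto
  have first: "first_annihilations ?x v s A = first_annihilations ?x' v' s' A" if A: "A \<subseteq> {1..n}" for A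
  proof -
    have "(i, j, t) \<in> first_annihilations ?x v s A \<longleftrightarrow> (i, j, t) \<in> first_annihilations ?x' v' s' A" for i j t
    proof (cases "i \<in> A \<and> j \<in> A")
      case True
      then have "i \<in> {1..n}" "j \<in> {1..n}" using A by auto
      moreover have "pos ?x v k t = pos ?x' v' k t" if "k \<in> A" for k using pos A that by blast
      ultimately show ?thesis
        unfolding first_annihilations_def using meetings[OF A] assms(2,3) pos by simp
    next
      case False
      then show ?thesis by (auto simp: first_annihilations_def meetings_def)
    qed
    then show ?thesis by auto
  qed
  have rem: "remaining n ?x v s m = remaining n ?x' v' s' m \<and> remaining n ?x v s m \<subseteq> {1..n}" for m
  proof (induction m)
    case (Suc m)
    then show ?case using first[of "remaining n ?x v s m"] by auto
  qed simp
  have ann: "annihilations n ?x v s = annihilations n ?x' v' s'"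
  proof -
    have "first_annihilations ?x v s (remaining n ?x v s m) =
        first_annihilations ?x' v' s' (remaining n ?x' v' s' m)" for m
    proof -
      have "remaining n ?x v s m = remaining n ?x' v' s' m" "remaining n ?x v s m \<subseteq> {1..n}"
        using rem[of m] by blast+
      then show ?thesis using first by metis
    qed
    then show ?thesis unfolding annihilations_def by simp
  qed
  have reaches: "reaches n ?x v s i y = reaches n ?x' v' s' i y" if "i \<in> {1..n}" for i y
    unfolding reaches_def annihilated_at_def ann using pos[OF that] by simp
  have hit: "hit_from_left n ?x v s y = hit_from_left n ?x' v' s' y"
    "hit_from_right n ?x v s y = hit_from_right n ?x' v' s' y" for y
    unfolding hit_from_left_def hit_from_right_def using reaches assms(1) by simp_all
  have shape: "has_shape n ?x v s L R \<Sigma> = has_shape n ?x' v' s' L R \<Sigma>"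
    if "L \<in> {1..n}" "R \<in> {1..n}" for L R \<Sigma>
    using assms that
    by (cases \<Sigma>) (simp_all add: annihilated_def annihilated_at_def annihilate_each_other_def ann hit)
  have "is_skyline n ?x v s bs = is_skyline n ?x' v' s' bs" for bs
  proof (cases "(\<Union>(L, R, \<Sigma>)\<in>set bs. {L..R}) = {1..n}")
    case True
    have "L \<le> R \<and> has_shape n ?x v s L R \<Sigma> \<longleftrightarrow> L \<le> R \<and> has_shape n ?x' v' s' L R \<Sigma>"
      if B: "(L, R, \<Sigma>) \<in> set bs" for L R \<Sigma>
    proof (cases "L \<le> R")
      case LR: True
      have "L \<in> {L..R}" "R \<in> {L..R}" using LR by auto
      then have "L \<in> {1..n}" "R \<in> {1..n}" using True B by blast+
      then show ?thesis using shape by blast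
    qed simp
    then show ?thesis unfolding is_skyline_def by (intro conj_cong ball_cong refl) auto
  next
    case False
    then show ?thesis unfolding is_skyline_def by blast
  qed
  then have "is_skyline n ?x v s = is_skyline n ?x' v' s'" by (rule ext)
  then show ?thesis unfolding skyline_def by (rule arg_cong)
qed

definition velocity_pmf :: "real \<Rightarrow> int pmf" where
  "velocity_pmf p = bind_pmf (bernoulli_pmf p) (\<lambda>b. if b then return_pmf 0 else pmf_of_set {-1, 1})"

definition mark_pmf :: "real \<Rightarrow> (int \<times> int) pmf" where
  "mark_pmf p = pair_pmf (velocity_pmf p) (pmf_of_set {-1, 1})"

lemma pmf_velocity:
  assumes "0 \<le> p" "p \<le> 1"
  shows "pmf (velocity_pmf p) (-1) = (1 - p) / 2" "pmf (velocity_pmf p) 0 = p"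
    "pmf (velocity_pmf p) 1 = (1 - p) / 2"
  using assms unfolding velocity_pmf_def by (simp_all add: pmf_bind)

lemma set_velocity: "set_pmf (velocity_pmf p) \<subseteq> {-1, 0, 1}"
  unfolding velocity_pmf_def by (auto split: if_splits)

lemma symmetric_sign: "map_pmf uminus (pmf_of_set {-1, 1 :: int}) = pmf_of_set {-1, 1}"
  by (subst map_pmf_of_set_inj) (auto simp: insert_commute)

lemma symmetric_velocity: "map_pmf uminus (velocity_pmf p) = velocity_pmf p"
  unfolding velocity_pmf_def map_bind_pmf
  by (intro bind_pmf_cong refl) (simp add: symmetric_sign)

lemma mark_law_mark_pmf: "mark_law (mark_pmf p)"
proof
  show "set_pmf (mark_pmf p) \<subseteq> {-1, 0, 1} \<times> {-1, 1}"
    using set_velocity[of p] by (auto simp: mark_pmf_def)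
  have "map_pmf uminus (mark_pmf p) = map_pmf (\<lambda>(a, b). (- a, - b)) (mark_pmf p)"
    by (intro map_pmf_cong) auto
  also have "\<dots> = mark_pmf p"
    unfolding mark_pmf_def map_pair symmetric_sign symmetric_velocity ..
  finally show "map_pmf uminus (mark_pmf p) = mark_pmf p" .
qed

definition skyline_of :: "nat \<Rightarrow> (nat \<Rightarrow> real) \<Rightarrow> (nat \<Rightarrow> int \<times> int) \<times> (nat \<Rightarrow> nat) \<Rightarrow> (nat \<times> nat \<times> shape) list" where
  "skyline_of n l = (\<lambda>(u, \<pi>). skyline n l (\<lambda>i. fst (u i)) (\<lambda>i. snd (u i)) \<pi>)"

context mark_law
begin

definition config_pmf :: "nat \<Rightarrow> ((nat \<Rightarrow> int \<times> int) \<times> (nat \<Rightarrow> nat)) pmf" where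
  "config_pmf n = pair_pmf (marks {1..n}) (perms {1..n})"

text \<open>The lengths are set to \<open>1\<close> outside \<open>{1..n}\<close> to make all gaps positive, as required by
  \<open>valid\<close>.\<close>
lemma pmf_skyline:
  assumes "l \<in> lengths n" and m: "\<And>i. m i = (if i \<in> {1..n} then l i else 1)"
  shows "pmf (map_pmf (skyline_of n l) (config_pmf n)) bs = pr {1..n} m (has_decomposition 1 n bs)"
proof -
  have m_pos: "0 < m i" for i using assms by (auto simp: lengths_def)
  have "skyline_of n l (u, \<pi>) = bs \<longleftrightarrow> has_decomposition 1 n bs (m \<circ> \<pi>) u"
    if "(u, \<pi>) \<in> set_pmf (config_pmf n)" for u \<pi>
  proof -
    have u: "u \<in> set_pmf (marks {1..n})" and \<pi>: "\<pi> permutes {1..n}"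
      using that set_perms[of "{1..n}"] by (auto simp: config_pmf_def)
    have w: "start m \<pi> = walk (m \<circ> \<pi>)" by (auto simp: start_def walk_def)
    have "valid (m \<circ> \<pi>) u" using m_pos marks_support[OF _ u] by (simp add: valid_def)
    then have "particles (start m \<pi>) (\<lambda>i. fst (u i)) (\<lambda>i. snd (u i))" unfolding w by (rule valid_particles)
    then have "skyline n m (\<lambda>i. fst (u i)) (\<lambda>i. snd (u i)) \<pi> = bs \<longleftrightarrow> has_decomposition 1 n bs (m \<circ> \<pi>) u"
      unfolding has_decomposition_def w[symmetric] by (rule skyline_eq_iff)
    moreover have "skyline n l (\<lambda>i. fst (u i)) (\<lambda>i. snd (u i)) \<pi> = skyline n m (\<lambda>i. fst (u i)) (\<lambda>i. snd (u i)) \<pi>"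
    proof (rule skyline_cong)
      fix k assume k: "k \<in> {1..n}"
      have "\<pi> i \<in> {1..n}" if "i \<in> {1..k}" for i
        using permutes_in_image[OF \<pi>, of i] that k by auto
      then show "start l \<pi> k = start m \<pi> k" unfolding start_def using m by (intro sum.cong) auto
    qed simp_all
    ultimately show ?thesis by (simp add: skyline_of_def)
  qed
  then have "pmf (map_pmf (skyline_of n l) (config_pmf n)) bs =
    measure_pmf.prob (config_pmf n) {(u, \<pi>). has_decomposition 1 n bs (m \<circ> \<pi>) u}"
    unfolding pmf_map by (intro measure_prob_cong_0) (auto simp: set_pmf_iff)
  also have "\<dots> = measure_pmf.prob (map_pmf (\<lambda>(\<pi>, u). (u, \<pi>)) (pair_pmf (perms {1..n}) (marks {1..n})))
      {(u, \<pi>). has_decomposition 1 n bs (m \<circ> \<pi>) u}"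
    unfolding config_pmf_def pair_commute_pmf[of "marks {1..n}"] ..
  also have "\<dots> = measure_pmf.prob (map_pmf (\<lambda>(\<pi>, u). (m \<circ> \<pi>, u)) (pair_pmf (perms {1..n}) (marks {1..n})))
      {(h, u). has_decomposition 1 n bs h u}"
    by (simp add: vimage_def case_prod_beta')
  also have "map_pmf (\<lambda>(\<pi>, u). (m \<circ> \<pi>, u)) (pair_pmf (perms {1..n}) (marks {1..n})) = conf {1..n} m"
    using map_pair[of "\<lambda>\<pi>. m \<circ> \<pi>" "\<lambda>u. u"] by (simp add: conf_def pmf.map_ident)
  finally show ?thesis by (simp add: pr_def)
qed

lemma skyline_law_universal:
  assumes "l \<in> lengths n" "l' \<in> lengths n"
  shows "map_pmf (skyline_of n l) (config_pmf n) = map_pmf (skyline_of n l') (config_pmf n)"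
proof (rule pmf_eqI)
  fix bs
  have "0 < (if i \<in> {1..n} then l i else 1)" "0 < (if i \<in> {1..n} then l' i else 1)" for i
    using assms by (auto simp: lengths_def)
  then show "pmf (map_pmf (skyline_of n l) (config_pmf n)) bs = pmf (map_pmf (skyline_of n l') (config_pmf n)) bs"
    unfolding pmf_skyline[OF assms(1) refl] pmf_skyline[OF assms(2) refl]
    by (intro universalD[OF universal_has_decomposition]) auto
qed

end

lemma extended_pair_eq_iff:
  assumes "\<And>i. i \<notin> I \<Longrightarrow> u i = (c, d)"
  shows "(\<lambda>i. if i \<in> I then (f i, g i) else (c, d)) = u \<longleftrightarrow> (\<forall>i\<in>I. f i = fst (u i) \<and> g i = snd (u i))"
  using assms by (auto simp: fun_eq_iff prod_eq_iff)

context particle_model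
begin

definition config :: "'w \<Rightarrow> (nat \<Rightarrow> int \<times> int) \<times> (nat \<Rightarrow> nat)" where
  "config \<omega> = (\<lambda>i. if i \<in> {1..n} then (v i \<omega>, s i \<omega>) else (0, 1), \<sigma> \<omega>)"

lemma component_random_variables: "i \<in> {1..n} \<Longrightarrow> random_variable (count_space UNIV) (v i)"
  "i \<in> {1..n} \<Longrightarrow> random_variable (count_space UNIV) (s i)"
  using v_indep s_indep by (auto simp: indep_vars_def)

lemma preimage_events: "i \<in> {1..n} \<Longrightarrow> v i -` X \<inter> space M \<in> events" "i \<in> {1..n} \<Longrightarrow> s i -` X \<inter> space M \<in> events"
  "\<sigma> -` Y \<inter> space M \<in> events"
  using component_random_variables \<sigma>_rv by (auto intro: measurable_sets)

text \<open>The permutation takes uncountably many values, but every set of permutations is measurable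
  for it by assumption; so it is enough that the marks take countably many values.\<close>
lemma config_measurable:
  assumes "1 \<le> n" shows "random_variable (count_space UNIV) config"
proof -
  let ?I = "{1..n}"
  let ?u = "\<lambda>\<omega> i. if i \<in> ?I then (v i \<omega>, s i \<omega>) else (0, 1)"
  let ?W = "(\<lambda>f i. if i \<in> ?I then f i else (0, 1)) ` (PiE ?I (\<lambda>_. UNIV :: (int \<times> int) set))"
  have count: "countable ?W" by (intro countable_image countable_PiE) auto
  have u: "?u \<in> measurable M (count_space ?W)"
    unfolding measurable_count_space_eq_countable[OF count]
  proof (intro conjI ballI)
    show "?u \<in> space M \<rightarrow> ?W"
    proof
      fix \<omega>
      show "?u \<omega> \<in> ?W"
        by (rule image_eqI[of _ _ "\<lambda>i\<in>?I. (v i \<omega>, s i \<omega>)"]) (auto simp: fun_eq_iff)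
    qed
    fix w assume "w \<in> ?W"
    then have out: "w i = (0, 1)" if "i \<notin> ?I" for i using that by auto
    have "?u -` {w} \<inter> space M =
      (\<Inter>i\<in>?I. (v i -` {fst (w i)} \<inter> space M) \<inter> (s i -` {snd (w i)} \<inter> space M))"
      using assms extended_pair_eq_iff[of ?I w 0 1, OF out] by auto
    also have "\<dots> \<in> events"
    proof (rule sets.finite_INT)
      show "(v i -` {fst (w i)} \<inter> space M) \<inter> (s i -` {snd (w i)} \<inter> space M) \<in> events" if "i \<in> ?I" for i
        by (rule sets.Int[OF preimage_events(1)[OF that] preimage_events(2)[OF that]])
    qed (use assms in auto)
    finally show "?u -` {w} \<inter> space M \<in> events" .
  qed
  have "(\<lambda>\<omega>. (\<lambda>w \<omega>. (w, \<sigma> \<omega>)) (?u \<omega>) \<omega>) \<in> measurable M (count_space UNIV)"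
  proof (rule measurable_compose_countable'[OF _ u count])
    fix w
    show "(\<lambda>\<omega>. (w, \<sigma> \<omega>)) \<in> measurable M (count_space UNIV)"
      using measurable_compose[OF \<sigma>_rv, of "\<lambda>\<pi>. (w, \<pi>)" "count_space UNIV"] by simp
  qed
  then show ?thesis by (simp add: config_def[abs_def])
qed

lemma prob_config:
  assumes "1 \<le> n" "0 \<le> p" "p \<le> 1" and z: "z \<in> set_pmf (mark_law.config_pmf (mark_pmf p) n)"
  shows "prob (config -` {z} \<inter> space M) = pmf (mark_law.config_pmf (mark_pmf p) n) z"
proof -
  interpret mark_law "mark_pmf p" by (rule mark_law_mark_pmf)
  let ?I = "{1..n}"
  obtain u \<pi> where z_eq: "z = (u, \<pi>)" by (cases z)
  have u: "u \<in> set_pmf (marks ?I)" using z by (auto simp: z_eq config_pmf_def)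
  have out: "u i = (0, 1)" if "i \<notin> ?I" for i
    using subsetD[OF set_Pi_pmf_subset[of ?I "(0, 1)" "\<lambda>_. mark_pmf p"]] u that unfolding marks_def by blast
  have u_range: "fst (u i) \<in> {-1, 0, 1}" "snd (u i) \<in> {-1, 1}" for i
    using marks_support[OF _ u, of i] by (auto simp: mem_Times_iff)
  let ?V = "\<Inter>i\<in>?I. v i -` {fst (u i)} \<inter> space M"
  let ?S = "\<Inter>i\<in>?I. s i -` {snd (u i)} \<inter> space M"
  let ?P = "\<sigma> -` {\<pi>} \<inter> space M"
  let ?E = "\<lambda>k::nat. [?V, ?S, ?P] ! k"
  have PiE_sets: "PiE ?I (\<lambda>i. {f i}) \<in> sets (Pi\<^sub>M ?I (\<lambda>_. count_space UNIV))" for f :: "nat \<Rightarrow> int"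
    by (intro sets_PiM_I_finite) auto
  have "config -` {z} \<inter> space M = (\<Inter>k\<in>{0, 1, 2}. ?E k)"
  proof -
    have "config \<omega> = z \<longleftrightarrow> (\<forall>i\<in>?I. v i \<omega> = fst (u i) \<and> s i \<omega> = snd (u i)) \<and> \<sigma> \<omega> = \<pi>" for \<omega>
    proof -
      have "(\<lambda>i. if i \<in> ?I then (v i \<omega>, s i \<omega>) else (0, 1)) = u \<longleftrightarrow>
          (\<forall>i\<in>?I. v i \<omega> = fst (u i) \<and> s i \<omega> = snd (u i))"
        by (rule extended_pair_eq_iff[OF out])
      then show ?thesis unfolding config_def z_eq prod.inject by (rule arg_cong)
    qed
    moreover have "(\<Inter>k\<in>{0, 1, 2}. ?E k) = ?V \<inter> (?S \<inter> ?P)" by simp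
    ultimately show ?thesis using assms(1) by auto
  qed
  moreover have "prob (\<Inter>k\<in>{0, 1, 2}. ?E k) = (\<Prod>k\<in>{0, 1, 2}. prob (?E k))"
  proof (rule indep_setsD[OF v_s_\<sigma>_indep])
    have "?V = (\<lambda>\<omega>. \<lambda>i\<in>?I. v i \<omega>) -` (PiE ?I (\<lambda>i. {fst (u i)})) \<inter> space M"
      using assms(1) by (auto simp: PiE_iff extensional_def)
    then have 0: "?V \<in> sets (vimage_algebra (space M) (\<lambda>\<omega>. \<lambda>i\<in>?I. v i \<omega>) (Pi\<^sub>M ?I (\<lambda>_. count_space UNIV)))"
      using in_vimage_algebra[OF PiE_sets] by simp
    have "?S = (\<lambda>\<omega>. \<lambda>i\<in>?I. s i \<omega>) -` (PiE ?I (\<lambda>i. {snd (u i)})) \<inter> space M"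
      using assms(1) by (auto simp: PiE_iff extensional_def)
    then have 1: "?S \<in> sets (vimage_algebra (space M) (\<lambda>\<omega>. \<lambda>i\<in>?I. s i \<omega>) (Pi\<^sub>M ?I (\<lambda>_. count_space UNIV)))"
      using in_vimage_algebra[OF PiE_sets] by simp
    have 2: "?P \<in> sets (vimage_algebra (space M) \<sigma> (count_space UNIV))"
      by (intro in_vimage_algebra) simp
    show "\<forall>k\<in>{0, 1, 2}. ?E k \<in> sets
      ([vimage_algebra (space M) (\<lambda>\<omega>. \<lambda>i\<in>{1..n}. v i \<omega>) (Pi\<^sub>M {1..n} (\<lambda>_. count_space UNIV)),
        vimage_algebra (space M) (\<lambda>\<omega>. \<lambda>i\<in>{1..n}. s i \<omega>) (Pi\<^sub>M {1..n} (\<lambda>_. count_space UNIV)),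
        vimage_algebra (space M) \<sigma> (count_space UNIV)] ! k)"
      using 0 1 2 by simp
  qed auto
  moreover have "prob ?V = (\<Prod>i\<in>?I. pmf (velocity_pmf p) (fst (u i)))"
  proof -
    have "prob ?V = (\<Prod>i\<in>?I. prob (v i -` {fst (u i)} \<inter> space M))"
      using assms(1) by (intro indep_varsD_finite[OF v_indep]) auto
    also have "\<dots> = (\<Prod>i\<in>?I. pmf (velocity_pmf p) (fst (u i)))"
    proof (intro prod.cong refl)
      fix i assume i: "i \<in> ?I"
      have "v i -` {c} \<inter> space M = {\<omega> \<in> space M. v i \<omega> = c}" for c by auto
      then show "prob (v i -` {fst (u i)} \<inter> space M) = pmf (velocity_pmf p) (fst (u i))"
        using u_range(1)[of i] v_law[OF i] pmf_velocity[OF assms(2,3)] by auto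
    qed
    finally show ?thesis .
  qed
  moreover have "prob ?S = (\<Prod>i\<in>?I. pmf (pmf_of_set {-1, 1}) (snd (u i)))"
  proof -
    have "prob ?S = (\<Prod>i\<in>?I. prob (s i -` {snd (u i)} \<inter> space M))"
      using assms(1) by (intro indep_varsD_finite[OF s_indep]) auto
    also have "\<dots> = (\<Prod>i\<in>?I. pmf (pmf_of_set {-1, 1}) (snd (u i)))"
    proof (intro prod.cong refl)
      fix i assume i: "i \<in> ?I"
      have "prob (s i -` {snd (u i)} \<inter> space M) = measure (distr M (count_space UNIV) (s i)) {snd (u i)}"
        by (rule measure_distr[symmetric]) (use component_random_variables i in auto)
      then show "prob (s i -` {snd (u i)} \<inter> space M) = pmf (pmf_of_set {-1, 1}) (snd (u i))"
        unfolding s_law[OF i] by (simp add: measure_pmf_single)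
    qed
    finally show ?thesis .
  qed
  moreover have "prob ?P = pmf (perms ?I) \<pi>"
  proof -
    have "prob ?P = measure (distr M (count_space UNIV) \<sigma>) {\<pi>}"
      by (rule measure_distr[symmetric]) (use \<sigma>_rv in auto)
    then show ?thesis unfolding \<sigma>_law perms_def by (simp add: measure_pmf_single)
  qed
  moreover have "pmf (config_pmf n) z = (\<Prod>i\<in>?I. pmf (velocity_pmf p) (fst (u i))) *
    (\<Prod>i\<in>?I. pmf (pmf_of_set {-1, 1}) (snd (u i))) * pmf (perms ?I) \<pi>"
  proof -
    have "pmf (mark_pmf p) (u i) = pmf (velocity_pmf p) (fst (u i)) * pmf (pmf_of_set {-1, 1}) (snd (u i))" for i
      unfolding mark_pmf_def by (cases "u i") (simp add: pmf_pair)
    moreover have "pmf (marks ?I) u = (\<Prod>i\<in>?I. pmf (mark_pmf p) (u i))"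
      unfolding marks_def by (rule pmf_Pi'[OF _ out]) simp_all
    ultimately show ?thesis
      unfolding z_eq config_pmf_def pmf_pair by (simp only: prod.distrib)
  qed
  ultimately show ?thesis by simp
qed

text \<open>The point masses of the finitely many possible configurations already add up to one, so they
  determine the law.\<close>
lemma distr_config:
  assumes "1 \<le> n" "0 \<le> p" "p \<le> 1"
  shows "distr M (count_space UNIV) config = measure_pmf (mark_law.config_pmf (mark_pmf p) n)"
proof -
  interpret mark_law "mark_pmf p" by (rule mark_law_mark_pmf)
  let ?K = "set_pmf (config_pmf n)"
  have fin: "finite ?K"
  proof -
    have "finite (set_pmf (mark_pmf p))" using U_support finite_subset by blast
    then have "finite (set_pmf (marks {1..n}))"
      unfolding marks_def set_Pi_pmf[OF finite_atLeastAtMost] by (intro finite_PiE_dflt) auto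
    moreover have "finite (set_pmf (perms {1..n}))"
      unfolding set_perms[OF finite_atLeastAtMost] by (rule finite_permutations) simp
    ultimately show ?thesis by (simp add: config_pmf_def)
  qed
  have meas: "config -` X \<inter> space M \<in> events" for X
    using measurable_sets[OF config_measurable[OF assms(1)]] by simp
  have sum: "prob (config -` X \<inter> space M) = measure_pmf.prob (config_pmf n) X" if "X \<subseteq> ?K" for X
  proof -
    have X: "finite X" using that fin finite_subset by blast
    have "config -` X \<inter> space M = (\<Union>z\<in>X. config -` {z} \<inter> space M)" by auto
    then have "prob (config -` X \<inter> space M) = (\<Sum>z\<in>X. prob (config -` {z} \<inter> space M))"
      using X meas by (simp only:) (intro finite_measure_finite_Union, auto simp: disjoint_family_on_def)
    also have "\<dots> = (\<Sum>z\<in>X. pmf (config_pmf n) z)"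
      using that by (intro sum.cong refl prob_config[OF assms]) auto
    also have "\<dots> = measure_pmf.prob (config_pmf n) X" using X by (rule measure_measure_pmf_finite[symmetric])
    finally show ?thesis .
  qed
  have "prob (config -` ?K \<inter> space M) = 1" using sum[of ?K] by (simp add: measure_pmf.prob_eq_1 AE_measure_pmf)
  then have null: "AE \<omega> in M. config \<omega> \<in> ?K"
    using meas by (subst (asm) prob_eq_1) auto
  show ?thesis
  proof (rule measure_eqI)
    fix X
    have "emeasure (distr M (count_space UNIV) config) X = ennreal (prob (config -` X \<inter> space M))"
      using config_measurable[OF assms(1)] by (simp add: emeasure_distr emeasure_eq_measure)
    also have "prob (config -` X \<inter> space M) = prob (config -` (X \<inter> ?K) \<inter> space M)"
      by (rule finite_measure_eq_AE) (use null meas[of X] meas[of "X \<inter> ?K"] in auto)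
    also have "\<dots> = measure_pmf.prob (config_pmf n) X" using sum[of "X \<inter> ?K"] by (simp add: measure_Int_set_pmf)
    finally show "emeasure (distr M (count_space UNIV) config) X = emeasure (measure_pmf (config_pmf n)) X"
      by (simp add: measure_pmf.emeasure_eq_measure)
  qed simp
qed

lemma skyline_config: "skyline n l (\<lambda>i. v i \<omega>) (\<lambda>i. s i \<omega>) (\<sigma> \<omega>) = skyline_of n l (config \<omega>)"
  unfolding skyline_of_def config_def by (auto intro!: skyline_cong)

lemma distr_skyline:
  assumes "1 \<le> n" "0 \<le> p" "p \<le> 1"
  shows "distr M (count_space UNIV) (\<lambda>\<omega>. skyline n l (\<lambda>i. v i \<omega>) (\<lambda>i. s i \<omega>) (\<sigma> \<omega>)) =
    measure_pmf (map_pmf (skyline_of n l) (mark_law.config_pmf (mark_pmf p) n))"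
proof -
  have "distr M (count_space UNIV) (skyline_of n l \<circ> config) =
      distr (distr M (count_space UNIV) config) (count_space UNIV) (skyline_of n l)"
    by (rule distr_distr[symmetric]) (use config_measurable[OF assms(1)] in auto)
  then show ?thesis
    unfolding skyline_config distr_config[OF assms] map_pmf_rep_eq by (simp add: o_def)
qed

end

theorem theorem1:
  fixes M :: "'w measure" and n :: nat and p :: real
    and v s :: "nat \<Rightarrow> 'w \<Rightarrow> int" and \<sigma> :: "'w \<Rightarrow> nat \<Rightarrow> nat"
    and l l' :: "nat \<Rightarrow> real"
  assumes "0 \<le> p" and "p \<le> 1" and "n \<ge> 1"
    and "particle_model M n p v s \<sigma>"
    and "l \<in> lengths n" and "l' \<in> lengths n"
  shows "distr M (count_space UNIV) (\<lambda>\<omega>. skyline n l (\<lambda>i. v i \<omega>) (\<lambda>i. s i \<omega>) (\<sigma> \<omega>)) =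
         distr M (count_space UNIV) (\<lambda>\<omega>. skyline n l' (\<lambda>i. v i \<omega>) (\<lambda>i. s i \<omega>) (\<sigma> \<omega>))"
proof -
  interpret particle_model M n p v s \<sigma> by fact
  show ?thesis
    unfolding distr_skyline[OF assms(3,1,2)]
      mark_law.skyline_law_universal[OF mark_law_mark_pmf assms(5,6)] ..
qed

end
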